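(* Let $K\ge0$ and let $(X,d,\mu)$ be an $\mathrm{RCD}(-K,\infty)$ space with $\mu$ a probability measure. Assume that there exists $\epsilon>0$ such that $$\int_X e^{(K/2+\epsilon)\,d(o,x)^2}\,\mathrm{d}\mu(x)<\infty\quad\text{for some fixed point }o\in X.$$ Then there is a constant $C>0$ such that the log-Sobolev inequality $$\int_X f^2\log f^2\,\mathrm{d}\mu\le C\,\mathcal{E}(f,f)$$ holds for all $f\in\mathcal{D}(\mathcal{E})$ with $\int_X f^2\,\mathrm{d}\mu=1$, where $\mathcal{E}$ is the Dirichlet form associated with the Cheeger energy, $\mathcal{E}(f,f)=2\,\mathrm{Ch}(f)$ for $f\in\mathcal{D}(\mathcal{E})=W^{1,2}(X,d,\mu)$.
   Context: Setting. $(X,d)$ is a Polish (complete separable metric) space and $\mu$ is a nonnegative $\sigma$-finite Borel measure with support $X$ and $\mu(B(x,r))<\infty$ for all $x\in X$, $r>0$ (here $\mu(X)=1$). $\mathcal{P}_2(X)$ is the set of Borel probability measures $\nu$ on $X$ with $\int_X d(o,\cdot)^2\,\mathrm{d}\nu<\infty$ for some (hence any) $o\in X$. For $\nu_1,\nu_2\in\mathcal{P}_2(X)$, $W_2(\nu_1,\nu_2)=\inf_\pi\big(\int_{X\times X} d(x,y)^2\,\mathrm{d}\pi(x,y)\big)^{1/2}$, the infimum being over couplings $\pi$ of $\nu_1$ and $\nu_2$. A curve $\{\eta_t\}_{t\in[0,1]}$ in a metric space is a geodesic if the distance between $\eta_s$ and $\eta_t$ equals $|t-s|$ times the distance between $\eta_0$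 and $\eta_1$ for all $s,t\in[0,1]$. Relative entropy. For $\rho\in\mathcal{P}_2(X)$, $\mathrm{Ent}_\mu(\rho)=\lim_{\varepsilon\downarrow0}\int_{\{f>\varepsilon\}} f\log f\,\mathrm{d}\mu$ if $\rho=f\mu$, and $\mathrm{Ent}_\mu(\rho)=\infty$ otherwise; $\mathcal{D}(\mathrm{Ent}_\mu)=\{\rho\in\mathcal{P}_2(X):\mathrm{Ent}_\mu(\rho)<\infty\}$. Cheeger energy. For a bounded Lipschitz function $f$, $|Df|(x)=\limsup_{y\to x}|f(y)-f(x)|/d(y,x)$. For $f\in L^2(X,\mu)$, $$\mathrm{Ch}(f)=\inf\Big\{\liminf_{n\to\infty}\tfrac12\int_X|Df_n|^2\,\mathrm{d}\mu:\ f_n \text{ bounded Lipschitz},\ \|f_n-f\|_{L^2(X,\mu)}\to0\Big\}\in[0,\infty],$$ and $W^{1,2}(X,d,\mu)=\{f\in L^2(X,\mu):\mathrm{Ch}(f)<\infty\}$. $\mathrm{RCD}(\kappa,\infty)$ for $\kappa\in\mathbb{R}$. $(X,d,\mu)$ is a $\mathrm{CD}(\kappa,\infty)$ space if for all $\eta_0,\eta_1\in\mathcal{D}(\mathrm{Ent}_\mu)$ there is a geodesic $\{\eta_t\}_{0\le t\le1}\subset(\mathcal{P}_2(X),W_2)$ with $$\mathrm{Ent}_\mu(\eta_t)\le(1-t)\mathrm{Ent}_\mu(\eta_0)+t\,\mathrm{Ent}_\mu(\eta_1)-\tfrac{\kappa}{2} t(1-t)W_2(\eta_0,\eta_1)^2\quad\text{for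 all }t\in[0,1].$$ It is an $\mathrm{RCD}(\kappa,\infty)$ space if in addition $\mathrm{Ch}$ is a quadratic form, i.e. $\mathrm{Ch}(f+g)+\mathrm{Ch}(f-g)=2\mathrm{Ch}(f)+2\mathrm{Ch}(g)$ for all $f,g\in L^2(X,\mu)$. In the theorem $\kappa=-K$. Dirichlet form. When $\mathrm{Ch}$ is quadratic, $\mathcal{E}$ is the unique symmetric bilinear form on $\mathcal{D}(\mathcal{E})=W^{1,2}(X,d,\mu)$ with $\mathcal{E}(f,f)=2\,\mathrm{Ch}(f)$. The convention $0\log0=0$ is used. *)

theory Defs
  imports "HOL-Probability.Probability"
begin

section \<open>Metric measure spaces\<close>

text \<open>
  The Polish space \<open>(X, d)\<close> is a type of class \<^class>\<open>polish_space\<close> (complete, separable, with its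
  metric \<^const>\<open>dist\<close>).
\<close>

definition measure_support :: "'a::metric_space measure \<Rightarrow> 'a set" where
  "measure_support M = {x. \<forall>r>0. emeasure M (ball x r) > 0}"

definition metric_measure_space :: "'a::polish_space measure \<Rightarrow> bool" where
  "metric_measure_space M \<longleftrightarrow>
     sets M = sets borel \<and> sigma_finite_measure M \<and> measure_support M = UNIV \<and>
     (\<forall>x. \<forall>r>0. emeasure M (ball x r) < \<infinity>)"

section \<open>The Wasserstein space\<close>

definition P2 :: "'a::polish_space measure set" where
  "P2 = {\<nu>. sets \<nu> = sets borel \<and> prob_space \<nu> \<and>
             (\<exists>p. (\<integral>\<^sup>+x. ennreal ((dist p x)\<^sup>2) \<partial>\<nu>) < \<infinity>)}"

definition couplings :: "'a::polish_space measure \<Rightarrow> 'a measure \<Rightarrow> ('a \<times> 'a) measure set" where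
  "couplings \<nu>1 \<nu>2 = {\<pi>. sets \<pi> = sets (borel \<Otimes>\<^sub>M borel) \<and>
                        distr \<pi> borel fst = \<nu>1 \<and> distr \<pi> borel snd = \<nu>2}"

text \<open>
  The infimum is finite on \<^const>\<open>P2\<close> (take the product coupling), so \<^const>\<open>enn2real\<close> only
  changes the type there.
\<close>

definition W2 :: "'a::polish_space measure \<Rightarrow> 'a measure \<Rightarrow> real" where
  "W2 \<nu>1 \<nu>2 = sqrt (enn2real (INF \<pi>\<in>couplings \<nu>1 \<nu>2. \<integral>\<^sup>+z. ennreal ((dist (fst z) (snd z))\<^sup>2) \<partial>\<pi>))"

definition geodesic_in :: "'b set \<Rightarrow> ('b \<Rightarrow> 'b \<Rightarrow> real) \<Rightarrow> (real \<Rightarrow> 'b) \<Rightarrow> bool" where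
  "geodesic_in S D \<eta> \<longleftrightarrow>
     (\<forall>t\<in>{0..1}. \<eta> t \<in> S) \<and>
     (\<forall>s\<in>{0..1}. \<forall>t\<in>{0..1}. D (\<eta> s) (\<eta> t) = \<bar>t - s\<bar> * D (\<eta> 0) (\<eta> 1))"

section \<open>Relative entropy\<close>

text \<open>
  Integral with values in \<^typ>\<open>ereal\<close>. It is only used for functions whose negative part has a
  finite integral, so \<open>\<infinity> - \<infinity>\<close> does not occur. Unlike for \<^const>\<open>lebesgue_integral\<close>,
  a function whose positive part is not integrable gets the value \<open>\<infinity>\<close> rather than \<open>0\<close>.
\<close>

definition ext_integral :: "'a measure \<Rightarrow> ('a \<Rightarrow> real) \<Rightarrow> ereal" where
  "ext_integral M g =
     enn2ereal (\<integral>\<^sup>+x. ennreal (g x) \<partial>M) - enn2ereal (\<integral>\<^sup>+x. ennreal (- g x) \<partial>M)"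

text \<open>
  If \<open>\<rho>\<close> has a density then \<^term>\<open>RN_deriv M \<rho>\<close> is one, finite almost everywhere when \<open>\<rho>\<close> is a
  probability measure and \<open>M\<close> is sigma-finite.
\<close>

definition Ent :: "'a measure \<Rightarrow> 'a measure \<Rightarrow> ereal" where
  "Ent M \<rho> =
     (if \<exists>h\<in>borel_measurable M. \<rho> = density M h
      then let f = (\<lambda>x. enn2real (RN_deriv M \<rho> x)) in
           Lim (at_right 0) (\<lambda>\<epsilon>::real. ext_integral M (\<lambda>x. indicator {y. f y > \<epsilon>} x * (f x * ln (f x))))
      else \<infinity>)"

definition Ent_domain :: "'a::polish_space measure \<Rightarrow> 'a measure set" where
  "Ent_domain M = {\<rho>\<in>P2. Ent M \<rho> < \<infinity>}"

section \<open>Cheeger energy\<close>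

text \<open>
  At an isolated point the filter \<^term>\<open>at x\<close> is trivial, and the upper limit in \<^typ>\<open>ennreal\<close> is
  then \<open>0\<close>, the usual convention.
\<close>

definition local_lip :: "('a::metric_space \<Rightarrow> real) \<Rightarrow> 'a \<Rightarrow> ennreal" where
  "local_lip f x = Limsup (at x) (\<lambda>y. ennreal (\<bar>f y - f x\<bar> / dist y x))"

definition bounded_lipschitz :: "('a::metric_space \<Rightarrow> real) \<Rightarrow> bool" where
  "bounded_lipschitz f \<longleftrightarrow> bounded (range f) \<and> (\<exists>L. L-lipschitz_on UNIV f)"

text \<open>
  Elements of \<open>L\<^sup>2\<close> are represented by functions; all notions below depend on them only up to
  equality almost everywhere.
\<close>

definition L2 :: "'a measure \<Rightarrow> ('a \<Rightarrow> real) set" where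
  "L2 M = {f \<in> borel_measurable M. integrable M (\<lambda>x. (f x)\<^sup>2)}"

definition L2_norm :: "'a measure \<Rightarrow> ('a \<Rightarrow> real) \<Rightarrow> real" where
  "L2_norm M f = sqrt (\<integral>x. (f x)\<^sup>2 \<partial>M)"

text \<open>
  Convergence of \<open>F n\<close> to \<open>f\<close> in \<open>L\<^sup>2\<close> entails that \<open>F n\<close> is in \<open>L\<^sup>2\<close>; this has to be said because
  the Bochner integral of a non-integrable function is \<open>0\<close>.
\<close>

definition Cheeger_approx :: "'a::metric_space measure \<Rightarrow> ('a \<Rightarrow> real) \<Rightarrow> (nat \<Rightarrow> 'a \<Rightarrow> real) set" where
  "Cheeger_approx M f =
     {F. (\<forall>n. bounded_lipschitz (F n) \<and> F n \<in> L2 M) \<and>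
         (\<lambda>n. L2_norm M (\<lambda>x. F n x - f x)) \<longlonglongrightarrow> 0}"

definition Ch :: "'a::metric_space measure \<Rightarrow> ('a \<Rightarrow> real) \<Rightarrow> ennreal" where
  "Ch M f = (INF F\<in>Cheeger_approx M f. liminf (\<lambda>n. (\<integral>\<^sup>+x. (local_lip (F n) x)\<^sup>2 \<partial>M) / 2))"

definition W12 :: "'a::metric_space measure \<Rightarrow> ('a \<Rightarrow> real) set" where
  "W12 M = {f \<in> L2 M. Ch M f < \<infinity>}"

definition Ch_quadratic :: "'a::metric_space measure \<Rightarrow> bool" where
  "Ch_quadratic M \<longleftrightarrow>
     (\<forall>f\<in>L2 M. \<forall>g\<in>L2 M.
        Ch M (\<lambda>x. f x + g x) + Ch M (\<lambda>x. f x - g x) = 2 * Ch M f + 2 * Ch M g)"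

section \<open>Curvature-dimension conditions\<close>

definition CD_space :: "real \<Rightarrow> 'a::polish_space measure \<Rightarrow> bool" where
  "CD_space \<kappa> M \<longleftrightarrow> metric_measure_space M \<and>
     (\<forall>\<eta>0\<in>Ent_domain M. \<forall>\<eta>1\<in>Ent_domain M. \<exists>\<eta>.
        geodesic_in P2 W2 \<eta> \<and> \<eta> 0 = \<eta>0 \<and> \<eta> 1 = \<eta>1 \<and>
        (\<forall>t\<in>{0..1}. Ent M (\<eta> t) \<le>
           ereal (1 - t) * Ent M \<eta>0 + ereal t * Ent M \<eta>1
           - ereal (\<kappa> / 2 * t * (1 - t) * (W2 \<eta>0 \<eta>1)\<^sup>2)))"

definition RCD_space :: "real \<Rightarrow> 'a::polish_space measure \<Rightarrow> bool" where
  "RCD_space \<kappa> M \<longleftrightarrow> CD_space \<kappa> M \<and> Ch_quadratic M"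

section \<open>The Dirichlet form\<close>

text \<open>
  Forms on the domain \<^term>\<open>W12 M\<close> are extended by \<open>0\<close> to all pairs of functions, which makes the
  form unique as a HOL function.
\<close>

definition is_dirichlet_form ::
    "'a::metric_space measure \<Rightarrow> (('a \<Rightarrow> real) \<Rightarrow> ('a \<Rightarrow> real) \<Rightarrow> real) \<Rightarrow> bool" where
  "is_dirichlet_form M E \<longleftrightarrow>
     (\<forall>f\<in>W12 M. \<forall>g\<in>W12 M. E f g = E g f) \<and>
     (\<forall>f\<in>W12 M. \<forall>g\<in>W12 M. \<forall>h\<in>W12 M. E (\<lambda>x. f x + g x) h = E f h + E g h) \<and>
     (\<forall>f\<in>W12 M. \<forall>g\<in>W12 M. \<forall>c. E (\<lambda>x. c * f x) g = c * E f g) \<and>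
     (\<forall>f\<in>W12 M. E f f = 2 * enn2real (Ch M f)) \<and>
     (\<forall>f g. f \<notin> W12 M \<or> g \<notin> W12 M \<longrightarrow> E f g = 0)"

definition dirichlet_form ::
    "'a::metric_space measure \<Rightarrow> ('a \<Rightarrow> real) \<Rightarrow> ('a \<Rightarrow> real) \<Rightarrow> real" where
  "dirichlet_form M = (THE E. is_dirichlet_form M E)"

subsection \<open>Existence and uniqueness\<close>

lemma L2_add:
  assumes "f \<in> L2 M" "g \<in> L2 M"
  shows "(\<lambda>x. f x + g x) \<in> L2 M"
proof -
  have [measurable]: "f \<in> borel_measurable M" "g \<in> borel_measurable M"
    and i: "integrable M (\<lambda>x. (f x)\<^sup>2)" "integrable M (\<lambda>x. (g x)\<^sup>2)"
    using assms by (auto simp: L2_def)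
  have "integrable M (\<lambda>x. (f x + g x)\<^sup>2)"
  proof (rule Bochner_Integration.integrable_bound)
    show "integrable M (\<lambda>x. 2 * (f x)\<^sup>2 + 2 * (g x)\<^sup>2)" using i by auto
    have "(f x + g x)\<^sup>2 \<le> 2 * (f x)\<^sup>2 + 2 * (g x)\<^sup>2" for x
      using zero_le_power2[of "f x - g x"] by (simp add: power2_eq_square algebra_simps)
    then show "AE x in M. norm ((f x + g x)\<^sup>2) \<le> norm (2 * (f x)\<^sup>2 + 2 * (g x)\<^sup>2)" by simp
  qed measurable
  then show ?thesis by (simp add: L2_def)
qed

lemma L2_cmult:
  assumes "f \<in> L2 M"
  shows "(\<lambda>x. c * f x) \<in> L2 M"
  using assms by (auto simp: L2_def power_mult_distrib)

lemma nn_integral_cmult_pos_le: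
  assumes "0 < c" "c < \<infinity>"
  shows "(\<integral>\<^sup>+x. c * f x \<partial>M) \<le> c * (\<integral>\<^sup>+x. f x \<partial>M)"
  unfolding nn_integral_def
proof (rule SUP_least)
  fix g assume "g \<in> {g. simple_function M g \<and> g \<le> (\<lambda>x. c * f x)}"
  then have g: "simple_function M g" "\<And>x. g x \<le> c * f x" by (auto simp: le_fun_def)
  let ?h = "\<lambda>x. (1 / c) * g x"
  have c1: "c * (1 / c) = 1"
    using assms by (simp add: ennreal_times_divide ennreal_divide_self)
  have c2: "c * ((1 / c) * y) = y" "(1 / c) * (c * y) = y" for y
    using c1 by (metis mult.assoc mult.commute mult_1)+
  have h: "simple_function M ?h" using g(1) by (intro simple_function_mult simple_function_const)
  have "?h x \<le> f x" for x using mult_left_mono[OF g(2)[of x], of "1 / c"] c2 by simp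
  then have "integral\<^sup>S M ?h \<le> (SUP g\<in>{g. simple_function M g \<and> g \<le> f}. integral\<^sup>S M g)"
    using h by (intro SUP_upper) (auto simp: le_fun_def)
  then have "c * integral\<^sup>S M ?h \<le> c * (SUP g\<in>{g. simple_function M g \<and> g \<le> f}. integral\<^sup>S M g)"
    by (rule mult_left_mono) simp
  moreover have "c * integral\<^sup>S M ?h = integral\<^sup>S M g"
    using g(1) c2 by simp
  ultimately show "integral\<^sup>S M g \<le> c * (SUP g\<in>{g. simple_function M g \<and> g \<le> f}. integral\<^sup>S M g)"
    by simp
qed

lemma local_lip_cmult_le:
  "local_lip (\<lambda>x. c * f x) x \<le> ennreal \<bar>c\<bar> * local_lip f x"
proof (cases "at x = bot")
  case True
  have "Limsup bot u = (0 :: ennreal)" for u :: "'a \<Rightarrow> ennreal"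
  proof -
    have "Limsup bot u \<le> (SUP x\<in>Collect (\<lambda>_. False). u x)"
      unfolding Limsup_def by (intro INF_lower) simp
    then show ?thesis by (simp add: bot_ennreal)
  qed
  then show ?thesis using True by (simp add: local_lip_def)
next
  case False
  have "ennreal (\<bar>c * f y - c * f x\<bar> / dist y x) = ennreal \<bar>c\<bar> * ennreal (\<bar>f y - f x\<bar> / dist y x)" for y
    by (simp add: ennreal_mult[symmetric] right_diff_distrib[symmetric] abs_mult)
  then have "local_lip (\<lambda>x. c * f x) x = Limsup (at x) (\<lambda>y. ennreal \<bar>c\<bar> * ennreal (\<bar>f y - f x\<bar> / dist y x))"
    by (simp add: local_lip_def)
  also have "\<dots> = ennreal \<bar>c\<bar> * Limsup (at x) (\<lambda>y. ennreal (\<bar>f y - f x\<bar> / dist y x))"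
    using False
    by (intro Limsup_compose_continuous_mono)
       (auto intro!: monoI mult_left_mono simp: continuous_on_def
          intro: ennreal_tendsto_cmult)
  finally show ?thesis by (simp add: local_lip_def)
qed

lemma bounded_lipschitz_cmult:
  assumes "bounded_lipschitz f"
  shows "bounded_lipschitz (\<lambda>x. c * f x)"
proof -
  obtain L where "bounded (range f)" "L-lipschitz_on UNIV f"
    using assms by (auto simp: bounded_lipschitz_def)
  then have "bounded ((\<lambda>x. c *\<^sub>R x) ` range f)" "(\<bar>c\<bar> * L)-lipschitz_on UNIV (\<lambda>x. c * f x)"
    by (blast intro: bounded_scaling lipschitz_on_cmult_real)+
  then show ?thesis by (auto simp: bounded_lipschitz_def image_image)
qed

lemma Ch_cmult_le:
  assumes "c \<noteq> 0"
  shows "Ch M (\<lambda>x. c * f x) \<le> ennreal (c\<^sup>2) * Ch M f"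
proof -
  have *: "Ch M (\<lambda>x. c * f x) \<le> ennreal (c\<^sup>2) * liminf (\<lambda>n. (\<integral>\<^sup>+x. (local_lip (F n) x)\<^sup>2 \<partial>M) / 2)"
    if F: "F \<in> Cheeger_approx M f" for F
  proof -
    let ?G = "\<lambda>n x. c * F n x"
    have "L2_norm M (\<lambda>x. ?G n x - c * f x) = \<bar>c\<bar> * L2_norm M (\<lambda>x. F n x - f x)" for n
      by (simp add: L2_norm_def right_diff_distrib[symmetric] power_mult_distrib real_sqrt_mult)
    then have "?G \<in> Cheeger_approx M (\<lambda>x. c * f x)"
      using F tendsto_mult_right[of "\<lambda>n. L2_norm M (\<lambda>x. F n x - f x)" 0 sequentially "\<bar>c\<bar>"]
      by (auto simp: Cheeger_approx_def bounded_lipschitz_cmult L2_cmult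
            intro: tendsto_mult_right_zero)
    then have "Ch M (\<lambda>x. c * f x) \<le> liminf (\<lambda>n. (\<integral>\<^sup>+x. (local_lip (?G n) x)\<^sup>2 \<partial>M) / 2)"
      unfolding Ch_def by (rule INF_lower)
    also have "\<dots> \<le> liminf (\<lambda>n. ennreal (c\<^sup>2) * ((\<integral>\<^sup>+x. (local_lip (F n) x)\<^sup>2 \<partial>M) / 2))"
    proof (intro Liminf_mono always_eventually allI)
      fix n
      have "(local_lip (?G n) x)\<^sup>2 \<le> ennreal (c\<^sup>2) * (local_lip (F n) x)\<^sup>2" for x
        using power_mono[OF local_lip_cmult_le[of c "F n" x], of 2]
        by (simp add: power_mult_distrib ennreal_power)
      then have "(\<integral>\<^sup>+x. (local_lip (?G n) x)\<^sup>2 \<partial>M) \<le> (\<integral>\<^sup>+x. ennreal (c\<^sup>2) * (local_lip (F n) x)\<^sup>2 \<partial>M)"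
        by (intro nn_integral_mono)
      also have "\<dots> \<le> ennreal (c\<^sup>2) * (\<integral>\<^sup>+x. (local_lip (F n) x)\<^sup>2 \<partial>M)"
        using assms by (intro nn_integral_cmult_pos_le) auto
      finally show "(\<integral>\<^sup>+x. (local_lip (?G n) x)\<^sup>2 \<partial>M) / 2 \<le> ennreal (c\<^sup>2) * ((\<integral>\<^sup>+x. (local_lip (F n) x)\<^sup>2 \<partial>M) / 2)"
        by (metis divide_right_mono_ennreal ennreal_times_divide)
    qed
    also have "\<dots> = ennreal (c\<^sup>2) * liminf (\<lambda>n. (\<integral>\<^sup>+x. (local_lip (F n) x)\<^sup>2 \<partial>M) / 2)"
      by (intro Liminf_compose_continuous_mono)
         (auto intro!: monoI mult_left_mono simp: continuous_on_def intro: ennreal_tendsto_cmult)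
    finally show ?thesis .
  qed
  have "ennreal (1 / c\<^sup>2) * Ch M (\<lambda>x. c * f x) \<le> Ch M f"
    unfolding Ch_def[of M f]
  proof (rule INF_greatest)
    fix F assume "F \<in> Cheeger_approx M f"
    from mult_left_mono[OF *[OF this], of "ennreal (1 / c\<^sup>2)"]
    show "ennreal (1 / c\<^sup>2) * Ch M (\<lambda>x. c * f x) \<le> liminf (\<lambda>n. (\<integral>\<^sup>+x. (local_lip (F n) x)\<^sup>2 \<partial>M) / 2)"
      using assms by (simp add: mult.assoc[symmetric] ennreal_mult[symmetric])
  qed
  from mult_left_mono[OF this, of "ennreal (c\<^sup>2)"] show ?thesis
    using assms by (simp add: mult.assoc[symmetric] ennreal_mult[symmetric])
qed

lemma Ch_cmult:
  assumes "c \<noteq> 0"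
  shows "Ch M (\<lambda>x. c * f x) = ennreal (c\<^sup>2) * Ch M f"
proof (rule antisym)
  show "Ch M (\<lambda>x. c * f x) \<le> ennreal (c\<^sup>2) * Ch M f" using assms by (rule Ch_cmult_le)
  have "Ch M f \<le> ennreal ((1 / c)\<^sup>2) * Ch M (\<lambda>x. c * f x)"
    using Ch_cmult_le[of "1 / c" M "\<lambda>x. c * f x"] assms by simp
  from mult_left_mono[OF this, of "ennreal (c\<^sup>2)"]
  show "ennreal (c\<^sup>2) * Ch M f \<le> Ch M (\<lambda>x. c * f x)"
    using assms by (simp add: mult.assoc[symmetric] ennreal_mult[symmetric] power_divide)
qed

lemma Ch_zero: "Ch M (\<lambda>x. 0) = 0"
proof -
  have "local_lip (\<lambda>x. 0) x = 0" for x :: 'a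
    using local_lip_cmult_le[of 0 "\<lambda>x. 0" x] by simp
  moreover have "(\<lambda>n x. 0) \<in> Cheeger_approx M (\<lambda>x. 0)"
    by (auto simp: Cheeger_approx_def bounded_lipschitz_def L2_def L2_norm_def
        intro: lipschitz_on_constant)
  ultimately have "Ch M (\<lambda>x. 0) \<le> liminf (\<lambda>n. (\<integral>\<^sup>+x. 0 \<partial>M) / 2)"
    unfolding Ch_def by (intro INF_lower2[of "\<lambda>n x. 0"]) auto
  then show ?thesis by (simp add: Liminf_const)
qed

lemma additive_bounded_imp_linear:
  fixes \<phi> :: "real \<Rightarrow> real"
  assumes add: "\<And>a b. \<phi> (a + b) = \<phi> a + \<phi> b"
    and bdd: "\<And>a. \<bar>a\<bar> \<le> 1 \<Longrightarrow> \<bar>\<phi> a\<bar> \<le> B"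
  shows "\<phi> a = a * \<phi> 1"
proof -
  define \<psi> where "\<psi> a = \<phi> a - a * \<phi> 1" for a
  have \<psi>_add: "\<psi> (a + b) = \<psi> a + \<psi> b" for a b by (simp add: \<psi>_def add algebra_simps)
  have \<psi>0: "\<psi> 0 = 0" using \<psi>_add[of 0 0] by simp
  have \<psi>1: "\<psi> 1 = 0" by (simp add: \<psi>_def)
  have \<psi>_nat: "\<psi> (real n * a) = real n * \<psi> a" for n a
    by (induction n) (simp_all add: \<psi>0 \<psi>_add algebra_simps)
  have \<psi>_neg: "\<psi> (- a) = - \<psi> a" for a using \<psi>_add[of a "- a"] \<psi>0 by simp
  have \<psi>_int: "\<psi> (of_int k) = 0" for k
    by (cases k rule: int_cases2) (use \<psi>_nat[of _ 1] \<psi>1 \<psi>_neg in auto)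
  have \<psi>_bdd: "\<bar>\<psi> a\<bar> \<le> 2 * B" for a
  proof -
    have "\<psi> a = \<psi> (frac a)"
      using \<psi>_add[of "of_int \<lfloor>a\<rfloor>" "frac a"] \<psi>_int by (simp add: frac_def)
    moreover have "\<bar>frac a\<bar> \<le> 1" using frac_lt_1[of a] by simp
    then have "\<bar>\<phi> (frac a)\<bar> \<le> B" "\<bar>frac a * \<phi> 1\<bar> \<le> B"
      using bdd[of 1] mult_mono[of "\<bar>frac a\<bar>" 1 "\<bar>\<phi> 1\<bar>" B] by (auto intro!: bdd simp: abs_mult)
    ultimately show ?thesis unfolding \<psi>_def by linarith
  qed
  have "\<psi> a = 0"
  proof (rule ccontr)
    assume "\<psi> a \<noteq> 0"
    then obtain n :: nat where "2 * B < real n * \<bar>\<psi> a\<bar>"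
      using reals_Archimedean3[of "\<bar>\<psi> a\<bar>"] by auto
    also have "\<dots> = \<bar>\<psi> (real n * a)\<bar>" by (simp add: \<psi>_nat abs_mult)
    finally show False using \<psi>_bdd[of "real n * a"] by simp
  qed
  then show ?thesis by (simp add: \<psi>_def)
qed

lemma W12_cmult:
  assumes "f \<in> W12 M"
  shows "(\<lambda>x. c * f x) \<in> W12 M"
proof (cases "c = 0")
  case True
  then show ?thesis using L2_cmult[of f M 0] assms by (simp add: W12_def Ch_zero)
next
  case False
  then show ?thesis using assms
    by (auto simp: W12_def Ch_cmult L2_cmult ennreal_mult_less_top)
qed

lemma W12_add_diff:
  assumes "Ch_quadratic M" "f \<in> W12 M" "g \<in> W12 M"
  shows "(\<lambda>x. f x + g x) \<in> W12 M" "(\<lambda>x. f x - g x) \<in> W12 M"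
proof -
  have L: "f \<in> L2 M" "g \<in> L2 M" and fin: "Ch M f < \<infinity>" "Ch M g < \<infinity>"
    using assms by (auto simp: W12_def)
  have "Ch M (\<lambda>x. f x + g x) + Ch M (\<lambda>x. f x - g x) = 2 * Ch M f + 2 * Ch M g"
    using assms(1) L by (auto simp: Ch_quadratic_def)
  also have "\<dots> < \<infinity>" using fin by (simp add: ennreal_mult_less_top)
  finally show "(\<lambda>x. f x + g x) \<in> W12 M" "(\<lambda>x. f x - g x) \<in> W12 M"
    using L2_add[OF L] L2_add[OF L(1) L2_cmult[OF L(2), of "-1"]] by (auto simp: W12_def)
qed

lemma dirichlet_form_ex1:
  assumes quad: "Ch_quadratic M"
  shows "\<exists>!E. is_dirichlet_form M E"
proof -
  define Q where "Q f = enn2real (Ch M f)" for f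
  define B where "B f g = (Q (\<lambda>x. f x + g x) - Q (\<lambda>x. f x - g x)) / 2" for f g
  define E where "E f g = (if f \<in> W12 M \<and> g \<in> W12 M then B f g else 0)" for f g
  note W = W12_add_diff[OF quad] W12_cmult
  have Q0: "Q f \<ge> 0" for f by (simp add: Q_def)
  have Qc: "Q (\<lambda>x. c * f x) = c\<^sup>2 * Q f" for c f
    by (cases "c = 0") (simp_all add: Q_def Ch_cmult Ch_zero enn2real_mult)
  have Qz: "Q (\<lambda>x. 0) = 0" by (simp add: Q_def Ch_zero)
  have par: "Q (\<lambda>x. f x + g x) + Q (\<lambda>x. f x - g x) = 2 * Q f + 2 * Q g"
    if "f \<in> W12 M" "g \<in> W12 M" for f g
  proof -
    have "Ch M (\<lambda>x. f x + g x) + Ch M (\<lambda>x. f x - g x) = 2 * Ch M f + 2 * Ch M g"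
      using quad that by (auto simp: Ch_quadratic_def W12_def)
    from arg_cong[OF this, of enn2real] show ?thesis
      using W(1,2)[OF that] that
      by (simp add: Q_def W12_def enn2real_plus enn2real_mult ennreal_mult_less_top)
  qed
  have Qsym: "Q (\<lambda>x. f x - g x) = Q (\<lambda>x. g x - f x)" for f g
    using Qc[of "-1" "\<lambda>x. f x - g x"] by simp
  have Bsym: "B f g = B g f" for f g
    by (simp add: B_def Qsym[of f g] add.commute)
  have Bdiag: "B f f = 2 * Q f" for f
    using Qc[of 2 f] Qz by (simp add: B_def mult_2[symmetric])
  have Badd: "B (\<lambda>x. f x + g x) h = B f h + B g h"
    if f: "f \<in> W12 M" and g: "g \<in> W12 M" and h: "h \<in> W12 M" for f g h
  proof -
    have 1: "Q (\<lambda>x. f x + g x + h x) + Q (\<lambda>x. f x + h x - g x) = 2 * Q (\<lambda>x. f x + h x) + 2 * Q g"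
      using par[OF W(1)[OF f h] g] by (simp add: algebra_simps)
    have 2: "Q (\<lambda>x. f x + g x + h x) + Q (\<lambda>x. g x + h x - f x) = 2 * Q (\<lambda>x. g x + h x) + 2 * Q f"
      using par[OF W(1)[OF g h] f] by (simp add: algebra_simps)
    have 3: "Q (\<lambda>x. f x + g x - h x) + Q (\<lambda>x. f x - h x - g x) = 2 * Q (\<lambda>x. f x - h x) + 2 * Q g"
      using par[OF W(2)[OF f h] g] by (simp add: algebra_simps)
    have 4: "Q (\<lambda>x. f x + g x - h x) + Q (\<lambda>x. g x - h x - f x) = 2 * Q (\<lambda>x. g x - h x) + 2 * Q f"
      using par[OF W(2)[OF g h] f] by (simp add: algebra_simps)
    have 5: "Q (\<lambda>x. f x + h x - g x) = Q (\<lambda>x. g x - h x - f x)"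
      using Qsym[of "\<lambda>x. f x + h x" g] by (simp add: algebra_simps)
    have 6: "Q (\<lambda>x. g x + h x - f x) = Q (\<lambda>x. f x - h x - g x)"
      using Qsym[of "\<lambda>x. g x + h x" f] by (simp add: algebra_simps)
    show ?thesis using 1 2 3 4 5 6 unfolding B_def by (simp add: field_simps)
  qed
  have Bbdd: "\<bar>B f g\<bar> \<le> Q f + Q g" if "f \<in> W12 M" "g \<in> W12 M" for f g
    using par[OF that] Q0[of "\<lambda>x. f x + g x"] Q0[of "\<lambda>x. f x - g x"] unfolding B_def by (simp add: abs_le_iff field_simps)
  have Bc: "B (\<lambda>x. c * f x) g = c * B f g" if f: "f \<in> W12 M" and g: "g \<in> W12 M" for c f g
  proof -
    have "(\<lambda>c. B (\<lambda>x. c * f x) g) c = c * (\<lambda>c. B (\<lambda>x. c * f x) g) 1"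
    proof (rule additive_bounded_imp_linear)
      show "B (\<lambda>x. (a + b) * f x) g = B (\<lambda>x. a * f x) g + B (\<lambda>x. b * f x) g" for a b
        using Badd[OF W(3)[OF f, of a] W(3)[OF f, of b] g] by (simp add: algebra_simps)
      show "\<bar>B (\<lambda>x. a * f x) g\<bar> \<le> Q f + Q g" if "\<bar>a\<bar> \<le> 1" for a
      proof -
        have "a\<^sup>2 \<le> 1" using that by (simp add: abs_square_le_1)
        then have "a\<^sup>2 * Q f \<le> Q f" using Q0[of f] by (simp add: mult_left_le_one_le)
        then show ?thesis using Bbdd[OF W(3)[OF f, of a] g] Qc[of a f] by simp
      qed
    qed
    then show ?thesis by simp
  qed
  have ex: "is_dirichlet_form M E"
    unfolding is_dirichlet_form_def
  proof (intro conjI ballI allI impI)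
    show "E f g = E g f" for f g using Bsym[of f g] by (simp add: E_def)
  next
    fix f g h assume "f \<in> W12 M" "g \<in> W12 M" "h \<in> W12 M"
    then show "E (\<lambda>x. f x + g x) h = E f h + E g h" using W(1)[of f g] Badd[of f g h] by (simp add: E_def)
  next
    fix f g c assume "f \<in> W12 M" "g \<in> W12 M"
    then show "E (\<lambda>x. c * f x) g = c * E f g" using W(3)[of f M c] Bc[of f g c] by (simp add: E_def)
  next
    fix f assume "f \<in> W12 M"
    then show "E f f = 2 * enn2real (Ch M f)" using Bdiag[of f] by (simp add: E_def Q_def)
  next
    fix f g assume "f \<notin> W12 M \<or> g \<notin> W12 M"
    then show "E f g = 0" by (auto simp: E_def)
  qed
  moreover have "E' = E" if E': "is_dirichlet_form M E'" for E'
  proof (intro ext)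
    fix f g
    show "E' f g = E f g"
    proof (cases "f \<in> W12 M \<and> g \<in> W12 M")
      case True
      have pol: "2 * F f g = Q' (\<lambda>x. f x + g x) - Q' f - Q' g"
        if "is_dirichlet_form M F" and Q': "Q' = (\<lambda>f. 2 * enn2real (Ch M f))" for F Q'
      proof -
        have fg: "f \<in> W12 M" "g \<in> W12 M" "(\<lambda>x. f x + g x) \<in> W12 M"
          using True W(1)[of f g] by auto
        have add: "F (\<lambda>x. f x + g x) h = F f h + F g h" if "h \<in> W12 M" for h
          using \<open>is_dirichlet_form M F\<close> fg that unfolding is_dirichlet_form_def by blast
        have sym: "F u v = F v u" if "u \<in> W12 M" "v \<in> W12 M" for u v
          using \<open>is_dirichlet_form M F\<close> that unfolding is_dirichlet_form_def by blast
        have diag: "F u u = Q' u" if "u \<in> W12 M" for u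
          using \<open>is_dirichlet_form M F\<close> that unfolding is_dirichlet_form_def Q' by blast
        have "F (\<lambda>x. f x + g x) (\<lambda>x. f x + g x) = F f f + F g g + 2 * F f g"
          using add[of "\<lambda>x. f x + g x"] add[of f] add[of g] fg
            sym[of f "\<lambda>x. f x + g x"] sym[of g "\<lambda>x. f x + g x"] sym[of f g] by simp
        then show ?thesis
          using diag fg by simp
      qed
      from pol[OF ex refl] pol[OF E' refl] show ?thesis by simp
    next
      case False
      then show ?thesis using E' ex unfolding is_dirichlet_form_def by metis
    qed
  qed
  ultimately show ?thesis by auto
qed

end

theory Submission
  imports Defs
begin

text \<open>
  The inequality follows from the displacement convexity of the entropy by comparing a density with its mixtures
  with the reference measure \<open>M\<close>.

  Let \<open>f = g\<^sup>2 / Z\<close> be a density, where \<open>g\<close> is bounded, Lipschitz and bounded away from 0, and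
  \<open>Z = \<integral> g\<^sup>2\<close>, and let \<open>J = \<integral> |Dg|\<^sup>2 / Z\<close>.
  Differentiating the entropy at the start of a geodesic from \<open>f\<close> to another measure
  \<open>\<rho>\<close> yields the HWI inequality \<open>Ent f - Ent \<rho> \<le> s J + (1 / s + K / 2)
  W\<^sup>2\<close> for all \<open>s > 0\<close>, where \<open>W\<close> is the distance between the two
  measures (\<open>HWI_inequality\<close>). It is applied to the mixtures \<open>\<rho> = (1 - h) f + h\<close>.
  They are coupled with \<open>f\<close> by resampling a fraction \<open>h\<close> of the mass, so
  \<open>W\<^sup>2 \<le> h D\<close> with \<open>D\<close> the mean squared distance of two points drawn from
  \<open>f\<close> and from \<open>M\<close>. By the Gibbs variational principle, Gaussian integrability bounds
  \<open>D\<close> by about \<open>Ent f / (K / 2 + \<epsilon>)\<close> plus a constant.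

  For \<open>h = 1\<close> the entropy on the right has a coefficient near \<open>(K / 2) / (K / 2 + \<epsilon>)
  < 1\<close> and can be absorbed. The result is the defective inequality \<open>Ent f \<le> A J + B\<close>
  (\<open>defective_log_sobolev\<close>).

  For small \<open>h\<close> the same comparison gives a Poincare inequality
  (\<open>poincare_vanishing_on_half\<close>). If \<open>u \<ge> 0\<close> vanishes on half of the space and
  \<open>g = u + \<delta>\<close>, then \<open>f\<close> is small on half of the space, and placing mass
  \<open>h\<close> there gains entropy of order \<open>h ln (1 / h)\<close>, at a squared distance of order
  \<open>h\<close> only. For \<open>h\<close> below a fixed threshold the gain outweighs this cost, so
  \<open>J\<close> cannot be small compared with \<open>h\<close>.

  For a Lipschitz function \<open>v\<close> with \<open>\<integral> v\<^sup>2 = 1\<close> put \<open>w = | |v| -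
  1 |\<close>. Then \<open>\<integral> v\<^sup>2 ln v\<^sup>2\<close> is at most a multiple of
  \<open>\<integral> w\<^sup>2 (1 + ln (1 + w\<^sup>2))\<close>. The defective inequality for \<open>w\<close>,
  shifted to be positive, bounds this by the energy plus a multiple of \<open>\<integral> w\<^sup>2\<close>, and
  the Poincare inequality bounds \<open>\<integral> w\<^sup>2\<close> by the energy
  (\<open>tight_log_sobolev_slope_majorant\<close>). Finally the inequality for Lipschitz functions extends to
  the Cheeger energy, its relaxation in \<open>L\<^sup>2\<close>, by Fatou's lemma.
\<close>

section \<open>Relative entropy\<close>

lemma ext_integral_eq_integral:
  assumes "integrable M g"
  shows "ext_integral M g = ereal (\<integral>x. g x \<partial>M)"
proof -
  have fin: "(\<integral>\<^sup>+x. ennreal (g x) \<partial>M) < \<infinity>" "(\<integral>\<^sup>+x. ennreal (- g x) \<partial>M) < \<infinity>"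
    using assms by (auto simp: real_integrable_def top.not_eq_extremum)
  then show ?thesis
    unfolding ext_integral_def real_lebesgue_integral_def[OF assms]
    by (cases "\<integral>\<^sup>+x. ennreal (g x) \<partial>M"; cases "\<integral>\<^sup>+x. ennreal (- g x) \<partial>M") auto
qed

text \<open>
  The tangent at \<open>b\<close> of the convex function \<open>x ln x\<close>. Integrated with \<open>a\<close>
  and \<open>b\<close> replaced by densities this is the convexity of the entropy, and with \<open>b = exp
  u\<close> it is the Gibbs variational principle.
\<close>

lemma x_ln_x_tangent:
  fixes a b :: real
  assumes "0 \<le> a" "0 < b"
  shows "a * ln b + a - b \<le> a * ln a"
proof (cases "a = 0")
  case False
  then have a: "a > 0" using assms by simp
  have "ln (b / a) \<le> b / a - 1" using a assms by (intro ln_le_minus_one) auto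
  then have "a * ln (b / a) \<le> a * (b / a - 1)" using a by (intro mult_left_mono) auto
  then have "a * (ln b - ln a) \<le> b - a" using a assms by (simp add: ln_div right_diff_distrib)
  then show ?thesis by (simp add: right_diff_distrib)
qed (use assms in simp)

lemma x_ln_x_ge: "0 \<le> a \<Longrightarrow> a - 1 \<le> a * ln (a::real)"
  using x_ln_x_tangent[of a 1] by simp

lemma (in prob_space) nn_integral_neg_x_ln_x_le_1:
  fixes f :: "'a \<Rightarrow> real"
  assumes f0: "\<And>x. 0 \<le> f x"
  shows "(\<integral>\<^sup>+x. ennreal (- (f x * ln (f x))) \<partial>M) \<le> 1"
proof -
  have "(\<integral>\<^sup>+x. ennreal (- (f x * ln (f x))) \<partial>M) \<le> (\<integral>\<^sup>+x. 1 \<partial>M)"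
  proof (intro nn_integral_mono)
    fix x show "ennreal (- (f x * ln (f x))) \<le> 1"
      using x_ln_x_ge[OF f0[of x]] f0[of x] by (intro ennreal_le_1[THEN iffD2]) linarith
  qed
  then show ?thesis by (simp add: emeasure_space_1)
qed

lemma (in prob_space) integrable_bounded_real:
  fixes f :: "'a \<Rightarrow> real"
  assumes "f \<in> borel_measurable M" "\<And>x. \<bar>f x\<bar> \<le> B"
  shows "integrable M f"
  using assms by (intro integrable_const_bound[where B=B]) auto

lemma (in prob_space) integrable_x_ln_x:
  fixes f :: "'a \<Rightarrow> real"
  assumes [measurable]: "f \<in> borel_measurable M" and f: "\<And>x. 0 \<le> f x" "\<And>x. f x \<le> B"
  shows "integrable M (\<lambda>x. f x * ln (f x))"
proof (rule integrable_bounded_real)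
  fix x
  have "ln (f x) \<le> f x" using f(1)[of x] ln_le_minus_one[of "f x"] by (cases "f x = 0") auto
  then have "f x * ln (f x) \<le> f x * f x" using f(1) by (rule mult_left_mono)
  also have "\<dots> \<le> B * B" using f(1)[of x] f(2)[of x] by (intro mult_mono) auto
  finally have "f x * ln (f x) \<le> B * B" .
  moreover have "- 1 \<le> f x * ln (f x)" using x_ln_x_ge[OF f(1)[of x]] f(1)[of x] by linarith
  moreover have "0 \<le> B * B" by simp
  ultimately show "\<bar>f x * ln (f x)\<bar> \<le> B * B + 1" by linarith
qed measurable

text \<open>
  This explicit modulus of continuity of \<open>x ln x\<close> at \<open>0\<close> bounds the part of the
  entropy integral that a truncation at a small height removes.
\<close>

lemma minus_x_ln_x_le_sqrt:
  fixes a :: real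
  assumes "0 \<le> a"
  shows "- (a * ln a) \<le> 2 * sqrt a"
proof (cases "a = 0")
  case False
  then have a: "a > 0" using assms by simp
  have "ln (1 / sqrt a) \<le> 1 / sqrt a - 1" using a by (intro ln_le_minus_one) auto
  then have "a * - ln a \<le> a * (2 / sqrt a)" using a
    by (intro mult_left_mono) (auto simp: ln_div ln_sqrt)
  also have "\<dots> = 2 * (a / sqrt a)" by simp
  also have "\<dots> = 2 * sqrt a" using a by (simp only: real_div_sqrt less_imp_le)
  finally show ?thesis by simp
qed simp

lemma (in prob_space) tendsto_ext_integral_truncated:
  assumes [measurable]: "f \<in> borel_measurable M" and f0: "\<And>x. 0 \<le> f x"
  shows "((\<lambda>\<epsilon>::real. ext_integral M (\<lambda>x. indicator {y. f y > \<epsilon>} x * (f x * ln (f x))))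
           \<longlongrightarrow> ext_integral M (\<lambda>x. f x * ln (f x))) (at_right 0)"
proof -
  let ?P = "\<integral>\<^sup>+x. ennreal (f x * ln (f x)) \<partial>M"
  let ?N = "\<lambda>\<epsilon>. \<integral>\<^sup>+x. ennreal (- (indicator {y. f y > \<epsilon>} x * (f x * ln (f x)))) \<partial>M"
  let ?L = "\<integral>\<^sup>+x. ennreal (- (f x * ln (f x))) \<partial>M"
  have N0: "?L \<le> 1" using f0 by (rule nn_integral_neg_x_ln_x_le_1)
  have up: "?N \<epsilon> \<le> ?L" for \<epsilon>
    by (intro nn_integral_mono) (auto simp: indicator_def ennreal_neg intro: ennreal_leI)
  have low: "?L \<le> ?N \<epsilon> + ennreal (2 * sqrt \<epsilon>)" if "\<epsilon> > 0" for \<epsilon>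
  proof -
    have "?L \<le> (\<integral>\<^sup>+x. ennreal (- (indicator {y. f y > \<epsilon>} x * (f x * ln (f x)))) + ennreal (2 * sqrt \<epsilon>) \<partial>M)"
    proof (intro nn_integral_mono)
      fix x
      show "ennreal (- (f x * ln (f x))) \<le> ennreal (- (indicator {y. f y > \<epsilon>} x * (f x * ln (f x)))) + ennreal (2 * sqrt \<epsilon>)"
      proof (cases "f x > \<epsilon>")
        case False
        have "- (f x * ln (f x)) \<le> 2 * sqrt (f x)" using f0 by (rule minus_x_ln_x_le_sqrt)
        also have "\<dots> \<le> 2 * sqrt \<epsilon>" using False by simp
        finally show ?thesis using False by (simp add: ennreal_leI)
      qed (simp add: indicator_def)
    qed
    also have "\<dots> = ?N \<epsilon> + ennreal (2 * sqrt \<epsilon>)"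
      by (subst nn_integral_add) (auto simp: emeasure_space_1)
    finally show ?thesis .
  qed
  have ev: "\<forall>\<^sub>F \<epsilon> in at_right (0::real). 0 < \<epsilon> \<and> \<epsilon> < 1"
    by (auto simp: eventually_at_right_field intro!: exI[of _ 1])
  have "((\<lambda>\<epsilon>. ?L - ennreal (2 * sqrt \<epsilon>)) \<longlongrightarrow> ?L - ennreal (2 * sqrt 0)) (at_right 0)"
    using N0 by (intro tendsto_diff_ennreal tendsto_intros) (auto simp: top_unique intro!: tendsto_intros)
  moreover have "\<forall>\<^sub>F \<epsilon> in at_right 0. ?L - ennreal (2 * sqrt \<epsilon>) \<le> ?N \<epsilon>"
    using ev by eventually_elim (use low in \<open>auto simp: ennreal_minus_le_iff add.commute\<close>)
  ultimately have N: "(?N \<longlongrightarrow> ?L) (at_right 0)"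
    using up by (intro tendsto_sandwich[of "\<lambda>\<epsilon>. ?L - ennreal (2 * sqrt \<epsilon>)" ?N _ "\<lambda>_. ?L"]) auto
  have "((\<lambda>\<epsilon>. enn2ereal ?P - enn2ereal (?N \<epsilon>)) \<longlongrightarrow> enn2ereal ?P - enn2ereal ?L) (at_right 0)"
  proof (intro tendsto_diff_ereal_general tendsto_const tendsto_enn2erealI[OF N])
    have "enn2ereal ?L \<noteq> \<infinity>" using N0 by (metis enn2ereal_top infinity_ennreal_def ennreal_one_less_top enn2ereal_inject leD)
    then show "\<not> (enn2ereal ?P = \<infinity> \<and> enn2ereal ?L = \<infinity> \<or> enn2ereal ?P = - \<infinity> \<and> enn2ereal ?L = - \<infinity>)"
      by simp
  qed
  then show ?thesis
    unfolding ext_integral_def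
  proof (rule Lim_transform_eventually)
    show "\<forall>\<^sub>F \<epsilon> in at_right 0. enn2ereal ?P - enn2ereal (?N \<epsilon>) =
       enn2ereal (\<integral>\<^sup>+x. ennreal (indicator {y. f y > \<epsilon>} x * (f x * ln (f x))) \<partial>M) - enn2ereal (?N \<epsilon>)"
      using ev
    proof eventually_elim
      case (elim \<epsilon>)
      have "ennreal (f x * ln (f x)) = ennreal (indicator {y. f y > \<epsilon>} x * (f x * ln (f x)))" for x
      proof (cases "f x > \<epsilon>")
        case False
        then have "ln (f x) \<le> 0" using elim f0[of x] by (cases "f x = 0") auto
        then have "f x * ln (f x) \<le> 0" using f0[of x] by (rule mult_nonneg_nonpos[rotated])
        then show ?thesis using False by (simp add: ennreal_neg)
      qed simp
      then show ?case by simp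
    qed
  qed
qed

text \<open>
  The limit defining the entropy is harmless: truncation changes only the negative part of the integrand,
  uniformly little, so any density computes the entropy as an extended integral.
\<close>

lemma (in prob_space) Ent_density:
  fixes f :: "'a \<Rightarrow> real"
  assumes [measurable]: "f \<in> borel_measurable M" and f0: "\<And>x. 0 \<le> f x"
    and p: "prob_space (density M f)"
  shows "Ent M (density M f) = ext_integral M (\<lambda>x. f x * ln (f x))"
proof -
  let ?\<rho> = "density M f"
  let ?h = "\<lambda>x. enn2real (RN_deriv M ?\<rho> x)"
  have ac: "AE x in M. RN_deriv M ?\<rho> x = ennreal (f x)"
    using RN_deriv_unique[of "\<lambda>x. ennreal (f x)" ?\<rho>] by (simp add: eq_commute[of "ennreal _"])
  then have eq: "AE x in M. ?h x = f x" by eventually_elim (simp add: f0)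
  have "Ent M ?\<rho> = Lim (at_right 0) (\<lambda>\<epsilon>::real. ext_integral M (\<lambda>x. indicator {y. ?h y > \<epsilon>} x * (?h x * ln (?h x))))"
    by (auto simp: Ent_def Let_def intro!: bexI[of _ "\<lambda>x. ennreal (f x)"])
  also have "\<dots> = ext_integral M (\<lambda>x. ?h x * ln (?h x))"
    by (intro tendsto_Lim tendsto_ext_integral_truncated) auto
  also have "\<dots> = ext_integral M (\<lambda>x. f x * ln (f x))"
  proof -
    have "(\<integral>\<^sup>+x. ennreal (?h x * ln (?h x)) \<partial>M) = (\<integral>\<^sup>+x. ennreal (f x * ln (f x)) \<partial>M)"
      by (rule nn_integral_cong_AE) (use eq in \<open>eventually_elim, simp\<close>)
    moreover have "(\<integral>\<^sup>+x. ennreal (- (?h x * ln (?h x))) \<partial>M) = (\<integral>\<^sup>+x. ennreal (- (f x * ln (f x))) \<partial>M)"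
      by (rule nn_integral_cong_AE) (use eq in \<open>eventually_elim, simp\<close>)
    ultimately show ?thesis by (simp add: ext_integral_def)
  qed
  finally show ?thesis .
qed

lemma (in prob_space) finite_EntE:
  assumes "Ent M \<rho> < \<infinity>" and \<rho>: "prob_space \<rho>"
  obtains f :: "'a \<Rightarrow> real" where "f \<in> borel_measurable M" "\<And>x. 0 \<le> f x" "\<rho> = density M f"
    "integrable M (\<lambda>x. f x * ln (f x))" "Ent M \<rho> = ereal (\<integral>x. f x * ln (f x) \<partial>M)"
proof -
  obtain h where h[measurable]: "h \<in> borel_measurable M" and \<rho>h: "\<rho> = density M h"
    using assms(1) by (auto simp: Ent_def split: if_splits)
  have "(\<integral>\<^sup>+x. h x \<partial>M) = 1"
    using prob_space.emeasure_space_1[OF \<rho>] by (simp add: \<rho>h emeasure_density cong: nn_integral_cong)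
  then have "AE x in M. h x \<noteq> \<infinity>" by (intro nn_integral_PInf_AE) auto
  then have eq: "AE x in M. h x = ennreal (enn2real (h x))" by eventually_elim (auto simp: top.not_eq_extremum)
  define f where "f x = enn2real (h x)" for x
  have f[measurable]: "f \<in> borel_measurable M" and f0: "0 \<le> f x" for x by (auto simp: f_def[abs_def])
  have \<rho>f: "\<rho> = density M f" unfolding \<rho>h by (intro density_cong) (use eq in \<open>auto simp: f_def\<close>)
  have E: "Ent M \<rho> = ext_integral M (\<lambda>x. f x * ln (f x))"
    unfolding \<rho>f by (intro Ent_density f f0) (use \<rho> \<rho>f in simp)
  let ?L = "\<integral>\<^sup>+x. ennreal (- (f x * ln (f x))) \<partial>M"
  have N0: "?L \<le> 1" using f0 by (rule nn_integral_neg_x_ln_x_le_1)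
  have "(\<integral>\<^sup>+x. ennreal (f x * ln (f x)) \<partial>M) \<noteq> \<infinity>"
  proof
    assume "(\<integral>\<^sup>+x. ennreal (f x * ln (f x)) \<partial>M) = \<infinity>"
    then have "Ent M \<rho> = \<infinity>" using N0 unfolding E ext_integral_def
      by (cases ?L) (auto simp: top_unique)
    with assms show False by simp
  qed
  moreover have "?L \<noteq> \<infinity>" using N0 by (auto simp: top_unique)
  ultimately have "integrable M (\<lambda>x. f x * ln (f x))"
    by (auto simp: real_integrable_def)
  with that[OF f f0 \<rho>f this] E show thesis by (simp add: ext_integral_eq_integral)
qed

section \<open>Couplings by resampling\<close>

lemma W2_squared:
  "(W2 \<nu>1 \<nu>2)\<^sup>2 = enn2real (INF \<pi>\<in>couplings \<nu>1 \<nu>2. \<integral>\<^sup>+z. ennreal ((dist (fst z) (snd z))\<^sup>2) \<partial>\<pi>)"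
  by (simp add: W2_def)

lemma W2_squared_le:
  assumes "\<pi> \<in> couplings \<nu>1 \<nu>2" "(\<integral>\<^sup>+z. ennreal ((dist (fst z) (snd z))\<^sup>2) \<partial>\<pi>) \<le> ennreal c" "0 \<le> c"
  shows "(W2 \<nu>1 \<nu>2)\<^sup>2 \<le> c"
  unfolding W2_squared using assms by (intro enn2real_leI INF_lower2[of \<pi>]) auto

text \<open>
  The law of \<open>(x, y)\<close> when \<open>x\<close> is drawn from \<open>P\<close> and then, with
  probability \<open>h\<close>, the point \<open>y\<close> is resampled from \<open>Q\<close> and otherwise
  \<open>y = x\<close>. It couples \<open>P\<close> with \<open>(1 - h) P + h Q\<close>, and for \<open>h =
  1\<close> it is the product coupling. The coin is the first component of the product space.
\<close>

definition mixture_coupling :: "real \<Rightarrow> 'a::polish_space measure \<Rightarrow> 'a measure \<Rightarrow> ('a \<times> 'a) measure" where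
  "mixture_coupling h P Q = distr (measure_pmf (bernoulli_pmf h) \<Otimes>\<^sub>M (P \<Otimes>\<^sub>M Q)) (borel \<Otimes>\<^sub>M borel)
     (\<lambda>(b, x, y). (x, if b then y else x))"

lemma sets_mixture_coupling [simp]: "sets (mixture_coupling h P Q) = sets (borel \<Otimes>\<^sub>M borel)"
  by (simp add: mixture_coupling_def)

lemma nn_integral_mixture_coupling:
  fixes P Q :: "'a::polish_space measure"
  assumes P: "prob_space P" and sP [measurable_cong]: "sets P = sets borel"
    and Q: "prob_space Q" and sQ [measurable_cong]: "sets Q = sets borel"
    and h: "0 \<le> h" "h \<le> 1" and H [measurable]: "H \<in> borel_measurable (borel \<Otimes>\<^sub>M borel)"
  shows "(\<integral>\<^sup>+z. H z \<partial>mixture_coupling h P Q) =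
    ennreal h * (\<integral>\<^sup>+x. \<integral>\<^sup>+y. H (x, y) \<partial>Q \<partial>P) + ennreal (1 - h) * (\<integral>\<^sup>+x. H (x, x) \<partial>P)"
proof -
  interpret P: prob_space P by fact
  interpret Q: prob_space Q by fact
  interpret PQ: pair_prob_space P Q ..
  have *: "(\<lambda>(b, x, y). (x, if b then y else x)) \<in>
      measure_pmf (bernoulli_pmf h) \<Otimes>\<^sub>M (P \<Otimes>\<^sub>M Q) \<rightarrow>\<^sub>M borel \<Otimes>\<^sub>M borel"
    by (auto simp: split_beta' intro!: measurable_Pair measurable_If)
  have "(\<integral>\<^sup>+z. H z \<partial>mixture_coupling h P Q) =
      (\<integral>\<^sup>+b. \<integral>\<^sup>+z. H (fst z, if b then snd z else fst z) \<partial>(P \<Otimes>\<^sub>M Q) \<partial>measure_pmf (bernoulli_pmf h))"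
    unfolding mixture_coupling_def
    by (subst nn_integral_distr[OF *]) (auto cong: if_cong simp: PQ.nn_integral_fst[symmetric] split_beta' intro!: measurable_compose[OF _ H] measurable_Pair measurable_If)
  also have "\<dots> = (\<integral>\<^sup>+z. H (fst z, snd z) \<partial>(P \<Otimes>\<^sub>M Q)) * h + (\<integral>\<^sup>+z. H (fst z, fst z) \<partial>(P \<Otimes>\<^sub>M Q)) * (1 - h)"
    using h by simp
  also have "(\<integral>\<^sup>+z. H (fst z, snd z) \<partial>(P \<Otimes>\<^sub>M Q)) = (\<integral>\<^sup>+x. \<integral>\<^sup>+y. H (x, y) \<partial>Q \<partial>P)"
    by (subst Q.nn_integral_fst[symmetric]) auto
  also have "(\<integral>\<^sup>+z. H (fst z, fst z) \<partial>(P \<Otimes>\<^sub>M Q)) = (\<integral>\<^sup>+x. H (x, x) \<partial>P)"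
    by (subst Q.nn_integral_fst[symmetric]) (auto simp: Q.emeasure_space_1)
  finally show ?thesis by (simp add: mult.commute)
qed

lemma distr_fst_mixture_coupling:
  fixes P Q :: "'a::polish_space measure"
  assumes "prob_space P" "sets P = sets borel" "prob_space Q" "sets Q = sets borel" "0 \<le> h" "h \<le> 1"
  shows "distr (mixture_coupling h P Q) borel fst = P"
proof (rule measure_eqI)
  fix A assume "A \<in> sets (distr (mixture_coupling h P Q) borel fst)"
  then have A[measurable]: "A \<in> sets borel" by simp
  have "emeasure (distr (mixture_coupling h P Q) borel fst) A =
      (\<integral>\<^sup>+z. indicator A (fst z) \<partial>mixture_coupling h P Q)"
    by (subst nn_integral_distr[symmetric, of fst _ borel "indicator A"])
       (auto simp: measurable_cong_sets[OF sets_mixture_coupling refl])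
  also have "\<dots> = ennreal h * emeasure P A + ennreal (1 - h) * emeasure P A"
    using assms by (subst nn_integral_mixture_coupling) (auto simp: prob_space.emeasure_space_1)
  also have "\<dots> = emeasure P A"
    using assms by (simp add: distrib_right[symmetric] ennreal_plus[symmetric] del: ennreal_plus)
  finally show "emeasure (distr (mixture_coupling h P Q) borel fst) A = emeasure P A" .
qed (use assms in simp)

lemma emeasure_distr_snd_mixture_coupling:
  fixes P Q :: "'a::polish_space measure"
  assumes "prob_space P" "sets P = sets borel" "prob_space Q" "sets Q = sets borel" "0 \<le> h" "h \<le> 1"
    and A[measurable]: "A \<in> sets borel"
  shows "emeasure (distr (mixture_coupling h P Q) borel snd) A =
    ennreal h * emeasure Q A + ennreal (1 - h) * emeasure P A"
proof -
  have "emeasure (distr (mixture_coupling h P Q) borel snd) A =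
      (\<integral>\<^sup>+z. indicator A (snd z) \<partial>mixture_coupling h P Q)"
    by (subst nn_integral_distr[symmetric, of snd _ borel "indicator A"])
       (auto simp: measurable_cong_sets[OF sets_mixture_coupling refl])
  also have "\<dots> = ennreal h * emeasure Q A + ennreal (1 - h) * emeasure P A"
    using assms by (subst nn_integral_mixture_coupling) (auto simp: prob_space.emeasure_space_1)
  finally show ?thesis .
qed

text \<open>
  The product coupling shows that the infimum is finite. So its conversion to a real number in
  \<^const>\<open>W2\<close> loses nothing, and some coupling comes within \<open>e\<close> of it.
\<close>

lemma W2_near_optimal_coupling:
  fixes \<nu>1 \<nu>2 :: "'a::polish_space measure"
  assumes P2: "\<nu>1 \<in> P2" "\<nu>2 \<in> P2" and e: "0 < e"
  obtains \<pi> where "\<pi> \<in> couplings \<nu>1 \<nu>2"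
    "(\<integral>\<^sup>+z. ennreal ((dist (fst z) (snd z))\<^sup>2) \<partial>\<pi>) \<le> ennreal ((W2 \<nu>1 \<nu>2)\<^sup>2 + e)"
proof -
  from P2 obtain p q where 1: "prob_space \<nu>1" and 2: "prob_space \<nu>2"
    and s1[measurable_cong]: "sets \<nu>1 = sets borel" and s2[measurable_cong]: "sets \<nu>2 = sets borel"
    and p: "(\<integral>\<^sup>+x. ennreal ((dist p x)\<^sup>2) \<partial>\<nu>1) < \<infinity>" and q: "(\<integral>\<^sup>+x. ennreal ((dist q x)\<^sup>2) \<partial>\<nu>2) < \<infinity>"
    by (auto simp: P2_def)
  interpret P: prob_space \<nu>1 by fact
  interpret Q: prob_space \<nu>2 by fact
  let ?\<pi> = "mixture_coupling 1 \<nu>1 \<nu>2"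
  let ?c = "\<lambda>\<pi>. \<integral>\<^sup>+z. ennreal ((dist (fst z) (snd z))\<^sup>2) \<partial>\<pi>"
  let ?I = "INF \<pi>\<in>couplings \<nu>1 \<nu>2. ?c \<pi>"
  have cpl: "?\<pi> \<in> couplings \<nu>1 \<nu>2"
    unfolding couplings_def mem_Collect_eq
    by (intro conjI distr_fst_mixture_coupling measure_eqI)
       (use 1 2 s1 s2 in \<open>auto simp: emeasure_distr_snd_mixture_coupling\<close>)
  have "?c ?\<pi> = (\<integral>\<^sup>+x. \<integral>\<^sup>+y. ennreal ((dist x y)\<^sup>2) \<partial>\<nu>2 \<partial>\<nu>1)"
    using 1 2 s1 s2 by (subst nn_integral_mixture_coupling) auto
  also have "\<dots> \<le> (\<integral>\<^sup>+x. \<integral>\<^sup>+y. 3 * ennreal ((dist p x)\<^sup>2) + (3 * ennreal ((dist p q)\<^sup>2) + 3 * ennreal ((dist q y)\<^sup>2)) \<partial>\<nu>2 \<partial>\<nu>1)"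
  proof (intro nn_integral_mono)
    fix x y
    have "dist x y \<le> dist p x + dist p q + dist q y"
      using dist_triangle[of x y p] dist_triangle[of p y q] by (simp add: dist_commute)
    then have "(dist x y)\<^sup>2 \<le> (dist p x + dist p q + dist q y)\<^sup>2" by (intro power_mono) auto
    also have "\<dots> \<le> 3 * (dist p x)\<^sup>2 + (3 * (dist p q)\<^sup>2 + 3 * (dist q y)\<^sup>2)"
      using zero_le_power2[of "dist p x - dist p q"] zero_le_power2[of "dist p x - dist q y"]
        zero_le_power2[of "dist q y - dist p q"] by (simp add: power2_eq_square algebra_simps)
    finally have "ennreal ((dist x y)\<^sup>2) \<le> ennreal (3 * (dist p x)\<^sup>2 + (3 * (dist p q)\<^sup>2 + 3 * (dist q y)\<^sup>2))"
      by (rule ennreal_leI)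
    then show "ennreal ((dist x y)\<^sup>2) \<le> 3 * ennreal ((dist p x)\<^sup>2) + (3 * ennreal ((dist p q)\<^sup>2) + 3 * ennreal ((dist q y)\<^sup>2))"
      by (simp add: ennreal_mult)
  qed
  also have "\<dots> = 3 * (\<integral>\<^sup>+x. ennreal ((dist p x)\<^sup>2) \<partial>\<nu>1) + (3 * ennreal ((dist p q)\<^sup>2) + 3 * (\<integral>\<^sup>+x. ennreal ((dist q x)\<^sup>2) \<partial>\<nu>2))"
    by (simp add: nn_integral_add nn_integral_cmult P.emeasure_space_1 Q.emeasure_space_1)
  also have "\<dots> < \<infinity>" using p q by (simp add: ennreal_mult_less_top)
  finally have "?I < \<infinity>" using cpl by (meson INF_lower le_less_trans)
  then have "ennreal ((W2 \<nu>1 \<nu>2)\<^sup>2) = ?I" unfolding W2_squared by (intro ennreal_enn2real) simp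
  then have "?I < ennreal ((W2 \<nu>1 \<nu>2)\<^sup>2 + e)" using e
    by (metis ennreal_lessI less_add_same_cancel1 add_nonneg_pos zero_le_power2)
  then obtain \<pi> where "\<pi> \<in> couplings \<nu>1 \<nu>2" "?c \<pi> < ennreal ((W2 \<nu>1 \<nu>2)\<^sup>2 + e)"
    by (auto simp: INF_less_iff)
  with that show thesis by (simp add: less_imp_le)
qed

text \<open>
  Only the resampled fraction \<open>h\<close> of the mass moves. The squared distance is thus of order
  \<open>h\<close>, which is larger than the order \<open>h\<^sup>2\<close> along a geodesic but will be beaten
  by an entropy gain of order \<open>h ln (1 / h)\<close>.
\<close>

lemma W2_squared_mixture_le:
  fixes P Q :: "'a::polish_space measure"
  assumes "prob_space P" "sets P = sets borel" "prob_space Q" "sets Q = sets borel" "0 \<le> h" "h \<le> 1"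
    and R: "sets R = sets borel" "\<And>A. A \<in> sets borel \<Longrightarrow> emeasure R A = ennreal h * emeasure Q A + ennreal (1 - h) * emeasure P A"
    and D: "(\<integral>\<^sup>+x. \<integral>\<^sup>+y. ennreal ((dist x y)\<^sup>2) \<partial>Q \<partial>P) \<le> ennreal D" "0 \<le> D"
  shows "(W2 P R)\<^sup>2 \<le> h * D"
proof (rule W2_squared_le)
  show "mixture_coupling h P Q \<in> couplings P R"
    unfolding couplings_def mem_Collect_eq
    by (intro conjI distr_fst_mixture_coupling measure_eqI)
       (use assms in \<open>auto simp: emeasure_distr_snd_mixture_coupling\<close>)
  have "(\<integral>\<^sup>+z. ennreal ((dist (fst z) (snd z))\<^sup>2) \<partial>mixture_coupling h P Q) =
      ennreal h * (\<integral>\<^sup>+x. \<integral>\<^sup>+y. ennreal ((dist x y)\<^sup>2) \<partial>Q \<partial>P)"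
    using assms by (subst nn_integral_mixture_coupling) auto
  also have "\<dots> \<le> ennreal (h * D)" using D assms by (simp add: ennreal_mult mult_left_mono)
  finally show "(\<integral>\<^sup>+z. ennreal ((dist (fst z) (snd z))\<^sup>2) \<partial>mixture_coupling h P Q) \<le> ennreal (h * D)" .
qed (use assms in simp)

section \<open>The slope of the entropy\<close>

text \<open>
  The local Lipschitz constant controls differences of \<open>g\<close> only in the limit, whereas a transport
  plan moves mass over small but positive distances. A slope majorant bounds the difference quotients of
  \<open>g\<close> on some fixed scale \<open>r\<close>; the local Lipschitz constant is recovered at the very
  end as a limit of slope majorants.
\<close>

definition slope_majorant :: "('a::metric_space \<Rightarrow> real) \<Rightarrow> ('a \<Rightarrow> real) \<Rightarrow> bool" where
  "slope_majorant g G \<longleftrightarrow> bounded_lipschitz g \<and> G \<in> borel_measurable borel \<and> bounded (range G) \<and>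
     (\<forall>x. 0 \<le> G x) \<and> (\<exists>r>0. \<forall>x y. dist x y < r \<longrightarrow> \<bar>g y - g x\<bar> \<le> G x * dist x y)"

lemma bounded_lipschitz_borel_measurable:
  "bounded_lipschitz g \<Longrightarrow> g \<in> borel_measurable borel"
  unfolding bounded_lipschitz_def using borel_measurable_continuous_onI lipschitz_on_continuous_on by blast

lemma bounded_range_realE:
  fixes g :: "'a \<Rightarrow> real"
  assumes "bounded (range g)"
  obtains B where "0 < B" "\<And>x. \<bar>g x\<bar> \<le> B"
  using assms unfolding bounded_pos by auto

text \<open>
  Truncations, absolute values and shifts do not increase difference quotients.
\<close>

lemma slope_majorant_contraction:
  fixes \<phi> :: "real \<Rightarrow> real"
  assumes g: "slope_majorant g G" and \<phi>: "\<And>a b. \<bar>\<phi> a - \<phi> b\<bar> \<le> \<bar>a - b\<bar>"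
  shows "slope_majorant (\<lambda>x. \<phi> (g x)) G"
proof -
  obtain L where L: "L-lipschitz_on UNIV g" and bd: "bounded (range g)"
    using g by (auto simp: slope_majorant_def bounded_lipschitz_def)
  obtain B where B: "\<And>x. \<bar>g x\<bar> \<le> B" using bounded_range_realE[OF bd] by metis
  have "\<bar>\<phi> (g x)\<bar> \<le> B + \<bar>\<phi> 0\<bar>" for x using \<phi>[of "g x" 0] B[of x] by linarith
  then have "bounded (range (\<lambda>x. \<phi> (g x)))" by (auto simp: bounded_iff)
  moreover have "L-lipschitz_on UNIV (\<lambda>x. \<phi> (g x))"
    using L \<phi> unfolding lipschitz_on_def dist_real_def by (meson order_trans)
  ultimately have "bounded_lipschitz (\<lambda>x. \<phi> (g x))" by (auto simp: bounded_lipschitz_def)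
  then show ?thesis using g \<phi> unfolding slope_majorant_def by (meson order_trans)
qed

text \<open>
  To first order \<open>ln g x - ln g y\<close> is at most \<open>(G x / g x) d\<close> with \<open>d = dist x
  y\<close>, and Young's inequality separates the two factors. All errors are \<open>O(d\<^sup>2)\<close>: the
  one from linearising the logarithm, and the one from distances \<open>d \<ge> r\<close>, where \<open>L d
  \<le> (L / r) d\<^sup>2\<close> with the Lipschitz constant \<open>L\<close>. The constant \<open>C\<close>
  does not depend on \<open>s\<close>; this matters because \<open>s\<close> will tend to \<open>0\<close>
  together with the distance.
\<close>

lemma ln_difference_le:
  fixes g :: "'a::metric_space \<Rightarrow> real"
  assumes g: "slope_majorant g G" and \<delta>: "0 < \<delta>" "\<And>x. \<delta> \<le> g x"
  obtains C where "0 \<le> C" "\<And>s x y. 0 < s \<Longrightarrow>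
    2 * (ln (g x) - ln (g y)) \<le> s * (G x / g x)\<^sup>2 + (1 / s + C) * (dist x y)\<^sup>2"
proof -
  obtain L where L: "L-lipschitz_on UNIV g" 
    using g by (auto simp: slope_majorant_def bounded_lipschitz_def)
  then have L0: "0 \<le> L" and gL: "\<bar>g x - g y\<bar> \<le> L * dist x y" for x y
    by (auto simp: lipschitz_on_def dist_real_def)
  obtain r where r: "r > 0" and gr: "\<And>x y. dist x y < r \<Longrightarrow> \<bar>g y - g x\<bar> \<le> G x * dist x y"
    using g by (auto simp: slope_majorant_def)
  have G0: "0 \<le> G x" for x using g by (auto simp: slope_majorant_def)
  define C where "C = 2 * (L / (r * \<delta>) + L\<^sup>2 / \<delta>\<^sup>2)"
  have "2 * (ln (g x) - ln (g y)) \<le> s * (G x / g x)\<^sup>2 + (1 / s + C) * (dist x y)\<^sup>2" if "0 < s" for s x y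
  proof -
    define d where "d = dist x y"
    have d0: "0 \<le> d" by (simp add: d_def)
    have gx: "\<delta> \<le> g x" "0 < g x" and gy: "\<delta> \<le> g y" "0 < g y" using \<delta>(1) \<delta>(2)[of x] \<delta>(2)[of y] by auto
    have pos: "\<bar>g x - g y\<bar> \<le> G x * d + L / r * d\<^sup>2"
    proof (cases "d < r")
      case True
      then have "\<bar>g x - g y\<bar> \<le> G x * d" using gr[of x y] by (simp add: d_def abs_minus_commute)
      moreover have "0 \<le> L / r * d\<^sup>2" using L0 r by simp
      ultimately show ?thesis by linarith
    next
      case False
      then have "1 \<le> d / r" using r by simp
      then have "L * d * 1 \<le> L * d * (d / r)" using L0 d0 by (intro mult_left_mono) auto
      also have "\<dots> = L / r * d\<^sup>2" by (simp add: power2_eq_square)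
      finally have "\<bar>g x - g y\<bar> \<le> L / r * d\<^sup>2" using gL[of x y] by (simp add: d_def)
      moreover have "0 \<le> G x * d" using G0 d0 by simp
      ultimately show ?thesis by linarith
    qed
    have "ln (g x) - ln (g y) = ln (g x / g y)" using gx gy by (simp add: ln_div)
    also have "\<dots> \<le> g x / g y - 1" using gx gy by (intro ln_le_minus_one) auto
    also have "\<dots> = (g x - g y) / g x + (g x - g y)\<^sup>2 / (g x * g y)"
      using gx gy by (simp add: field_simps power2_eq_square)
    also have "\<dots> \<le> (G x * d + L / r * d\<^sup>2) / g x + (L * d)\<^sup>2 / (\<delta> * \<delta>)"
    proof (intro add_mono)
      show "(g x - g y) / g x \<le> (G x * d + L / r * d\<^sup>2) / g x"
        using pos gx by (intro divide_right_mono) auto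
      have "(g x - g y)\<^sup>2 \<le> (L * d)\<^sup>2" using gL[of x y] by (simp add: d_def abs_le_square_iff[symmetric] L0)
      moreover have "\<delta> * \<delta> \<le> g x * g y" using gx gy \<delta>(1) by (intro mult_mono) auto
      ultimately show "(g x - g y)\<^sup>2 / (g x * g y) \<le> (L * d)\<^sup>2 / (\<delta> * \<delta>)"
        using \<delta>(1) by (intro frac_le) auto
    qed
    also have "(G x * d + L / r * d\<^sup>2) / g x \<le> G x / g x * d + L / (r * \<delta>) * d\<^sup>2"
    proof -
      have "L / r * d\<^sup>2 / g x \<le> L / r * d\<^sup>2 / \<delta>" using L0 r gx \<delta>(1) by (intro divide_left_mono) auto
      then show ?thesis by (simp add: add_divide_distrib)
    qed
    finally have "ln (g x) - ln (g y) \<le> G x / g x * d + L / (r * \<delta>) * d\<^sup>2 + (L * d)\<^sup>2 / (\<delta> * \<delta>)" by simp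
    moreover have "C * d\<^sup>2 = 2 * (L / (r * \<delta>) * d\<^sup>2) + 2 * ((L * d)\<^sup>2 / (\<delta> * \<delta>))"
      by (simp add: C_def power_mult_distrib distrib_right power2_eq_square[of \<delta>])
    ultimately have "2 * (ln (g x) - ln (g y)) \<le> 2 * (G x / g x * d) + C * d\<^sup>2"
    proof -
      have "2 * u \<le> 2 * a + w" if "u \<le> a + b + c" "w = 2 * b + 2 * c" for u a b c w :: real
        using that by linarith
      then show ?thesis using \<open>ln (g x) - ln (g y) \<le> _\<close> \<open>C * d\<^sup>2 = _\<close> by blast
    qed
    also have "2 * (G x / g x * d) \<le> s * (G x / g x)\<^sup>2 + 1 / s * d\<^sup>2"
    proof -
      have "(s * a - d)\<^sup>2 / s = s * a\<^sup>2 + 1 / s * d\<^sup>2 - 2 * (a * d)" for a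
        using that by (simp add: power2_eq_square field_simps)
      moreover have "0 \<le> (s * a - d)\<^sup>2 / s" for a using that by simp
      ultimately show ?thesis by (metis diff_ge_0_iff_ge)
    qed
    finally show ?thesis by (simp add: d_def algebra_simps)
  qed
  moreover have "0 \<le> C" using L0 r \<delta>(1) by (simp add: C_def)
  ultimately show thesis using that by blast
qed

definition entropy_integral :: "'a measure \<Rightarrow> ('a \<Rightarrow> real) \<Rightarrow> real" where
  "entropy_integral M f = (\<integral>x. f x * ln (f x) \<partial>M)"

text \<open>
  Densities are parametrised as normalised squares because the Fisher information of \<open>g\<^sup>2 /
  Z\<close>, where \<open>Z = \<integral> g\<^sup>2\<close>, is \<open>4 \<integral> |Dg|\<^sup>2 / Z\<close>,
  without a weight.
\<close>

definition square_density :: "'a measure \<Rightarrow> ('a \<Rightarrow> real) \<Rightarrow> 'a \<Rightarrow> real" where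
  "square_density M g x = (g x)\<^sup>2 / (\<integral>y. (g y)\<^sup>2 \<partial>M)"

lemma (in prob_space) prob_density_real_iff:
  fixes k :: "'a \<Rightarrow> real"
  assumes [measurable]: "k \<in> borel_measurable M" and k0: "\<And>x. 0 \<le> k x"
  shows "prob_space (density M k) \<longleftrightarrow> integrable M k \<and> (\<integral>x. k x \<partial>M) = 1"
proof -
  have "prob_space (density M k) \<longleftrightarrow> (\<integral>\<^sup>+x. ennreal (k x) \<partial>M) = 1"
    by (auto simp: emeasure_density prob_space.emeasure_space_1 cong: nn_integral_cong
        intro!: prob_spaceI dest!: prob_space.emeasure_space_1)
  also have "\<dots> \<longleftrightarrow> integrable M k \<and> (\<integral>x. k x \<partial>M) = 1"
    using nn_integral_eq_integrable[of k M 1] k0 by auto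
  finally show ?thesis .
qed

text \<open>
  Convexity of the entropy: its decrease from \<open>f\<close> to \<open>k\<close> is at most the linear
  decrease predicted by the differential \<open>ln f\<close> at \<open>f\<close>. The bounds on \<open>f\<close>
  make \<open>ln f\<close> a bounded test function.
\<close>

lemma (in prob_space) entropy_integral_diff_le:
  fixes f k :: "'a \<Rightarrow> real"
  assumes [measurable]: "f \<in> borel_measurable M" and f: "0 < c" "\<And>x. c \<le> f x" "\<And>x. f x \<le> B" "(\<integral>x. f x \<partial>M) = 1"
    and k: "\<And>x. 0 \<le> k x" "integrable M k" "(\<integral>x. k x \<partial>M) = 1" "integrable M (\<lambda>x. k x * ln (k x))"
  shows "integrable M (\<lambda>x. k x * ln (f x))"
    and "entropy_integral M f - entropy_integral M k \<le> (\<integral>x. f x * ln (f x) \<partial>M) - (\<integral>x. k x * ln (f x) \<partial>M)"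
proof -
  have fp: "0 < f x" for x using f(1) f(2)[of x] by simp
  have lnf: "\<bar>ln (f x)\<bar> \<le> \<bar>ln c\<bar> + \<bar>ln B\<bar>" for x
  proof -
    have "ln c \<le> ln (f x)" "ln (f x) \<le> ln B" using f fp[of x] by (auto intro!: ln_mono less_le_trans[OF fp f(3)])
    then show ?thesis by linarith
  qed
  show i: "integrable M (\<lambda>x. k x * ln (f x))"
  proof (rule Bochner_Integration.integrable_bound)
    show "integrable M (\<lambda>x. k x * (\<bar>ln c\<bar> + \<bar>ln B\<bar>))" using k(2) by simp
    show "AE x in M. norm (k x * ln (f x)) \<le> norm (k x * (\<bar>ln c\<bar> + \<bar>ln B\<bar>))"
      using lnf k(1) by (auto simp: abs_mult intro!: mult_left_mono)
  qed (use k(2) in measurable)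
  have fi: "integrable M f" using f fp by (intro integrable_bounded_real[where B=B]) (auto simp: less_imp_le abs_of_pos)
  have "(\<integral>x. k x * ln (f x) \<partial>M) = (\<integral>x. k x * ln (f x) + k x - f x \<partial>M)"
    using i k fi f(4) by simp
  also have "\<dots> \<le> (\<integral>x. k x * ln (k x) \<partial>M)"
    using i k fi fp by (intro integral_mono) (auto intro: x_ln_x_tangent)
  finally show "entropy_integral M f - entropy_integral M k \<le> (\<integral>x. f x * ln (f x) \<partial>M) - (\<integral>x. k x * ln (f x) \<partial>M)"
    by (simp add: entropy_integral_def)
qed

locale borel_prob_space = prob_space M for M :: "'a::polish_space measure" +
  assumes sets_M [measurable_cong]: "sets M = sets borel"
begin

lemma borel_imp_measurable: "f \<in> borel_measurable borel \<Longrightarrow> f \<in> borel_measurable M"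
  using measurable_cong_sets[OF sets_M refl] by blast

lemma square_density_props:
  assumes "bounded_lipschitz g" "0 < \<delta>" "\<And>x. \<delta> \<le> g x"
  shows "square_density M g \<in> borel_measurable M" "0 < (\<integral>x. (g x)\<^sup>2 \<partial>M)" "integrable M (\<lambda>x. (g x)\<^sup>2)"
    "(\<integral>x. square_density M g x \<partial>M) = 1" "\<And>x. 0 < square_density M g x"
    "\<exists>c B. 0 < c \<and> (\<forall>x. c \<le> square_density M g x \<and> square_density M g x \<le> B)"
proof -
  have [measurable]: "g \<in> borel_measurable M"
    using assms(1) by (intro borel_imp_measurable bounded_lipschitz_borel_measurable)
  obtain B where B: "0 < B" "\<And>x. \<bar>g x\<bar> \<le> B"
    using bounded_range_realE[of g] assms(1) unfolding bounded_lipschitz_def by metis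
  have le: "\<delta>\<^sup>2 \<le> (g x)\<^sup>2" "(g x)\<^sup>2 \<le> B\<^sup>2" for x
    using assms(2) assms(3)[of x] B(2)[of x] B(1) by (auto simp: abs_le_square_iff[symmetric])
  show i: "integrable M (\<lambda>x. (g x)\<^sup>2)" by (rule integrable_bounded_real[of _ "B\<^sup>2"]) (use le in auto)
  have "(\<integral>x. \<delta>\<^sup>2 \<partial>M) \<le> (\<integral>x. (g x)\<^sup>2 \<partial>M)" using i le by (intro integral_mono) auto
  then show Z: "0 < (\<integral>x. (g x)\<^sup>2 \<partial>M)" using assms(2) by (simp add: prob_space) (metis less_le_trans zero_less_power)
  show "square_density M g \<in> borel_measurable M" by (simp add: square_density_def[abs_def])
  show "(\<integral>x. square_density M g x \<partial>M) = 1" using Z by (simp add: square_density_def)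
  show "0 < square_density M g x" for x
    using assms(2) assms(3)[of x] Z by (simp add: square_density_def)
  show "\<exists>c B. 0 < c \<and> (\<forall>x. c \<le> square_density M g x \<and> square_density M g x \<le> B)"
    using Z le assms(2) unfolding square_density_def
    by (intro exI[of _ "\<delta>\<^sup>2 / (\<integral>x. (g x)\<^sup>2 \<partial>M)"] exI[of _ "B\<^sup>2 / (\<integral>x. (g x)\<^sup>2 \<partial>M)"]) (auto intro: divide_right_mono)
qed

text \<open>
  The easy half of the identification of the metric slope of the entropy with the Fisher information. The
  differential of the entropy at \<open>g\<^sup>2 / Z\<close> is \<open>2 ln g\<close> up to a constant, so by
  convexity the entropy drops at most by the integral of \<open>2 (ln g x - ln g y)\<close> over a coupling,
  which the previous estimate bounds. In the first term the weight \<open>1 / g\<^sup>2\<close> cancels against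
  the density.
\<close>

lemma entropy_drop_le_transport_cost:
  assumes g: "slope_majorant g G" and \<delta>: "0 < \<delta>" "\<And>x. \<delta> \<le> g x"
  obtains C where "0 \<le> C" "\<And>s k \<pi> w. \<lbrakk>0 < s; k \<in> borel_measurable M; \<And>x. 0 \<le> k x; prob_space (density M k);
      integrable M (\<lambda>x. k x * ln (k x)); \<pi> \<in> couplings (density M (square_density M g)) (density M k);
      (\<integral>\<^sup>+z. ennreal ((dist (fst z) (snd z))\<^sup>2) \<partial>\<pi>) \<le> ennreal w; 0 \<le> w\<rbrakk> \<Longrightarrow>
    entropy_integral M (square_density M g) - entropy_integral M k \<le>
      s * ((\<integral>x. (G x)\<^sup>2 \<partial>M) / (\<integral>x. (g x)\<^sup>2 \<partial>M)) + (1 / s + C) * w"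
proof -
  obtain C where C: "0 \<le> C" "\<And>s x y. 0 < s \<Longrightarrow>
    2 * (ln (g x) - ln (g y)) \<le> s * (G x / g x)\<^sup>2 + (1 / s + C) * (dist x y)\<^sup>2"
    using ln_difference_le[OF g \<delta>] by metis
  have bl: "bounded_lipschitz g" and Gm: "G \<in> borel_measurable borel" and "bounded (range G)"
    using g by (auto simp: slope_majorant_def)
  then obtain BG where BG: "0 < BG" "\<And>x. \<bar>G x\<bar> \<le> BG" using bounded_range_realE by metis
  have gm: "g \<in> borel_measurable borel" using bl by (rule bounded_lipschitz_borel_measurable)
  note [measurable] = gm Gm
  let ?f = "square_density M g" and ?Z = "\<integral>x. (g x)\<^sup>2 \<partial>M"
  note f = square_density_props[OF bl \<delta>]
  have Z: "0 < ?Z" by (rule f)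
  obtain c B where cB: "0 < c" "\<And>x. c \<le> ?f x" "\<And>x. ?f x \<le> B" using f(6) by auto
  have g0: "0 < g x" for x using \<delta>(1) \<delta>(2)[of x] by simp
  have "entropy_integral M ?f - entropy_integral M k \<le> s * ((\<integral>x. (G x)\<^sup>2 \<partial>M) / ?Z) + (1 / s + C) * w"
    if s: "0 < s" and k: "k \<in> borel_measurable M" "\<And>x. 0 \<le> k x" "prob_space (density M k)" "integrable M (\<lambda>x. k x * ln (k x))"
      and \<pi>: "\<pi> \<in> couplings (density M ?f) (density M k)"
      and w: "(\<integral>\<^sup>+z. ennreal ((dist (fst z) (snd z))\<^sup>2) \<partial>\<pi>) \<le> ennreal w" "0 \<le> w" for s k \<pi> w
  proof -
    have s\<pi>[measurable_cong]: "sets \<pi> = sets (borel \<Otimes>\<^sub>M borel)"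
      and d1: "distr \<pi> borel fst = density M ?f" and d2: "distr \<pi> borel snd = density M k"
      using \<pi> by (auto simp: couplings_def)
    have ki: "integrable M k" "(\<integral>x. k x \<partial>M) = 1" using prob_density_real_iff[OF k(1,2)] k(3) by auto
    note ed = entropy_integral_diff_le[OF f(1) cB f(4) k(2) ki k(4)]
    have [measurable]: "(\<lambda>x. ln (?f x)) \<in> borel_measurable borel" "?f \<in> borel_measurable borel"
      by (auto simp: square_density_def[abs_def])
    have fm: "AE x in M. 0 \<le> ?f x" using f(5) by (simp add: less_imp_le)
    have first: "integrable \<pi> (\<lambda>z. u (fst z)) \<and> (\<integral>z. u (fst z) \<partial>\<pi>) = (\<integral>x. ?f x * u x \<partial>M)"
      if [measurable]: "u \<in> borel_measurable borel" and iu: "integrable M (\<lambda>x. ?f x * u x)" for u :: "'a \<Rightarrow> real"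
    proof -
      have um: "u \<in> borel_measurable M" by measurable
      have "integrable (density M ?f) u" using iu integrable_density[OF um f(1) fm] by simp
      then have "integrable \<pi> (\<lambda>z. u (fst z))"
        unfolding d1[symmetric] by (subst (asm) integrable_distr_eq) auto
      moreover have "(\<integral>z. u (fst z) \<partial>\<pi>) = (\<integral>x. u x \<partial>density M ?f)"
        unfolding d1[symmetric] by (subst integral_distr) auto
      ultimately show ?thesis using integral_density[OF um f(1) fm] by simp
    qed
    have second: "integrable \<pi> (\<lambda>z. ln (?f (snd z))) \<and> (\<integral>z. ln (?f (snd z)) \<partial>\<pi>) = (\<integral>x. k x * ln (?f x) \<partial>M)"
    proof -
      have um: "(\<lambda>x. ln (?f x)) \<in> borel_measurable M" by measurable
      have km: "AE x in M. 0 \<le> k x" using k by simp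
      have "integrable (density M k) (\<lambda>x. ln (?f x))" using ed(1) integrable_density[OF um k(1) km] by simp
      then have "integrable \<pi> (\<lambda>z. ln (?f (snd z)))"
        unfolding d2[symmetric] by (subst (asm) integrable_distr_eq) auto
      moreover have "(\<integral>z. ln (?f (snd z)) \<partial>\<pi>) = (\<integral>x. ln (?f x) \<partial>density M k)"
        unfolding d2[symmetric] by (subst integral_distr) auto
      ultimately show ?thesis using integral_density[OF um k(1) km] by simp
    qed
    have lnfi: "integrable M (\<lambda>x. ?f x * ln (?f x))"
      using f(1) less_imp_le[OF f(5)] cB(3) by (rule integrable_x_ln_x)
    have first_ln: "integrable \<pi> (\<lambda>z. ln (?f (fst z)))" "(\<integral>z. ln (?f (fst z)) \<partial>\<pi>) = (\<integral>x. ?f x * ln (?f x) \<partial>M)"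
      using first[of "\<lambda>x. ln (?f x)"] lnfi by auto
    have GG: "?f x * (G x / g x)\<^sup>2 = (G x)\<^sup>2 / ?Z" for x
      using g0[of x] Z by (simp add: square_density_def power_divide)
    have "integrable M (\<lambda>x. (G x)\<^sup>2)"
      using BG(2) BG(1) by (intro integrable_bounded_real[of _ "BG\<^sup>2"]) (auto simp: abs_le_square_iff[symmetric])
    then have first_G: "integrable \<pi> (\<lambda>z. (G (fst z) / g (fst z))\<^sup>2)"
      "(\<integral>z. (G (fst z) / g (fst z))\<^sup>2 \<partial>\<pi>) = (\<integral>x. (G x)\<^sup>2 \<partial>M) / ?Z"
      using first[of "\<lambda>x. (G x / g x)\<^sup>2"] by (auto simp: GG)
    have di: "integrable \<pi> (\<lambda>z. (dist (fst z) (snd z))\<^sup>2)"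
      using w by (intro integrableI_bounded) (auto intro: le_less_trans)
    have dw: "(\<integral>z. (dist (fst z) (snd z))\<^sup>2 \<partial>\<pi>) \<le> w"
      using w nn_integral_eq_integral[OF di] by simp
    have "entropy_integral M ?f - entropy_integral M k \<le> (\<integral>x. ?f x * ln (?f x) \<partial>M) - (\<integral>x. k x * ln (?f x) \<partial>M)"
      by (rule ed(2))
    also have "\<dots> = (\<integral>z. ln (?f (fst z)) - ln (?f (snd z)) \<partial>\<pi>)"
      using first_ln second by simp
    also have "\<dots> \<le> (\<integral>z. s * (G (fst z) / g (fst z))\<^sup>2 + (1 / s + C) * (dist (fst z) (snd z))\<^sup>2 \<partial>\<pi>)"
    proof (intro integral_mono)
      fix z
      have "ln (?f x) = 2 * ln (g x) - ln ?Z" for x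
        using g0[of x] Z by (simp add: square_density_def ln_div ln_realpow)
      then show "ln (?f (fst z)) - ln (?f (snd z)) \<le> s * (G (fst z) / g (fst z))\<^sup>2 + (1 / s + C) * (dist (fst z) (snd z))\<^sup>2"
        using C(2)[OF s, of "fst z" "snd z"] by simp
    qed (use first_ln second first_G di in auto)
    also have "\<dots> = s * ((\<integral>x. (G x)\<^sup>2 \<partial>M) / ?Z) + (1 / s + C) * (\<integral>z. (dist (fst z) (snd z))\<^sup>2 \<partial>\<pi>)"
      using first_G di by simp
    also have "\<dots> \<le> s * ((\<integral>x. (G x)\<^sup>2 \<partial>M) / ?Z) + (1 / s + C) * w"
      using dw C(1) s by (intro add_left_mono mult_left_mono) auto
    finally show ?thesis .
  qed
  with C(1) show thesis by (rule that)
qed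

end

section \<open>The HWI inequality\<close>

lemma le_if_le_add_mult_small:
  fixes a b c :: real
  assumes "\<And>e. 0 < e \<Longrightarrow> e \<le> 1 \<Longrightarrow> a \<le> b + c * e"
  shows "a \<le> b"
proof (rule tendsto_lowerbound)
  show "((\<lambda>e. b + c * e) \<longlongrightarrow> b) (at_right 0)"
    by (rule tendsto_eq_intros refl | simp)+
  show "\<forall>\<^sub>F e in at_right 0. a \<le> b + c * e"
    using assms by (auto simp: eventually_at_right_field intro!: exI[of _ 1])
qed simp

context borel_prob_space
begin

lemma density_bounded_in_Ent_domain:
  assumes [measurable]: "k \<in> borel_measurable M" and k: "\<And>x. 0 \<le> k x" "\<And>x. k x \<le> B" "(\<integral>x. k x \<partial>M) = 1"
    and m2: "(\<integral>\<^sup>+x. ennreal ((dist p x)\<^sup>2) \<partial>M) < \<infinity>"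
  shows "integrable M k" "prob_space (density M k)" "integrable M (\<lambda>x. k x * ln (k x))" "density M k \<in> P2"
    "Ent M (density M k) = ereal (entropy_integral M k)" "density M k \<in> Ent_domain M"
proof -
  show ik: "integrable M k" using k by (intro integrable_bounded_real[of _ B]) auto
  show pk: "prob_space (density M k)" using prob_density_real_iff[of k] ik k by simp
  show il: "integrable M (\<lambda>x. k x * ln (k x))" by (rule integrable_x_ln_x[OF assms(1) k(1,2)])
  have "(\<integral>\<^sup>+x. ennreal ((dist p x)\<^sup>2) \<partial>density M k) = (\<integral>\<^sup>+x. ennreal (k x) * ennreal ((dist p x)\<^sup>2) \<partial>M)"
    by (subst nn_integral_density) auto
  also have "\<dots> \<le> (\<integral>\<^sup>+x. ennreal B * ennreal ((dist p x)\<^sup>2) \<partial>M)"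
    using k(2) by (intro nn_integral_mono mult_right_mono ennreal_leI) auto
  also have "\<dots> = ennreal B * (\<integral>\<^sup>+x. ennreal ((dist p x)\<^sup>2) \<partial>M)" by (rule nn_integral_cmult) simp
  also have "\<dots> < \<infinity>" using m2 by (simp add: ennreal_mult_less_top)
  finally show P2: "density M k \<in> P2" using pk by (auto simp: P2_def sets_M)
  show E: "Ent M (density M k) = ereal (entropy_integral M k)"
    using pk k(1) il by (simp add: Ent_density ext_integral_eq_integral entropy_integral_def)
  show "density M k \<in> Ent_domain M" using P2 E by (simp add: Ent_domain_def)
qed

text \<open>
  The HWI inequality, in the form obtained from the usual one by Young's inequality with parameter
  \<open>s\<close>. Follow the geodesic from \<open>g\<^sup>2 / Z\<close> to \<open>f1\<close> that the
  curvature condition provides. At time \<open>t\<close> the convexity along it bounds the entropy from above,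
  while the slope estimate bounds it from below at transport cost \<open>t\<^sup>2 W\<^sup>2\<close>. Dividing
  by \<open>t\<close> and letting \<open>t\<close> tend to \<open>0\<close> gives the claim.
\<close>

lemma HWI_inequality:
  assumes CD: "CD_space (- K) M"
    and g: "slope_majorant g G" and \<delta>: "0 < \<delta>" "\<And>x. \<delta> \<le> g x"
    and f1: "f1 \<in> borel_measurable M" "\<And>x. 0 \<le> f1 x" "\<And>x. f1 x \<le> B1" "(\<integral>x. f1 x \<partial>M) = 1"
    and m2: "(\<integral>\<^sup>+x. ennreal ((dist p x)\<^sup>2) \<partial>M) < \<infinity>" and s: "0 < s"
  shows "entropy_integral M (square_density M g) - entropy_integral M f1 \<le>
    s * ((\<integral>x. (G x)\<^sup>2 \<partial>M) / (\<integral>x. (g x)\<^sup>2 \<partial>M)) +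
    (1 / s + K / 2) * (W2 (density M (square_density M g)) (density M f1))\<^sup>2"
proof -
  let ?f = "square_density M g"
  let ?\<rho>0 = "density M ?f" and ?\<rho>1 = "density M f1"
  let ?E0 = "entropy_integral M ?f" and ?E1 = "entropy_integral M f1"
  let ?J = "(\<integral>x. (G x)\<^sup>2 \<partial>M) / (\<integral>x. (g x)\<^sup>2 \<partial>M)" and ?W = "W2 (density M (square_density M g)) (density M f1)"
  have bl: "bounded_lipschitz g" using g by (simp add: slope_majorant_def)
  note f = square_density_props[OF bl \<delta>]
  obtain B where B: "\<And>x. ?f x \<le> B" using f(6) by auto
  note d0 = density_bounded_in_Ent_domain[OF f(1) less_imp_le[OF f(5)] B f(4) m2]
  note d1 = density_bounded_in_Ent_domain[OF f1 m2]
  obtain \<eta> where geo: "geodesic_in P2 W2 \<eta>" and ends: "\<eta> 0 = ?\<rho>0" "\<eta> 1 = ?\<rho>1"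
    and conv: "\<And>t. t \<in> {0..1} \<Longrightarrow> Ent M (\<eta> t) \<le> ereal (1 - t) * Ent M ?\<rho>0 + ereal t * Ent M ?\<rho>1
           - ereal (- K / 2 * t * (1 - t) * ?W\<^sup>2)"
    using CD d0(6) d1(6) unfolding CD_space_def by blast
  obtain C where C: "0 \<le> C" "\<And>s k \<pi> w. \<lbrakk>0 < s; k \<in> borel_measurable M; \<And>x. 0 \<le> k x; prob_space (density M k);
      integrable M (\<lambda>x. k x * ln (k x)); \<pi> \<in> couplings (density M (square_density M g)) (density M k);
      (\<integral>\<^sup>+z. ennreal ((dist (fst z) (snd z))\<^sup>2) \<partial>\<pi>) \<le> ennreal w; 0 \<le> w\<rbrakk> \<Longrightarrow>
    entropy_integral M (square_density M g) - entropy_integral M k \<le> s * ?J + (1 / s + C) * w"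
    using entropy_drop_le_transport_cost[OF g \<delta>] by blast
  have "?E0 - ?E1 \<le> s * ?J + (1 / s + K / 2) * ?W\<^sup>2 + ((C - K / 2) * ?W\<^sup>2) * t" if t: "0 < t" "t \<le> 1" for t
  proof -
    have Et: "Ent M (\<eta> t) \<le> ereal ((1 - t) * ?E0 + t * ?E1 + K / 2 * t * (1 - t) * ?W\<^sup>2)"
      using conv[of t] t d0(5) d1(5) by simp
    have P2t: "\<eta> t \<in> P2" using geo t by (auto simp: geodesic_in_def)
    have "\<forall>a\<in>{0..1}. \<forall>b\<in>{0..1}. W2 (\<eta> a) (\<eta> b) = \<bar>b - a\<bar> * W2 (\<eta> 0) (\<eta> 1)"
      using geo unfolding geodesic_in_def by blast
    from bspec[OF bspec[OF this, of 0], of t] t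
    have Wt: "W2 ?\<rho>0 (\<eta> t) = t * ?W" by (simp add: ends)
    have "Ent M (\<eta> t) < \<infinity>" using Et by (rule le_less_trans) simp
    then obtain k where k: "k \<in> borel_measurable M" "\<And>x. 0 \<le> k x" and \<eta>k: "\<eta> t = density M k"
      and ki: "integrable M (\<lambda>x. k x * ln (k x))" and Ek: "Ent M (\<eta> t) = ereal (\<integral>x. k x * ln (k x) \<partial>M)"
      using finite_EntE[of "\<eta> t"] P2t by (auto simp: P2_def)
    \<comment> \<open>The Young parameter has to be of order t: it is s t here. The cost of an almost optimal
      coupling exceeds (t W)^2 by e.\<close>
    have "?E0 - entropy_integral M k \<le> s * t * ?J + (1 / (s * t) + C) * (t * ?W)\<^sup>2 + (1 / (s * t) + C) * e"
      if e: "0 < e" for e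
    proof -
      obtain \<pi> where "\<pi> \<in> couplings ?\<rho>0 (\<eta> t)"
        "(\<integral>\<^sup>+z. ennreal ((dist (fst z) (snd z))\<^sup>2) \<partial>\<pi>) \<le> ennreal ((W2 ?\<rho>0 (\<eta> t))\<^sup>2 + e)"
        using W2_near_optimal_coupling[OF d0(4) P2t e] by blast
      then have "?E0 - entropy_integral M k \<le> s * t * ?J + (1 / (s * t) + C) * ((W2 ?\<rho>0 (\<eta> t))\<^sup>2 + e)"
        using s t e k ki P2t by (intro C(2)) (auto simp: \<eta>k P2_def)
      then show ?thesis by (simp add: Wt distrib_left)
    qed
    then have "?E0 - entropy_integral M k \<le> s * t * ?J + (1 / (s * t) + C) * (t * ?W)\<^sup>2"
      by (rule le_if_le_add_mult_small)
    moreover have "entropy_integral M k \<le> (1 - t) * ?E0 + t * ?E1 + K / 2 * t * (1 - t) * ?W\<^sup>2"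
      using Et Ek by (simp add: entropy_integral_def)
    ultimately have "t * (?E0 - ?E1) \<le> s * t * ?J + (1 / (s * t) + C) * (t * ?W)\<^sup>2 + K / 2 * t * (1 - t) * ?W\<^sup>2"
      by (simp add: algebra_simps)
    also have "\<dots> = t * (s * ?J + (1 / s + K / 2) * ?W\<^sup>2 + ((C - K / 2) * ?W\<^sup>2) * t)"
    proof -
      have "1 / (s * t) * (t * ?W)\<^sup>2 = t * (1 / s * ?W\<^sup>2)" using t s by (simp add: power2_eq_square)
      then have "(1 / (s * t) + C) * (t * ?W)\<^sup>2 = t * (1 / s * ?W\<^sup>2) + C * (t * ?W)\<^sup>2" by (simp only: distrib_right)
      moreover have "s * t * j + (t * (i * w\<^sup>2) + C * (t * w)\<^sup>2) + k * t * (1 - t) * w\<^sup>2 =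
          t * (s * j + (i + k) * w\<^sup>2 + ((C - k) * w\<^sup>2) * t)" for i j k w :: real
        by (simp add: power2_eq_square algebra_simps)
      ultimately show ?thesis by (simp only:)
    qed
    finally show ?thesis using t by simp
  qed
  then show ?thesis by (rule le_if_le_add_mult_small)
qed

end

section \<open>Gaussian integrability\<close>

locale gaussian_CD_space = borel_prob_space M for M :: "'a::polish_space measure" +
  fixes K \<epsilon> :: real and p :: 'a
  assumes K: "0 \<le> K" and \<epsilon>: "0 < \<epsilon>" and CD: "CD_space (- K) M"
    and gaussian: "(\<integral>\<^sup>+x. ennreal (exp ((K / 2 + \<epsilon>) * (dist p x)\<^sup>2)) \<partial>M) < \<infinity>"
begin

definition "gaussian_moment = (\<integral>x. exp ((K / 2 + \<epsilon>) * (dist p x)\<^sup>2) \<partial>M)"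

definition "second_moment = (\<integral>x. (dist p x)\<^sup>2 \<partial>M)"

lemma rate_pos: "0 < K / 2 + \<epsilon>" using K \<epsilon> by simp

lemma integrable_exp_dist: "integrable M (\<lambda>x. exp ((K / 2 + \<epsilon>) * (dist p x)\<^sup>2))"
  using gaussian by (intro integrableI_bounded) auto

lemma integrable_dist_squared: "integrable M (\<lambda>x. (dist p x)\<^sup>2)"
proof (rule Bochner_Integration.integrable_bound)
  show "integrable M (\<lambda>x. exp ((K / 2 + \<epsilon>) * (dist p x)\<^sup>2) / (K / 2 + \<epsilon>))"
    using integrable_exp_dist by simp
  have "(dist p x)\<^sup>2 \<le> exp ((K / 2 + \<epsilon>) * (dist p x)\<^sup>2) / (K / 2 + \<epsilon>)" for x
  proof -
    have "(K / 2 + \<epsilon>) * (dist p x)\<^sup>2 \<le> exp ((K / 2 + \<epsilon>) * (dist p x)\<^sup>2)"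
      using exp_ge_add_one_self[of "(K / 2 + \<epsilon>) * (dist p x)\<^sup>2"] by linarith
    then show ?thesis using rate_pos by (simp add: pos_le_divide_eq mult.commute)
  qed
  then show "AE x in M. norm ((dist p x)\<^sup>2) \<le> norm (exp ((K / 2 + \<epsilon>) * (dist p x)\<^sup>2) / (K / 2 + \<epsilon>))"
    using rate_pos by (auto simp: abs_of_pos)
qed simp

lemma gaussian_moment_nonneg: "0 \<le> gaussian_moment" and second_moment_nonneg: "0 \<le> second_moment"
  by (simp_all add: gaussian_moment_def second_moment_def)

lemma second_moment_finite: "(\<integral>\<^sup>+x. ennreal ((dist p x)\<^sup>2) \<partial>M) < \<infinity>"
  using integrable_dist_squared by (subst nn_integral_eq_integral) auto

text \<open>
  The Gibbs variational principle for the function \<open>(K / 2 + \<epsilon>) (dist p x)\<^sup>2\<close>, whose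
  exponential is integrable by assumption. It bounds transport costs by the entropy itself, with the rate
  \<open>K / 2 + \<epsilon>\<close> as denominator.
\<close>

lemma second_moment_le_entropy:
  assumes [measurable]: "f \<in> borel_measurable M" and f: "\<And>x. 0 \<le> f x" "\<And>x. f x \<le> B" "(\<integral>x. f x \<partial>M) = 1"
  shows "integrable M (\<lambda>x. f x * (dist p x)\<^sup>2)"
    and "(\<integral>x. f x * (dist p x)\<^sup>2 \<partial>M) \<le> (entropy_integral M f + gaussian_moment) / (K / 2 + \<epsilon>)"
proof -
  let ?b = "K / 2 + \<epsilon>"
  note df = density_bounded_in_Ent_domain[OF assms second_moment_finite]
  show i: "integrable M (\<lambda>x. f x * (dist p x)\<^sup>2)"
  proof (rule Bochner_Integration.integrable_bound)
    show "integrable M (\<lambda>x. B * (dist p x)\<^sup>2)" using integrable_dist_squared by simp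
    show "AE x in M. norm (f x * (dist p x)\<^sup>2) \<le> norm (B * (dist p x)\<^sup>2)"
    proof (intro AE_I2)
      fix x
      have "\<bar>f x\<bar> \<le> \<bar>B\<bar>" using f(1)[of x] f(2)[of x] by linarith
      then show "norm (f x * (dist p x)\<^sup>2) \<le> norm (B * (dist p x)\<^sup>2)"
        by (simp add: abs_mult mult_right_mono)
    qed
  qed simp
  have "(\<integral>x. ?b * (f x * (dist p x)\<^sup>2) \<partial>M) \<le> (\<integral>x. f x * ln (f x) + exp (?b * (dist p x)\<^sup>2) \<partial>M)"
  proof (intro integral_mono)
    fix x
    show "?b * (f x * (dist p x)\<^sup>2) \<le> f x * ln (f x) + exp (?b * (dist p x)\<^sup>2)"
      using x_ln_x_tangent[of "f x" "exp (?b * (dist p x)\<^sup>2)"] f(1)[of x] by (simp add: mult.left_commute)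
  qed (use i df(3) integrable_exp_dist in auto)
  then have "?b * (\<integral>x. f x * (dist p x)\<^sup>2 \<partial>M) \<le> entropy_integral M f + gaussian_moment"
    using i df(3) integrable_exp_dist by (simp add: entropy_integral_def gaussian_moment_def)
  then show "(\<integral>x. f x * (dist p x)\<^sup>2 \<partial>M) \<le> (entropy_integral M f + gaussian_moment) / ?b"
    using rate_pos by (simp add: pos_le_divide_eq mult.commute)
qed

text \<open>
  The HWI inequality between \<open>f = g\<^sup>2 / Z\<close> and \<open>(1 - h) f + h\<close>, the mixture of
  \<open>f\<close> with the reference measure, with the Wasserstein distance replaced by the cost of the mixture
  coupling. The parameter \<open>\<theta>\<close> splits the square of the triangle inequality through
  \<open>p\<close>, so that the second moment of \<open>f\<close> enters with a factor arbitrarily close to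
  \<open>1\<close>.
\<close>

lemma entropy_drop_towards_reference:
  assumes g: "slope_majorant g G" and \<delta>: "0 < \<delta>" "\<And>x. \<delta> \<le> g x"
    and h: "0 \<le> h" "h \<le> 1" and s: "0 < s" and \<theta>: "0 < \<theta>"
  shows "entropy_integral M (square_density M g) - entropy_integral M (\<lambda>x. (1 - h) * square_density M g x + h) \<le>
    s * ((\<integral>x. (G x)\<^sup>2 \<partial>M) / (\<integral>x. (g x)\<^sup>2 \<partial>M)) +
    (1 / s + K / 2) * (h * ((1 + \<theta>) * ((entropy_integral M (square_density M g) + gaussian_moment) / (K / 2 + \<epsilon>)) + (1 + 1 / \<theta>) * second_moment))"
proof -
  let ?f = "square_density M g" and ?f1 = "\<lambda>x. (1 - h) * square_density M g x + h"
  have bl: "bounded_lipschitz g" using g by (simp add: slope_majorant_def)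
  note f = square_density_props[OF bl \<delta>]
  note [measurable] = f(1)
  obtain B where B: "\<And>x. ?f x \<le> B" using f(6) by auto
  have f0: "0 \<le> ?f x" for x using f(5)[of x] by simp
  have fi: "integrable M ?f" using f0 B by (intro integrable_bounded_real[of _ B]) auto
  note d0 = density_bounded_in_Ent_domain[OF f(1) f0 B f(4) second_moment_finite]
  note mom = second_moment_le_entropy[OF f(1) f0 B f(4)]
  have f1: "0 \<le> ?f1 x" "?f1 x \<le> B + 1" for x
  proof -
    show "0 \<le> ?f1 x" using f0[of x] h by simp
    have "(1 - h) * ?f x \<le> 1 * ?f x" using f0[of x] h by (intro mult_right_mono) auto
    then show "?f1 x \<le> B + 1" using B[of x] h by simp
  qed
  have f1_int: "(\<integral>x. ?f1 x \<partial>M) = 1" using fi f(4) by (simp add: prob_space)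
  let ?D = "(1 + \<theta>) * (\<integral>x. ?f x * (dist p x)\<^sup>2 \<partial>M) + (1 + 1 / \<theta>) * second_moment"
  have D0: "0 \<le> ?D" using \<theta> f0 second_moment_nonneg by (intro add_nonneg_nonneg mult_nonneg_nonneg integral_nonneg) auto
  have dd: "(dist x y)\<^sup>2 \<le> (1 + \<theta>) * (dist p x)\<^sup>2 + (1 + 1 / \<theta>) * (dist p y)\<^sup>2" for x y
  proof -
    have "(dist x y)\<^sup>2 \<le> (dist p x + dist p y)\<^sup>2"
      using dist_triangle[of x y p] by (intro power_mono) (auto simp: dist_commute)
    also have "\<dots> = (1 + \<theta>) * (dist p x)\<^sup>2 + (1 + 1 / \<theta>) * (dist p y)\<^sup>2 - (\<theta> * dist p x - dist p y)\<^sup>2 / \<theta>"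
      using \<theta> by (simp add: power2_eq_square field_simps)
    also have "\<dots> \<le> (1 + \<theta>) * (dist p x)\<^sup>2 + (1 + 1 / \<theta>) * (dist p y)\<^sup>2" using \<theta> by simp
    finally show ?thesis .
  qed
  have "(\<integral>\<^sup>+x. \<integral>\<^sup>+y. ennreal ((dist x y)\<^sup>2) \<partial>M \<partial>density M ?f) \<le>
      (\<integral>\<^sup>+x. ennreal ((1 + \<theta>) * (dist p x)\<^sup>2 + (1 + 1 / \<theta>) * second_moment) \<partial>density M ?f)"
  proof (intro nn_integral_mono)
    fix x
    have "(\<integral>\<^sup>+y. ennreal ((dist x y)\<^sup>2) \<partial>M) \<le> (\<integral>\<^sup>+y. ennreal ((1 + \<theta>) * (dist p x)\<^sup>2 + (1 + 1 / \<theta>) * (dist p y)\<^sup>2) \<partial>M)"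
      by (intro nn_integral_mono ennreal_leI dd)
    also have "\<dots> = ennreal (\<integral>y. (1 + \<theta>) * (dist p x)\<^sup>2 + (1 + 1 / \<theta>) * (dist p y)\<^sup>2 \<partial>M)"
      using \<theta> integrable_dist_squared by (intro nn_integral_eq_integral) auto
    also have "(\<integral>y. (1 + \<theta>) * (dist p x)\<^sup>2 + (1 + 1 / \<theta>) * (dist p y)\<^sup>2 \<partial>M) = (1 + \<theta>) * (dist p x)\<^sup>2 + (1 + 1 / \<theta>) * second_moment"
      using integrable_dist_squared by (simp add: second_moment_def prob_space)
    finally show "(\<integral>\<^sup>+y. ennreal ((dist x y)\<^sup>2) \<partial>M) \<le> ennreal ((1 + \<theta>) * (dist p x)\<^sup>2 + (1 + 1 / \<theta>) * second_moment)" .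
  qed
  also have "\<dots> = (\<integral>\<^sup>+x. ennreal (?f x * ((1 + \<theta>) * (dist p x)\<^sup>2 + (1 + 1 / \<theta>) * second_moment)) \<partial>M)"
    using \<theta> f0 second_moment_nonneg by (subst nn_integral_density) (auto simp: ennreal_mult)
  also have "\<dots> = (\<integral>\<^sup>+x. ennreal ((1 + \<theta>) * (?f x * (dist p x)\<^sup>2) + (1 + 1 / \<theta>) * second_moment * ?f x) \<partial>M)"
    by (simp add: algebra_simps)
  also have "\<dots> = ennreal (\<integral>x. (1 + \<theta>) * (?f x * (dist p x)\<^sup>2) + (1 + 1 / \<theta>) * second_moment * ?f x \<partial>M)"
    using \<theta> f0 second_moment_nonneg mom(1) fi by (intro nn_integral_eq_integral) auto
  also have "(\<integral>x. (1 + \<theta>) * (?f x * (dist p x)\<^sup>2) + (1 + 1 / \<theta>) * second_moment * ?f x \<partial>M) = ?D"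
    using mom(1) fi f(4) by simp
  finally have cost: "(\<integral>\<^sup>+x. \<integral>\<^sup>+y. ennreal ((dist x y)\<^sup>2) \<partial>M \<partial>density M ?f) \<le> ennreal ?D" .
  have "(W2 (density M ?f) (density M ?f1))\<^sup>2 \<le> h * ?D"
  proof (rule W2_squared_mixture_le[OF _ _ _ _ h _ _ cost D0])
    fix A :: "'a set" assume "A \<in> sets borel"
    then have [measurable]: "A \<in> sets M" by (simp add: sets_M)
    have "emeasure (density M ?f1) A = (\<integral>\<^sup>+x. ennreal (1 - h) * (ennreal (?f x) * indicator A x) + ennreal h * indicator A x \<partial>M)"
      using h f0 by (subst emeasure_density) (auto simp: ennreal_mult indicator_def intro!: nn_integral_cong)
    also have "\<dots> = ennreal h * emeasure M A + ennreal (1 - h) * emeasure (density M ?f) A"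
      by (simp add: nn_integral_add nn_integral_cmult emeasure_density add.commute)
    finally show "emeasure (density M ?f1) A = ennreal h * emeasure M A + ennreal (1 - h) * emeasure (density M ?f) A" .
  qed (use d0(2) sets_M in \<open>auto intro: prob_space_axioms\<close>)
  also have "\<dots> \<le> h * ((1 + \<theta>) * ((entropy_integral M ?f + gaussian_moment) / (K / 2 + \<epsilon>)) + (1 + 1 / \<theta>) * second_moment)"
    using mom(2) h \<theta> by (intro mult_left_mono add_right_mono) auto
  finally have W: "(W2 (density M ?f) (density M ?f1))\<^sup>2 \<le> h * ((1 + \<theta>) * ((entropy_integral M ?f + gaussian_moment) / (K / 2 + \<epsilon>)) + (1 + 1 / \<theta>) * second_moment)" .
  have "entropy_integral M ?f - entropy_integral M ?f1 \<le>
    s * ((\<integral>x. (G x)\<^sup>2 \<partial>M) / (\<integral>x. (g x)\<^sup>2 \<partial>M)) + (1 / s + K / 2) * (W2 (density M ?f) (density M ?f1))\<^sup>2"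
    by (rule HWI_inequality[OF CD g \<delta> _ f1 f1_int second_moment_finite s]) simp
  also have "\<dots> \<le> s * ((\<integral>x. (G x)\<^sup>2 \<partial>M) / (\<integral>x. (g x)\<^sup>2 \<partial>M)) +
    (1 / s + K / 2) * (h * ((1 + \<theta>) * ((entropy_integral M ?f + gaussian_moment) / (K / 2 + \<epsilon>)) + (1 + 1 / \<theta>) * second_moment))"
    using W s K by (intro add_left_mono mult_left_mono) auto
  finally show ?thesis .
qed

end

section \<open>Log-Sobolev inequality for functions with a slope majorant\<close>

context prob_space
begin

text \<open>
  If the density \<open>f\<close> is at most \<open>h\<close> on half of the space, then moving the fraction
  \<open>h\<close> of its mass to the reference measure puts mass at least \<open>h / 2\<close> where the
  density is of order \<open>h\<close> and the derivative of the entropy is about \<open>ln h\<close>. The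
  entropy therefore falls by at least \<open>(h / 2) ln (1 / h)\<close>, up to a multiple of \<open>h\<close>.
  The proof uses the tangent of the entropy at the mixture.
\<close>

lemma entropy_drop_on_small_set:
  fixes f :: "'a \<Rightarrow> real"
  assumes [measurable]: "f \<in> borel_measurable M" and f: "\<And>x. 0 < f x" "\<And>x. f x \<le> B" "(\<integral>x. f x \<partial>M) = 1"
    and h: "0 < h" "h \<le> 1 / 2" and small: "1 / 2 \<le> prob {x \<in> space M. f x \<le> h}"
  shows "h * (ln (1 / (2 * h)) / 2 - 2) \<le> entropy_integral M f - entropy_integral M (\<lambda>x. (1 - h) * f x + h)"
proof -
  let ?f1 = "\<lambda>x. (1 - h) * f x + h" and ?A = "{x \<in> space M. f x \<le> h}"
  have f1: "h \<le> ?f1 x" "?f1 x \<le> B + 1" "0 < ?f1 x" "?f1 x \<le> f x + h" for x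
  proof -
    show "h \<le> ?f1 x" using f(1)[of x] h by simp
    then show "0 < ?f1 x" using h by linarith
    have "(1 - h) * f x \<le> 1 * f x" using f(1)[of x] h by (intro mult_right_mono) auto
    then show "?f1 x \<le> f x + h" by simp
    then show "?f1 x \<le> B + 1" using f(2)[of x] h by simp
  qed
  have fi: "integrable M f" using f by (intro integrable_bounded_real[of _ B]) (auto simp: abs_of_pos)
  have f1_int: "(\<integral>x. ?f1 x \<partial>M) = 1" and f1i: "integrable M ?f1" using fi f(3) by (auto simp: prob_space)
  have bounded_ln: "integrable M (\<lambda>x. u x * ln (v x))"
    if [measurable]: "u \<in> borel_measurable M" "v \<in> borel_measurable M" and u: "\<And>x. 0 \<le> u x" "\<And>x. u x \<le> b"
      and v: "\<And>x. h \<le> v x" "\<And>x. v x \<le> c" for u v b c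
  proof (rule integrable_bounded_real)
    fix x
    have "ln h \<le> ln (v x)" "ln (v x) \<le> ln c"
      using v[of x] h(1) by (auto intro!: ln_mono)
    then have "\<bar>ln (v x)\<bar> \<le> \<bar>ln h\<bar> + \<bar>ln c\<bar>" by linarith
    then show "\<bar>u x * ln (v x)\<bar> \<le> b * (\<bar>ln h\<bar> + \<bar>ln c\<bar>)"
      using u[of x] unfolding abs_mult by (intro mult_mono) auto
  qed measurable
  have i1: "integrable M (\<lambda>x. f x * ln (?f1 x))"
    using f f1 by (intro bounded_ln[of _ _ B "B + 1"]) (auto simp: less_imp_le)
  have i2: "integrable M (\<lambda>x. ln (?f1 x))"
    using bounded_ln[of "\<lambda>_. 1" ?f1 1 "B + 1"] f1 by simp
  have flnf: "integrable M (\<lambda>x. f x * ln (f x))"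
    by (rule integrable_x_ln_x[OF assms(1) less_imp_le[OF f(1)] f(2)])
  have "entropy_integral M ?f1 - entropy_integral M f \<le> (\<integral>x. ?f1 x * ln (?f1 x) \<partial>M) - (\<integral>x. f x * ln (?f1 x) \<partial>M)"
    by (rule entropy_integral_diff_le(2)[OF _ h(1) f1(1,2) f1_int _ fi f(3) flnf]) (auto simp: less_imp_le f)
  also have "\<dots> = h * ((\<integral>x. ln (?f1 x) \<partial>M) - (\<integral>x. f x * ln (?f1 x) \<partial>M))"
  proof -
    have "?f1 x * ln (?f1 x) = h * ln (?f1 x) + (1 - h) * (f x * ln (?f1 x))" for x by (simp add: algebra_simps)
    then show ?thesis using i1 i2 by (simp add: algebra_simps)
  qed
  also have "\<dots> \<le> h * ((ln (2 * h) / 2 + 1) - (- 1))"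
  proof (intro mult_left_mono diff_mono)
    have "(\<integral>x. ln (?f1 x) \<partial>M) \<le> (\<integral>x. indicator ?A x * ln (2 * h) + f x \<partial>M)"
    proof (intro integral_mono)
      fix x assume x: "x \<in> space M"
      show "ln (?f1 x) \<le> indicator ?A x * ln (2 * h) + f x"
      proof (cases "f x \<le> h")
        case True
        then have "ln (?f1 x) \<le> ln (2 * h)" using f1(3)[of x] f1(4)[of x] by (intro ln_mono) auto
        then show ?thesis using True x f(1)[of x] by (simp add: indicator_def)
      next
        case False
        have "ln (?f1 x) \<le> ?f1 x - 1" using f1(3) by (rule ln_le_minus_one)
        then have "ln (?f1 x) \<le> f x" using f1(4)[of x] h by linarith
        then show ?thesis using False by (simp add: indicator_def)
      qed
    qed (use i2 fi in \<open>auto intro!: integrable_real_indicator integrable_mult_left simp: emeasure_eq_measure\<close>)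
    also have "\<dots> = prob ?A * ln (2 * h) + 1"
      using fi f(3) by (subst Bochner_Integration.integral_add) (auto simp: emeasure_eq_measure intro!: integrable_mult_left integrable_real_indicator)
    also have "\<dots> \<le> 1 / 2 * ln (2 * h) + 1"
      using small h by (intro add_right_mono mult_right_mono_neg) auto
    finally show "(\<integral>x. ln (?f1 x) \<partial>M) \<le> ln (2 * h) / 2 + 1" by simp
    have "(\<integral>x. - 1 \<partial>M) \<le> (\<integral>x. f x * ln (?f1 x) \<partial>M)"
    proof (intro integral_mono)
      fix x
      have "1 - 1 / (1 - h) \<le> ln (1 - h)"
        using ln_le_minus_one[of "1 / (1 - h)"] h by (simp add: ln_div)
      moreover have "1 / (1 - h) \<le> 2" using h by (simp add: field_simps)
      ultimately have "- 1 \<le> ln (1 - h)" by linarith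
      then have "f x * (- 1) \<le> f x * ln (1 - h)" using f(1)[of x] by (intro mult_left_mono) auto
      then have "- 1 \<le> f x * ln (1 - h) + f x * ln (f x)" using x_ln_x_ge[of "f x"] f(1)[of x] by linarith
      also have "\<dots> = f x * ln ((1 - h) * f x)" using f(1)[of x] h by (simp add: ln_mult distrib_left)
      also have "\<dots> \<le> f x * ln (?f1 x)" using f(1)[of x] h by (intro mult_left_mono ln_mono) auto
      finally show "- 1 \<le> f x * ln (?f1 x)" .
    qed (use i1 in auto)
    then show "- 1 \<le> (\<integral>x. f x * ln (?f1 x) \<partial>M)" by (simp add: prob_space)
  qed (use h in simp)
  also have "\<dots> = - (h * (ln (1 / (2 * h)) / 2 - 2))" using h by (simp add: ln_div algebra_simps)
  finally show ?thesis by simp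
qed

text \<open>
  The median \<open>c\<close> is the infimum of the points where the distribution function is at least \<open>1
  / 2\<close>. Its right continuity gives the first bound, its left limit at \<open>c\<close> the second.
\<close>

lemma median_exists:
  fixes f :: "'a \<Rightarrow> real"
  assumes f[measurable]: "f \<in> borel_measurable M"
  obtains c where "1 / 2 \<le> prob {x \<in> space M. f x \<le> c}" "1 / 2 \<le> prob {x \<in> space M. c \<le> f x}"
proof -
  interpret D: real_distribution "distr M borel f" by (rule real_distribution_distr) simp
  define S where "S = {a. 1 / 2 \<le> cdf (distr M borel f) a}"
  have cdf_f: "cdf (distr M borel f) a = prob {x \<in> space M. f x \<le> a}" for a
    by (auto simp: cdf_def measure_distr intro!: arg_cong[where f=prob])
  have "\<forall>\<^sub>F a in at_top. 1 / 2 < cdf (distr M borel f) a"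
    using D.cdf_lim_at_top_prob by (rule order_tendstoD) simp
  then have ne: "S \<noteq> {}" unfolding S_def eventually_at_top_linorder by (auto intro: less_imp_le)
  have "\<forall>\<^sub>F a in at_bot. cdf (distr M borel f) a < 1 / 2"
    using D.cdf_lim_at_bot by (rule order_tendstoD) simp
  then obtain l where l: "\<And>a. a \<le> l \<Longrightarrow> cdf (distr M borel f) a < 1 / 2" by (auto simp: eventually_at_bot_linorder)
  have bd: "bdd_below S"
  proof (rule bdd_belowI)
    fix a assume "a \<in> S" then show "l \<le> a" using l[of a] by (force simp: S_def)
  qed
  define c where "c = Inf S"
  have up: "1 / 2 \<le> cdf (distr M borel f) a" if "c < a" for a
  proof -
    have "\<exists>b\<in>S. b < a" using that unfolding c_def by (rule cInf_less_iff[OF ne bd, THEN iffD1])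
    then obtain b where "b \<in> S" "b < a" by blast
    then show ?thesis using D.cdf_nondecreasing[of b a] by (simp add: S_def)
  qed
  have "((cdf (distr M borel f)) \<longlongrightarrow> cdf (distr M borel f) c) (at_right c)"
    using D.cdf_is_right_cont[of c] by (simp add: continuous_within)
  moreover have "\<forall>\<^sub>F a in at_right c. 1 / 2 \<le> cdf (distr M borel f) a"
    using up by (auto simp: eventually_at_right_field intro!: exI[of _ "c + 1"])
  ultimately have "1 / 2 \<le> cdf (distr M borel f) c" by (rule tendsto_lowerbound) simp
  moreover have "1 / 2 \<le> prob {x \<in> space M. c \<le> f x}"
  proof -
    have low: "cdf (distr M borel f) a \<le> 1 / 2" if "a < c" for a
    proof (rule ccontr)
      assume "\<not> ?thesis"
      then have "a \<in> S" by (simp add: S_def)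
      then show False using that cInf_lower[OF _ bd, of a] by (simp add: c_def)
    qed
    have "\<forall>\<^sub>F a in at_left c. cdf (distr M borel f) a \<le> 1 / 2"
      using low by (auto simp: eventually_at_left_field intro!: exI[of _ "c - 1"])
    with D.cdf_at_left[of c] have "measure (distr M borel f) {..<c} \<le> 1 / 2"
      by (rule tendsto_upperbound) simp
    moreover have "measure (distr M borel f) {..<c} = prob {x \<in> space M. f x < c}"
      by (auto simp: measure_distr intro!: arg_cong[where f=prob])
    moreover have "{x \<in> space M. c \<le> f x} = space M - {x \<in> space M. f x < c}" by auto
    then have "prob {x \<in> space M. c \<le> f x} = 1 - prob {x \<in> space M. f x < c}"
      by (simp add: prob_compl)
    ultimately show ?thesis by linarith
  qed
  ultimately show thesis using that cdf_f by simp
qed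

end

text \<open>
  The integrand \<open>x\<^sup>2 ln x\<^sup>2\<close> of the entropy is corrected by \<open>x\<^sup>2 -
  1\<close>, which integrates to \<open>0\<close> for a normalised function. The result is nonnegative, which
  Fatou's lemma needs, and vanishes to second order at \<open>x = 1\<close>, which a tight inequality needs.
\<close>

definition square_entropy :: "real \<Rightarrow> real" where
  "square_entropy x = x\<^sup>2 * ln (x\<^sup>2) - x\<^sup>2 + 1"

lemma square_entropy_nonneg: "0 \<le> square_entropy x"
  using x_ln_x_ge[of "x\<^sup>2"] by (simp add: square_entropy_def)

lemma square_entropy_abs: "square_entropy \<bar>x\<bar> = square_entropy x"
  by (simp add: square_entropy_def)

text \<open>
  Near \<open>1\<close> this is the second order vanishing, and for large \<open>x\<close> both sides grow like
  \<open>x\<^sup>2 ln x\<^sup>2\<close>. The constant is \<open>(x + 1)\<^sup>2\<close> at the point \<open>x =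
  3\<close> where the two regimes are separated.
\<close>

lemma square_entropy_le:
  assumes "0 \<le> x"
  shows "square_entropy x \<le> 16 * ((x - 1)\<^sup>2 + (x - 1)\<^sup>2 * ln (1 + (x - 1)\<^sup>2))"
proof (cases "x \<le> 3")
  case True
  have "square_entropy x \<le> (x\<^sup>2 - 1)\<^sup>2"
  proof (cases "x = 0")
    case False
    then have "ln (x\<^sup>2) \<le> x\<^sup>2 - 1" by (intro ln_le_minus_one) simp
    then have "x\<^sup>2 * ln (x\<^sup>2) \<le> x\<^sup>2 * (x\<^sup>2 - 1)" by (rule mult_left_mono) simp
    then show ?thesis by (simp add: square_entropy_def power2_eq_square algebra_simps)
  qed (simp add: square_entropy_def)
  also have "\<dots> = (x - 1)\<^sup>2 * (x + 1)\<^sup>2" by (simp add: power2_eq_square algebra_simps)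
  also have "\<dots> \<le> (x - 1)\<^sup>2 * 4\<^sup>2" using True assms by (intro mult_left_mono power_mono) auto
  also have "\<dots> \<le> 16 * ((x - 1)\<^sup>2 + (x - 1)\<^sup>2 * ln (1 + (x - 1)\<^sup>2))" by simp
  finally show ?thesis .
next
  case False
  define w where "w = x - 1"
  have w: "2 < w" using False by (simp add: w_def)
  have x: "x = w + 1" by (simp add: w_def)
  have "x\<^sup>2 \<le> (3 / 2 * w)\<^sup>2" using w by (intro power_mono) (auto simp: x)
  then have x2: "x\<^sup>2 \<le> 9 / 4 * w\<^sup>2" by (simp add: power2_eq_square)
  have x1: "1 \<le> x\<^sup>2" using False by simp
  have "ln (x\<^sup>2) \<le> ln (9 / 4 * (1 + w\<^sup>2))" using x2 x1 by (intro ln_mono) auto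
  also have "\<dots> = ln (9 / 4) + ln (1 + w\<^sup>2)" by (rule ln_mult_pos) (auto intro: add_pos_nonneg)
  also have "ln (9 / 4) \<le> (9 / 4 - 1 :: real)" by (rule ln_le_minus_one) simp
  finally have ln: "ln (x\<^sup>2) \<le> 2 + ln (1 + w\<^sup>2)" by simp
  have lw: "0 \<le> ln (1 + w\<^sup>2)" by simp
  have "square_entropy x \<le> x\<^sup>2 * ln (x\<^sup>2)" using x1 by (simp add: square_entropy_def)
  also have "\<dots> \<le> 9 / 4 * w\<^sup>2 * (2 + ln (1 + w\<^sup>2))" using x1 x2 ln by (intro mult_mono) auto
  also have "\<dots> = 9 / 2 * w\<^sup>2 + 9 / 4 * (w\<^sup>2 * ln (1 + w\<^sup>2))" by (simp add: algebra_simps)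
  also have "\<dots> \<le> 16 * w\<^sup>2 + 16 * (w\<^sup>2 * ln (1 + w\<^sup>2))"
    using lw by (intro add_mono mult_right_mono mult_nonneg_nonneg) auto
  finally show ?thesis by (simp add: w_def)
qed

lemma x_ln_one_plus_8x_le:
  fixes x :: real
  assumes "0 < x"
  shows "x * ln (1 + 8 * x) \<le> x * ln x + 7 * x + 1"
proof -
  have "1 + 8 * x = x * (8 + 1 / x)" using assms by (simp add: distrib_left)
  then have "ln (1 + 8 * x) = ln (x * (8 + 1 / x))" by (simp only:)
  also have "\<dots> = ln x + ln (8 + 1 / x)" using assms by (intro ln_mult_pos) (auto intro: add_pos_pos)
  also have "ln (8 + 1 / x) \<le> (8 + 1 / x) - 1" using assms by (intro ln_le_minus_one) (auto intro: add_pos_pos)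
  finally have "x * ln (1 + 8 * x) \<le> x * (ln x + (7 + 1 / x))" using assms by (intro mult_left_mono) auto
  then show ?thesis using assms by (simp add: algebra_simps)
qed

context gaussian_CD_space
begin

text \<open>
  Take \<open>h = 1\<close>, that is, compare \<open>g\<^sup>2 / Z\<close> with the reference measure, whose
  entropy is \<open>0\<close>. On the right the entropy appears with the factor \<open>(1 / s + K / 2) (1 +
  \<theta>) / (K / 2 + \<epsilon>)\<close>. Since \<open>K / 2 < K / 2 + \<epsilon>\<close>, this is less than
  \<open>1\<close> if \<open>s\<close> is large and \<open>\<theta>\<close> is small, and the term can be
  absorbed on the left.
\<close>

lemma defective_log_sobolev:
  obtains A B where "0 \<le> A" "0 \<le> B" "\<And>g G \<delta>. slope_majorant g G \<Longrightarrow> 0 < \<delta> \<Longrightarrow> (\<And>x. \<delta> \<le> g x) \<Longrightarrow>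
    entropy_integral M (square_density M g) \<le> A * ((\<integral>x. (G x)\<^sup>2 \<partial>M) / (\<integral>x. (g x)\<^sup>2 \<partial>M)) + B"
proof -
  \<comment> \<open>The choices are 1 / s = \<open>\<epsilon>\<close> / 2, hence a = 1 / s + K / 2, and a (1 + \<open>\<theta>\<close>) = K / 2 + 3 \<open>\<epsilon>\<close> / 4.\<close>
  define a where "a = K / 2 + \<epsilon> / 2"
  define \<theta> where "\<theta> = (\<epsilon> / 4) / a"
  define q where "q = (K / 2 + 3 / 4 * \<epsilon>) / (K / 2 + \<epsilon>)"
  define c where "c = q * gaussian_moment + a * ((1 + 1 / \<theta>) * second_moment)"
  have a: "0 < a" using K \<epsilon> by (simp add: a_def)
  have \<theta>: "0 < \<theta>" using a \<epsilon> by (simp add: \<theta>_def)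
  have q: "0 < q" "q < 1" using K \<epsilon> by (auto simp: q_def field_simps intro!: divide_pos_pos)
  have aq: "a * ((1 + \<theta>) * (u / (K / 2 + \<epsilon>))) = q * u" for u
  proof -
    have "a * (1 + \<theta>) = K / 2 + 3 / 4 * \<epsilon>" using a by (simp add: \<theta>_def distrib_left) (simp add: a_def)
    then show ?thesis by (simp add: q_def mult.assoc[symmetric])
  qed
  have c: "0 \<le> c" unfolding c_def using q a \<theta> gaussian_moment_nonneg second_moment_nonneg by (intro add_nonneg_nonneg mult_nonneg_nonneg) auto
  show thesis
  proof (rule that)
    show "0 \<le> (2 / \<epsilon>) / (1 - q)" "0 \<le> c / (1 - q)" using q \<epsilon> c by auto
    fix g G :: "'a \<Rightarrow> real" and \<delta> :: real assume g: "slope_majorant g G" "0 < \<delta>" "\<And>x. \<delta> \<le> g x"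
    let ?E = "entropy_integral M (square_density M g)" and ?J = "(\<integral>x. (G x)\<^sup>2 \<partial>M) / (\<integral>x. (g x)\<^sup>2 \<partial>M)"
    have "?E - entropy_integral M (\<lambda>x. (1 - 1) * square_density M g x + 1) \<le> 2 / \<epsilon> * ?J +
      (1 / (2 / \<epsilon>) + K / 2) * (1 * ((1 + \<theta>) * ((?E + gaussian_moment) / (K / 2 + \<epsilon>)) + (1 + 1 / \<theta>) * second_moment))"
      by (rule entropy_drop_towards_reference[OF g]) (use \<epsilon> \<theta> in auto)
    then have "?E \<le> 2 / \<epsilon> * ?J + a * ((1 + \<theta>) * ((?E + gaussian_moment) / (K / 2 + \<epsilon>)) + (1 + 1 / \<theta>) * second_moment)"
      by (simp add: entropy_integral_def a_def add.commute)
    also have "\<dots> = 2 / \<epsilon> * ?J + (q * (?E + gaussian_moment) + a * ((1 + 1 / \<theta>) * second_moment))"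
      by (simp only: distrib_left[of a] aq)
    finally have "(1 - q) * ?E \<le> 2 / \<epsilon> * ?J + c" by (simp add: c_def algebra_simps)
    then have "?E \<le> (2 / \<epsilon> * ?J + c) / (1 - q)" using q by (simp add: pos_le_divide_eq mult.commute)
    moreover have "(u * j + c) / d = u / d * j + c / d" for u j d :: real by (simp add: add_divide_distrib)
    ultimately show "?E \<le> (2 / \<epsilon>) / (1 - q) * ?J + c / (1 - q)" by (simp only:)
  qed
qed

text \<open>
  A Poincare inequality for functions vanishing on half of the space, by transport to the reference measure. Put
  \<open>g = u + \<delta>\<close> with \<open>\<delta>\<^sup>2\<close> a small multiple \<open>h'\<close> of
  \<open>\<integral> u\<^sup>2\<close>, so that the density \<open>g\<^sup>2 / Z\<close> equals \<open>h =
  \<delta>\<^sup>2 / Z\<close> where \<open>u\<close> vanishes. Mixing in a fraction \<open>h\<close> of the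
  reference measure gains entropy of order \<open>h ln (1 / h)\<close> but the squared distance costs only
  \<open>\<kappa> h\<close> in the HWI inequality, where \<open>\<kappa>\<close> is a fixed constant because the
  defective inequality bounds the entropy when the energy is at most \<open>1\<close>. For \<open>h\<close>
  below the threshold \<open>h'\<close> the HWI inequality forces the energy to make up the difference.
\<close>

lemma poincare_vanishing_on_half:
  obtains C where "0 < C" "\<And>u G. \<lbrakk>slope_majorant u G; \<And>x. 0 \<le> u x; 1 / 2 \<le> prob {x \<in> space M. u x = 0}\<rbrakk> \<Longrightarrow>
    (\<integral>x. (u x)\<^sup>2 \<partial>M) \<le> C * (\<integral>x. (G x)\<^sup>2 \<partial>M)"
proof -
  obtain A B where A: "0 \<le> A" and B: "0 \<le> B" and defective: "\<And>g G \<delta>. slope_majorant g G \<Longrightarrow> 0 < \<delta> \<Longrightarrow> (\<And>x. \<delta> \<le> g x) \<Longrightarrow>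
    entropy_integral M (square_density M g) \<le> A * ((\<integral>x. (G x)\<^sup>2 \<partial>M) / (\<integral>x. (g x)\<^sup>2 \<partial>M)) + B"
    using defective_log_sobolev by metis
  define D where "D = 2 * ((A + B + gaussian_moment) / (K / 2 + \<epsilon>)) + 2 * second_moment"
  define \<kappa> where "\<kappa> = (1 + K / 2) * D"
  define h' where "h' = exp (- (2 * \<kappa> + 8)) / 2"
  have D0: "0 \<le> D" using A B gaussian_moment_nonneg second_moment_nonneg rate_pos by (auto simp: D_def)
  then have \<kappa>0: "0 \<le> \<kappa>" using K by (simp add: \<kappa>_def)
  have h': "0 < h'" "h' \<le> 1 / 2" using \<kappa>0 by (auto simp: h'_def)
  have "(\<integral>x. (u x)\<^sup>2 \<partial>M) \<le> 1 / h' * (\<integral>x. (G x)\<^sup>2 \<partial>M)"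
    if u: "slope_majorant u G" and u0: "\<And>x. 0 \<le> u x" and half: "1 / 2 \<le> prob {x \<in> space M. u x = 0}" for u G
  proof -
    let ?N = "\<integral>x. (u x)\<^sup>2 \<partial>M" and ?I = "\<integral>x. (G x)\<^sup>2 \<partial>M"
    have I0: "0 \<le> ?I" by simp
    show ?thesis
    proof (cases "?N = 0")
      case True
      have "0 \<le> 1 / h' * ?I" using h' I0 by (intro mult_nonneg_nonneg) auto
      then show ?thesis using True by simp
    next
      case False
      moreover have "0 \<le> ?N" by simp
      ultimately have N: "0 < ?N" by linarith
      define \<delta> where "\<delta> = sqrt (h' * ?N)"
      have \<delta>: "0 < \<delta>" and \<delta>2: "\<delta>\<^sup>2 = h' * ?N" using N h' by (auto simp: \<delta>_def)
      define g where "g x = u x + \<delta>" for x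
      have g: "slope_majorant g G"
        using slope_majorant_contraction[OF u, of "\<lambda>a. a + \<delta>"] by (simp add: g_def[abs_def])
      have g\<delta>: "\<delta> \<le> g x" for x using u0 by (simp add: g_def)
      have bl: "bounded_lipschitz g" "bounded_lipschitz u" using g u by (auto simp: slope_majorant_def)
      note f = square_density_props[OF bl(1) \<delta> g\<delta>]
      let ?Z = "\<integral>x. (g x)\<^sup>2 \<partial>M" and ?f = "square_density M g"
      let ?J = "?I / ?Z"
      have um[measurable]: "u \<in> borel_measurable M"
        using bl(2) by (intro borel_imp_measurable bounded_lipschitz_borel_measurable)
      have NZ: "?N \<le> ?Z"
      proof (rule integral_mono')
        show "integrable M (\<lambda>x. (g x)\<^sup>2)" by (rule f)
        show "(u x)\<^sup>2 \<le> (g x)\<^sup>2" for x using u0[of x] \<delta> by (intro power_mono) (auto simp: g_def)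
      qed simp
      \<comment> \<open>If the energy exceeds 1, there is nothing to do, as Z is at least the integral of u^2.\<close>
      have "h' * ?N \<le> ?I"
      proof (cases "?J \<le> 1")
        case False
        then have "?Z < ?I" using f(2) by (simp add: field_simps)
        moreover have "h' * ?N \<le> 1 * ?N" using h' N by (intro mult_right_mono) auto
        ultimately show ?thesis using NZ by linarith
      next
        case True
        let ?E = "entropy_integral M ?f"
        have "A * ?J \<le> A * 1" using True A by (rule mult_left_mono)
        then have E: "?E \<le> A + B" using defective[OF g \<delta> g\<delta>] by linarith
        define h where "h = \<delta>\<^sup>2 / ?Z"
        have h0: "0 < h" using \<delta> f(2) by (simp add: h_def)
        have hh': "h \<le> h'"
        proof -
          have "h' * ?N \<le> h' * ?Z" using NZ h' by (intro mult_left_mono) auto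
          then show ?thesis using f(2) by (simp add: h_def \<delta>2 pos_divide_le_eq)
        qed
        have h12: "h \<le> 1 / 2" using hh' h' by simp
        obtain Bf where Bf: "\<And>x. ?f x \<le> Bf" using f(6) by auto
        have "{x \<in> space M. u x = 0} \<subseteq> {x \<in> space M. ?f x \<le> h}"
          by (auto simp: square_density_def g_def h_def)
        then have "prob {x \<in> space M. u x = 0} \<le> prob {x \<in> space M. ?f x \<le> h}"
          using f(1) by (intro finite_measure_mono) auto
        then have small: "1 / 2 \<le> prob {x \<in> space M. ?f x \<le> h}" using half by linarith
        have "h * (\<kappa> + 2) \<le> h * (ln (1 / (2 * h)) / 2 - 2)"
        proof (intro mult_left_mono)
          have "2 * h \<le> exp (- (2 * \<kappa> + 8))" using hh' by (simp add: h'_def)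
          then have "ln (2 * h) \<le> ln (exp (- (2 * \<kappa> + 8)))" using h0 by (intro ln_mono) auto
          then have "2 * \<kappa> + 8 \<le> ln (1 / (2 * h))" using h0 by (simp add: ln_div)
          then show "\<kappa> + 2 \<le> ln (1 / (2 * h)) / 2 - 2" by simp
        qed (use h0 in simp)
        also have "\<dots> \<le> ?E - entropy_integral M (\<lambda>x. (1 - h) * ?f x + h)"
          by (rule entropy_drop_on_small_set[OF f(1) f(5) Bf f(4) h0 h12 small])
        also have "\<dots> \<le> 1 * ?J + (1 / 1 + K / 2) * (h * ((1 + 1) * ((?E + gaussian_moment) / (K / 2 + \<epsilon>)) + (1 + 1 / 1) * second_moment))"
          by (rule entropy_drop_towards_reference[OF g \<delta> g\<delta>]) (use h0 h12 in auto)
        also have "\<dots> \<le> 1 * ?J + (1 / 1 + K / 2) * (h * ((1 + 1) * ((A + B + gaussian_moment) / (K / 2 + \<epsilon>)) + (1 + 1 / 1) * second_moment))"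
          using E K h0 rate_pos by (intro add_left_mono add_right_mono mult_left_mono divide_right_mono) auto
        also have "\<dots> = ?J + h * \<kappa>" by (simp add: \<kappa>_def D_def)
        finally have "2 * h \<le> ?J" by (simp add: algebra_simps)
        then have "h \<le> ?J" using h0 by linarith
        then have "\<delta>\<^sup>2 \<le> ?I" using f(2) by (simp add: h_def divide_le_cancel)
        then show ?thesis by (simp add: \<delta>2)
      qed
      then show ?thesis using h' by (simp add: pos_le_divide_eq mult.commute)
    qed
  qed
  moreover have "0 < 1 / h'" using h' by simp
  ultimately show thesis using that by blast
qed

text \<open>
  Apply the previous inequality to the two parts of \<open>f\<close> above and below a median \<open>c\<close>.
  This bounds \<open>\<integral> (f - c)\<^sup>2\<close>, hence the variance \<open>1 - m\<^sup>2\<close> with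
  \<open>m = \<integral> f\<close>, and \<open>\<integral> (f - 1)\<^sup>2 = 2 (1 - m) \<le> 2 (1 -
  m\<^sup>2)\<close> since \<open>0 \<le> m \<le> 1\<close>.
\<close>

lemma distance_to_one_le:
  obtains C where "0 < C" "\<And>f G. \<lbrakk>slope_majorant f G; \<And>x. 0 \<le> f x; (\<integral>x. (f x)\<^sup>2 \<partial>M) = 1\<rbrakk> \<Longrightarrow>
    (\<integral>x. (f x - 1)\<^sup>2 \<partial>M) \<le> 2 \<and> (\<integral>x. (f x - 1)\<^sup>2 \<partial>M) \<le> C * (\<integral>x. (G x)\<^sup>2 \<partial>M)"
proof -
  obtain C where C: "0 < C" and P: "\<And>u G. \<lbrakk>slope_majorant u G; \<And>x. 0 \<le> u x; 1 / 2 \<le> prob {x \<in> space M. u x = 0}\<rbrakk> \<Longrightarrow>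
    (\<integral>x. (u x)\<^sup>2 \<partial>M) \<le> C * (\<integral>x. (G x)\<^sup>2 \<partial>M)"
    using poincare_vanishing_on_half by blast
  have "(\<integral>x. (f x - 1)\<^sup>2 \<partial>M) \<le> 2 \<and> (\<integral>x. (f x - 1)\<^sup>2 \<partial>M) \<le> 4 * C * (\<integral>x. (G x)\<^sup>2 \<partial>M)"
    if f: "slope_majorant f G" and f0: "\<And>x. 0 \<le> f x" and f1: "(\<integral>x. (f x)\<^sup>2 \<partial>M) = 1" for f G
  proof -
    have bl: "bounded_lipschitz f" using f by (simp add: slope_majorant_def)
    have fm[measurable]: "f \<in> borel_measurable M"
      using bl by (intro borel_imp_measurable bounded_lipschitz_borel_measurable)
    obtain B where B: "\<And>x. \<bar>f x\<bar> \<le> B"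
      using bounded_range_realE[of f] bl unfolding bounded_lipschitz_def by metis
    have i: "integrable M f" by (rule integrable_bounded_real[OF fm B])
    have bsq: "integrable M (\<lambda>x. (v x)\<^sup>2)" if [measurable]: "v \<in> borel_measurable M" and "\<And>x. \<bar>v x\<bar> \<le> b" for v :: "'a \<Rightarrow> real" and b
    proof (rule integrable_bounded_real)
      show "\<bar>(v x)\<^sup>2\<bar> \<le> b\<^sup>2" for x using power_mono[OF that(2)[of x], of 2] by simp
    qed measurable
    have i2: "integrable M (\<lambda>x. (f x)\<^sup>2)" using bsq[OF fm B] .
    obtain c where c: "1 / 2 \<le> prob {x \<in> space M. f x \<le> c}" "1 / 2 \<le> prob {x \<in> space M. c \<le> f x}"
      using median_exists[OF fm] by metis
    define m where "m = (\<integral>x. f x \<partial>M)"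
    have sq: "(\<integral>x. (f x - a)\<^sup>2 \<partial>M) = 1 - 2 * a * m + a\<^sup>2" for a
    proof -
      have "(\<integral>x. (f x - a)\<^sup>2 \<partial>M) = (\<integral>x. (f x)\<^sup>2 - 2 * a * f x + a\<^sup>2 \<partial>M)"
        by (simp add: power2_eq_square algebra_simps)
      also have "\<dots> = 1 - 2 * a * m + a\<^sup>2" using i i2 f1 by (simp add: m_def prob_space)
      finally show ?thesis .
    qed
    have m0: "0 \<le> m" unfolding m_def using f0 by (simp add: integral_nonneg_AE)
    have "0 \<le> (\<integral>x. (f x - m)\<^sup>2 \<partial>M)" by simp
    then have "m * m \<le> 1" unfolding sq by (simp add: power2_eq_square)
    then have m1: "m \<le> 1" using m0 by (metis abs_le_square_iff abs_of_nonneg abs_one mult_1 power2_eq_square)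
    let ?I = "\<integral>x. (G x)\<^sup>2 \<partial>M"
    let ?u = "\<lambda>x. max (f x - c) 0" and ?v = "\<lambda>x. max (c - f x) 0"
    have "(\<integral>x. (?u x)\<^sup>2 \<partial>M) \<le> C * ?I"
    proof (rule P)
      show "slope_majorant ?u G" by (rule slope_majorant_contraction[OF f]) auto
      have "{x \<in> space M. f x \<le> c} = {x \<in> space M. ?u x = 0}" by (auto simp: max_def)
      then show "1 / 2 \<le> prob {x \<in> space M. ?u x = 0}" using c by simp
    qed auto
    moreover have "(\<integral>x. (?v x)\<^sup>2 \<partial>M) \<le> C * ?I"
    proof (rule P)
      show "slope_majorant ?v G" by (rule slope_majorant_contraction[OF f]) auto
      have "{x \<in> space M. c \<le> f x} = {x \<in> space M. ?v x = 0}" by (auto simp: max_def)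
      then show "1 / 2 \<le> prob {x \<in> space M. ?v x = 0}" using c by simp
    qed auto
    moreover have "(\<integral>x. (f x - c)\<^sup>2 \<partial>M) = (\<integral>x. (?u x)\<^sup>2 \<partial>M) + (\<integral>x. (?v x)\<^sup>2 \<partial>M)"
    proof -
      have b: "\<bar>?u x\<bar> \<le> B + \<bar>c\<bar>" "\<bar>?v x\<bar> \<le> B + \<bar>c\<bar>" for x using B[of x] by auto
      have "(f x - c)\<^sup>2 = (?u x)\<^sup>2 + (?v x)\<^sup>2" for x by (auto simp: max_def power2_commute)
      then show ?thesis using bsq[OF _ b(1)] bsq[OF _ b(2)] by simp
    qed
    ultimately have "1 - 2 * c * m + c\<^sup>2 \<le> 2 * (C * ?I)" unfolding sq by linarith
    moreover have "1 - 2 * c * m + c\<^sup>2 = (1 - m\<^sup>2) + (c - m)\<^sup>2" by (simp add: power2_eq_square algebra_simps)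
    ultimately have var: "1 - m\<^sup>2 \<le> 2 * (C * ?I)" using zero_le_power2[of "c - m"] by linarith
    have "(1 - m) * 1 \<le> (1 - m) * (1 + m)" using m0 m1 by (intro mult_left_mono) auto
    then have "1 - m \<le> 1 - m\<^sup>2" by (simp add: power2_eq_square algebra_simps)
    then have "2 - 2 * m \<le> 4 * C * ?I" using var by linarith
    moreover have "(\<integral>x. (f x - 1)\<^sup>2 \<partial>M) = 2 - 2 * m" using sq[of 1] by simp
    ultimately show ?thesis using m0 by simp
  qed
  moreover have "0 < 4 * C" using C by simp
  ultimately show thesis using that by blast
qed

text \<open>
  The additive constant of the defective inequality is removed by applying it not to \<open>f\<close> but to the
  deviation \<open>w = | |f| - 1 |\<close>: there the constant is multiplied by \<open>\<integral>
  w\<^sup>2\<close>, which the Poincare inequality bounds by the energy. As the defective inequality needs a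
  positive lower bound, \<open>w\<close> is shifted by \<open>\<delta>\<close> with \<open>\<delta>\<^sup>2 =
  \<integral> w\<^sup>2\<close>, which keeps \<open>Z\<close> comparable to \<open>\<integral>
  w\<^sup>2\<close>.
\<close>

lemma tight_log_sobolev_slope_majorant:
  obtains C where "0 < C" "\<And>f G. \<lbrakk>slope_majorant f G; (\<integral>x. (f x)\<^sup>2 \<partial>M) = 1\<rbrakk> \<Longrightarrow>
    integrable M (\<lambda>x. square_entropy (f x)) \<and> (\<integral>x. square_entropy (f x) \<partial>M) \<le> C * (\<integral>x. (G x)\<^sup>2 \<partial>M)"
proof -
  obtain A B where A: "0 \<le> A" and B: "0 \<le> B" and defective: "\<And>g G \<delta>. slope_majorant g G \<Longrightarrow> 0 < \<delta> \<Longrightarrow> (\<And>x. \<delta> \<le> g x) \<Longrightarrow>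
    entropy_integral M (square_density M g) \<le> A * ((\<integral>x. (G x)\<^sup>2 \<partial>M) / (\<integral>x. (g x)\<^sup>2 \<partial>M)) + B"
    using defective_log_sobolev by metis
  obtain C where C: "0 < C" and dist1: "\<And>f G. \<lbrakk>slope_majorant f G; \<And>x. 0 \<le> f x; (\<integral>x. (f x)\<^sup>2 \<partial>M) = 1\<rbrakk> \<Longrightarrow>
    (\<integral>x. (f x - 1)\<^sup>2 \<partial>M) \<le> 2 \<and> (\<integral>x. (f x - 1)\<^sup>2 \<partial>M) \<le> C * (\<integral>x. (G x)\<^sup>2 \<partial>M)"
    using distance_to_one_le by metis
  define C' where "C' = 16 * (C + A + 4 * (B + 8) * C)"
  have "integrable M (\<lambda>x. square_entropy (f x)) \<and> (\<integral>x. square_entropy (f x) \<partial>M) \<le> C' * (\<integral>x. (G x)\<^sup>2 \<partial>M)"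
    if f': "slope_majorant f G" and f1': "(\<integral>x. (f x)\<^sup>2 \<partial>M) = 1" for f G
  proof -
    define w where "w x = \<bar>\<bar>f x\<bar> - 1\<bar>" for x
    have w: "slope_majorant w G"
      unfolding w_def by (rule slope_majorant_contraction[OF f']) auto
    have w0: "0 \<le> w x" for x by (simp add: w_def)
    let ?N = "\<integral>x. (w x)\<^sup>2 \<partial>M" and ?I = "\<integral>x. (G x)\<^sup>2 \<partial>M"
    have I0: "0 \<le> ?I" by simp
    have "slope_majorant (\<lambda>x. \<bar>f x\<bar>) G" by (rule slope_majorant_contraction[OF f']) auto
    from dist1[OF this] f1' have N: "?N \<le> 2" "?N \<le> C * ?I" by (auto simp: w_def)
    have bl: "bounded_lipschitz w" "bounded_lipschitz f" using w f' by (auto simp: slope_majorant_def)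
    have [measurable]: "w \<in> borel_measurable M" "f \<in> borel_measurable M"
      using bl by (auto intro: borel_imp_measurable bounded_lipschitz_borel_measurable)
    obtain b where b: "\<And>x. \<bar>w x\<bar> \<le> b"
      using bounded_range_realE[of w] bl(1) unfolding bounded_lipschitz_def by metis
    have b2: "(w x)\<^sup>2 \<le> b\<^sup>2" for x using power_mono[OF b[of x], of 2] by simp
    have wi: "integrable M (\<lambda>x. (w x)\<^sup>2)" by (rule integrable_bounded_real[of _ "b\<^sup>2"]) (use b2 in auto)
    let ?L = "\<lambda>x. (w x)\<^sup>2 * ln (1 + (w x)\<^sup>2)"
    have ln0: "0 \<le> ln (1 + (w x)\<^sup>2)" for x by simp
    have Li: "integrable M ?L"
    proof (rule integrable_bounded_real)
      fix x
      have "ln (1 + (w x)\<^sup>2) \<le> b\<^sup>2" using ln_add_one_self_le_self[of "(w x)\<^sup>2"] b2[of x] by simp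
      then show "\<bar>?L x\<bar> \<le> b\<^sup>2 * b\<^sup>2" using ln0[of x] b2[of x] unfolding abs_mult by (intro mult_mono) auto
    qed measurable
    have \<Psi>w: "square_entropy (f x) \<le> 16 * ((w x)\<^sup>2 + ?L x)" for x
      using square_entropy_le[of "\<bar>f x\<bar>"] by (simp add: square_entropy_abs w_def)
    have \<Psi>i: "integrable M (\<lambda>x. square_entropy (f x))"
    proof (rule Bochner_Integration.integrable_bound)
      show "integrable M (\<lambda>x. 16 * ((w x)\<^sup>2 + ?L x))" using wi Li by simp
      show "(\<lambda>x. square_entropy (f x)) \<in> borel_measurable M" unfolding square_entropy_def by measurable
      show "AE x in M. norm (square_entropy (f x)) \<le> norm (16 * ((w x)\<^sup>2 + ?L x))"
        using \<Psi>w square_entropy_nonneg order_trans[OF square_entropy_nonneg \<Psi>w] by (auto simp: abs_of_nonneg)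
    qed
    have L: "(\<integral>x. ?L x \<partial>M) \<le> A * ?I + 4 * (B + 8) * ?N"
    proof (cases "?N = 0")
      case True
      then have "AE x in M. (w x)\<^sup>2 = 0" using integral_nonneg_eq_0_iff_AE[OF wi] by simp
      then have "(\<integral>x. ?L x \<partial>M) = (\<integral>x. 0 \<partial>M)" by (intro integral_cong_AE) auto
      then show ?thesis using A I0 True by simp
    next
      case False
      moreover have "0 \<le> ?N" by simp
      ultimately have N0: "0 < ?N" by linarith
      define \<delta> where "\<delta> = sqrt ?N"
      have \<delta>: "0 < \<delta>" and \<delta>2: "\<delta>\<^sup>2 = ?N" using N0 by (auto simp: \<delta>_def)
      define g where "g x = w x + \<delta>" for x
      have g: "slope_majorant g G"
        using slope_majorant_contraction[OF w, of "\<lambda>a. a + \<delta>"] by (simp add: g_def[abs_def])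
      have g\<delta>: "\<delta> \<le> g x" for x using w0 by (simp add: g_def)
      have blg: "bounded_lipschitz g" using g by (auto simp: slope_majorant_def)
      note sd = square_density_props[OF blg \<delta> g\<delta>]
      let ?Z = "\<integral>x. (g x)\<^sup>2 \<partial>M" and ?f = "square_density M g"
      have "?Z \<le> (\<integral>x. 2 * (w x)\<^sup>2 + 2 * \<delta>\<^sup>2 \<partial>M)"
      proof (rule integral_mono)
        fix x
        show "(g x)\<^sup>2 \<le> 2 * (w x)\<^sup>2 + 2 * \<delta>\<^sup>2"
          using zero_le_power2[of "w x - \<delta>"] by (simp add: g_def power2_eq_square algebra_simps)
      qed (use sd wi in auto)
      also have "\<dots> = 4 * ?N" using wi by (simp add: \<delta>2 prob_space)
      finally have Z4: "?Z \<le> 4 * ?N" .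
      then have Z8: "?Z \<le> 8" using N by simp
      obtain Bf where Bf: "\<And>x. ?f x \<le> Bf" using sd(6) by auto
      note df = density_bounded_in_Ent_domain[OF sd(1) less_imp_le[OF sd(5)] Bf sd(4) second_moment_finite]
      have "(\<integral>x. ?L x \<partial>M) \<le> (\<integral>x. ?Z * (?f x * ln (?f x) + 7 * ?f x + 1) \<partial>M)"
      proof (rule integral_mono)
        fix x
        have wg: "(w x)\<^sup>2 \<le> ?Z * ?f x"
          using w0[of x] \<delta> sd(2) by (auto simp: square_density_def g_def intro!: power_mono)
        also have "\<dots> \<le> 8 * ?f x" using Z8 sd(5)[of x] by (intro mult_right_mono) auto
        finally have "ln (1 + (w x)\<^sup>2) \<le> ln (1 + 8 * ?f x)" by (intro ln_mono) (auto intro: add_pos_nonneg)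
        then have "?L x \<le> (?Z * ?f x) * ln (1 + 8 * ?f x)"
          using wg ln0[of x] sd(2) sd(5)[of x] by (intro mult_mono) auto
        also have "\<dots> = ?Z * (?f x * ln (1 + 8 * ?f x))" by simp
        also have "\<dots> \<le> ?Z * (?f x * ln (?f x) + 7 * ?f x + 1)"
          using sd(2) sd(5)[of x] by (intro mult_left_mono x_ln_one_plus_8x_le) auto
        finally show "?L x \<le> ?Z * (?f x * ln (?f x) + 7 * ?f x + 1)" .
      qed (use Li df in auto)
      also have "\<dots> = ?Z * (entropy_integral M ?f + 8)"
        using df sd(4) by (simp add: entropy_integral_def prob_space)
      also have "\<dots> \<le> ?Z * ((A * (?I / ?Z) + B) + 8)"
        using defective[OF g \<delta> g\<delta>] sd(2) by (intro mult_left_mono add_right_mono) auto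
      also have "\<dots> = A * ?I + ?Z * (B + 8)" using sd(2) by (simp add: field_simps)
      also have "\<dots> \<le> A * ?I + (4 * ?N) * (B + 8)" using Z4 B by (intro add_left_mono mult_right_mono) auto
      finally show ?thesis by (simp add: algebra_simps)
    qed
    have "(\<integral>x. square_entropy (f x) \<partial>M) \<le> (\<integral>x. 16 * ((w x)\<^sup>2 + ?L x) \<partial>M)"
      using \<Psi>i \<Psi>w wi Li by (intro integral_mono) auto
    also have "\<dots> = 16 * (?N + (\<integral>x. ?L x \<partial>M))" using wi Li by simp
    also have "\<dots> \<le> 16 * (C * ?I + (A * ?I + 4 * (B + 8) * (C * ?I)))"
    proof (intro mult_left_mono add_mono N(2))
      have "4 * (B + 8) * ?N \<le> 4 * (B + 8) * (C * ?I)" using N(2) B by (intro mult_left_mono) auto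
      then show "(\<integral>x. ?L x \<partial>M) \<le> A * ?I + 4 * (B + 8) * (C * ?I)" using L by linarith
    qed simp
    also have "\<dots> = C' * ?I" by (simp add: C'_def algebra_simps)
    finally show ?thesis using \<Psi>i by simp
  qed
  moreover have "0 < C'" using A B C by (simp add: C'_def add_pos_nonneg)
  ultimately show thesis using that by blast
qed

end

section \<open>From slope majorants to the local Lipschitz constant\<close>

text \<open>
  For a bounded Lipschitz function these suprema are slope majorants, and they decrease to the local Lipschitz
  constant as \<open>r\<close> tends to \<open>0\<close>.
\<close>

definition slope_at_scale :: "real \<Rightarrow> ('a::metric_space \<Rightarrow> real) \<Rightarrow> 'a \<Rightarrow> ennreal" where
  "slope_at_scale r f x = (SUP y\<in>ball x r - {x}. ennreal (\<bar>f y - f x\<bar> / dist y x))"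

lemma slope_at_scale_le_lipschitz:
  assumes "L-lipschitz_on UNIV f"
  shows "slope_at_scale r f x \<le> ennreal L"
  unfolding slope_at_scale_def
proof (intro SUP_least ennreal_leI)
  fix y assume "y \<in> ball x r - {x}"
  then have "0 < dist y x" by auto
  moreover have "\<bar>f y - f x\<bar> \<le> L * dist y x"
    using assms by (auto simp: lipschitz_on_def dist_real_def)
  ultimately show "\<bar>f y - f x\<bar> / dist y x \<le> L" by (simp add: pos_divide_le_eq)
qed

text \<open>
  For each \<open>y\<close> the quotient is continuous on an open set of \<open>x\<close>, so the supremum is
  lower semicontinuous.
\<close>

lemma borel_measurable_slope_at_scale:
  fixes f :: "'a::metric_space \<Rightarrow> real"
  assumes f: "continuous_on UNIV f"
  shows "slope_at_scale r f \<in> borel_measurable borel"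
proof (rule borel_measurableI_greater)
  fix a
  let ?U = "\<lambda>y. {x. x \<noteq> y \<and> dist y x < r}" and ?q = "\<lambda>y x. ennreal (\<bar>f y - f x\<bar> / dist y x)"
  have "open (?U y \<inter> ?q y -` {a<..})" for y
  proof (rule continuous_open_preimage)
    have "continuous_on (?U y) f" using f by (rule continuous_on_subset) simp
    then show "continuous_on (?U y) (?q y)" by (intro continuous_on_ennreal continuous_intros) auto
    have "?U y = - {y} \<inter> ball y r" by auto
    then show "open (?U y)" by (simp add: open_Int open_Compl)
  qed simp
  then have "open (\<Union>y. ?U y \<inter> ?q y -` {a<..})" by blast
  also have "(\<Union>y. ?U y \<inter> ?q y -` {a<..}) = {x. a < slope_at_scale r f x}"
    by (auto simp: slope_at_scale_def less_SUP_iff dist_commute)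
  finally show "{x \<in> space borel. a < slope_at_scale r f x} \<in> sets borel" by simp
qed

lemma slope_at_scale_tendsto_local_lip:
  "(\<lambda>n. slope_at_scale (1 / real (Suc n)) f x) \<longlonglongrightarrow> local_lip f x"
proof -
  have mono: "slope_at_scale r f x \<le> slope_at_scale r' f x" if "r \<le> r'" for r r'
    unfolding slope_at_scale_def using that by (intro SUP_subset_mono) auto
  have "(INF n. slope_at_scale (1 / real (Suc n)) f x) = (INF r\<in>{0<..}. slope_at_scale r f x)"
  proof (rule INF_eq)
    fix r :: real assume "r \<in> {0<..}"
    then obtain n where "1 / real (Suc n) < r" using nat_approx_posE[of r] by auto
    then show "\<exists>n\<in>UNIV. slope_at_scale (1 / real (Suc n)) f x \<le> slope_at_scale r f x"
      using mono by (auto intro: less_imp_le)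
  qed (auto intro!: bexI)
  also have "\<dots> = local_lip f x" unfolding local_lip_def Limsup_at slope_at_scale_def ..
  finally show ?thesis
    using LIMSEQ_INF[of "\<lambda>n. slope_at_scale (1 / real (Suc n)) f x"] mono
    by (auto simp: decseq_def field_simps)
qed

lemma slope_majorant_slope_at_scale:
  assumes f: "bounded_lipschitz f" and r: "0 < r"
  shows "slope_majorant f (\<lambda>x. enn2real (slope_at_scale r f x))"
proof -
  obtain L where L: "L-lipschitz_on UNIV f" using f by (auto simp: bounded_lipschitz_def)
  have L0: "0 \<le> L" using L by (simp add: lipschitz_on_def)
  have bd: "slope_at_scale r f x \<le> ennreal L" for x by (rule slope_at_scale_le_lipschitz[OF L])
  then have fin: "slope_at_scale r f x < \<infinity>" for x by (rule le_less_trans) simp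
  have [measurable]: "slope_at_scale r f \<in> borel_measurable borel"
    by (rule borel_measurable_slope_at_scale[OF lipschitz_on_continuous_on[OF L]])
  have "norm (enn2real (slope_at_scale r f x)) \<le> L" for x
    using bd[of x] L0 by (simp add: enn2real_leI)
  then have "bounded (range (\<lambda>x. enn2real (slope_at_scale r f x)))" by (auto simp: bounded_iff)
  moreover have "\<bar>f y - f x\<bar> \<le> enn2real (slope_at_scale r f x) * dist x y" if "dist x y < r" for x y
  proof (cases "x = y")
    case False
    then have "ennreal (\<bar>f y - f x\<bar> / dist y x) \<le> slope_at_scale r f x"
      unfolding slope_at_scale_def using that by (intro SUP_upper) auto
    then have "\<bar>f y - f x\<bar> / dist y x \<le> enn2real (slope_at_scale r f x)"
      using fin[of x] by (metis enn2real_ennreal enn2real_mono divide_nonneg_nonneg abs_ge_zero zero_le_dist infinity_ennreal_def)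
    then show ?thesis using False by (simp add: pos_divide_le_eq dist_commute)
  qed simp
  ultimately show ?thesis using f r by (auto simp: slope_majorant_def)
qed

lemma isCont_square_entropy: "isCont square_entropy x"
proof (cases "x = 0")
  case False
  then show ?thesis unfolding square_entropy_def by (intro continuous_intros) auto
next
  case True
  have "((\<lambda>x. x\<^sup>2 * ln (x\<^sup>2)) \<longlongrightarrow> 0) (at (0::real))"
  proof (rule tendsto_sandwich)
    show "\<forall>\<^sub>F x in at 0. - (2 * \<bar>x\<bar>) \<le> x\<^sup>2 * ln ((x::real)\<^sup>2)"
    proof (intro always_eventually allI)
      fix x :: real
      show "- (2 * \<bar>x\<bar>) \<le> x\<^sup>2 * ln (x\<^sup>2)" using minus_x_ln_x_le_sqrt[of "x\<^sup>2"] by simp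
    qed
    show "\<forall>\<^sub>F x in at 0. x\<^sup>2 * ln ((x::real)\<^sup>2) \<le> x\<^sup>2 * x\<^sup>2"
    proof (intro always_eventually allI mult_left_mono)
      fix x :: real
      show "ln (x\<^sup>2) \<le> x\<^sup>2" using ln_le_minus_one[of "x\<^sup>2"] by (cases "x = 0") auto
    qed simp
    show "((\<lambda>x::real. - (2 * \<bar>x\<bar>)) \<longlongrightarrow> 0) (at 0)" by (rule tendsto_eq_intros refl | simp)+
    show "((\<lambda>x::real. x\<^sup>2 * x\<^sup>2) \<longlongrightarrow> 0) (at 0)" by (rule tendsto_eq_intros refl | simp)+
  qed
  then have "(square_entropy \<longlongrightarrow> 0 - 0\<^sup>2 + 1) (at 0)" unfolding square_entropy_def by (intro tendsto_intros)
  then show ?thesis using True by (simp add: isCont_def square_entropy_def)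
qed

context gaussian_CD_space
begin

text \<open>
  Let the scale of the slope majorant tend to \<open>0\<close> under the integral; the Lipschitz constant
  dominates.
\<close>

lemma log_sobolev_bounded_lipschitz:
  obtains C where "0 < C" "\<And>f. bounded_lipschitz f \<Longrightarrow> (\<integral>x. (f x)\<^sup>2 \<partial>M) = 1 \<Longrightarrow>
    (\<integral>\<^sup>+x. ennreal (square_entropy (f x)) \<partial>M) \<le> ennreal C * (\<integral>\<^sup>+x. (local_lip f x)\<^sup>2 \<partial>M)"
proof -
  obtain C where C: "0 < C" and tight: "\<And>f G. \<lbrakk>slope_majorant f G; (\<integral>x. (f x)\<^sup>2 \<partial>M) = 1\<rbrakk> \<Longrightarrow>
    integrable M (\<lambda>x. square_entropy (f x)) \<and> (\<integral>x. square_entropy (f x) \<partial>M) \<le> C * (\<integral>x. (G x)\<^sup>2 \<partial>M)"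
    using tight_log_sobolev_slope_majorant by metis
  have "(\<integral>\<^sup>+x. ennreal (square_entropy (f x)) \<partial>M) \<le> ennreal C * (\<integral>\<^sup>+x. (local_lip f x)\<^sup>2 \<partial>M)"
    if f: "bounded_lipschitz f" and f1: "(\<integral>x. (f x)\<^sup>2 \<partial>M) = 1" for f
  proof -
    obtain L where L: "L-lipschitz_on UNIV f" using f by (auto simp: bounded_lipschitz_def)
    define S where "S n = slope_at_scale (1 / real (Suc n)) f" for n
    have SL: "S n x \<le> ennreal L" for n x unfolding S_def by (rule slope_at_scale_le_lipschitz[OF L])
    then have fin: "S n x < \<infinity>" for n x by (rule le_less_trans) simp
    have [measurable]: "S n \<in> borel_measurable borel" for n
      unfolding S_def by (rule borel_measurable_slope_at_scale[OF lipschitz_on_continuous_on[OF L]])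
    have lim: "(\<lambda>n. S n x) \<longlonglongrightarrow> local_lip f x" for x
      unfolding S_def by (rule slope_at_scale_tendsto_local_lip)
    have [measurable]: "local_lip f \<in> borel_measurable M"
      by (rule borel_measurable_LIMSEQ_order[OF lim]) simp
    have le: "(\<integral>\<^sup>+x. ennreal (square_entropy (f x)) \<partial>M) \<le> ennreal C * (\<integral>\<^sup>+x. (S n x)\<^sup>2 \<partial>M)" for n
    proof -
      let ?G = "\<lambda>x. enn2real (S n x)"
      have G: "slope_majorant f ?G" unfolding S_def by (rule slope_majorant_slope_at_scale[OF f]) simp
      have Gi: "integrable M (\<lambda>x. (?G x)\<^sup>2)"
      proof (rule integrable_bounded_real)
        fix x
        have "L \<ge> 0" using L by (simp add: lipschitz_on_def)
        then have "?G x \<le> L" using SL[of n x] by (simp add: enn2real_leI)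
        then show "\<bar>(?G x)\<^sup>2\<bar> \<le> L\<^sup>2" by (simp add: power_mono)
      qed measurable
      have "(\<integral>\<^sup>+x. ennreal (square_entropy (f x)) \<partial>M) = ennreal (\<integral>x. square_entropy (f x) \<partial>M)"
        using tight[OF G f1] square_entropy_nonneg by (intro nn_integral_eq_integral) auto
      also have "\<dots> \<le> ennreal (C * (\<integral>x. (?G x)\<^sup>2 \<partial>M))" using tight[OF G f1] by (intro ennreal_leI) simp
      also have "\<dots> = ennreal C * ennreal (\<integral>x. (?G x)\<^sup>2 \<partial>M)" using C by (simp add: ennreal_mult)
      also have "ennreal (\<integral>x. (?G x)\<^sup>2 \<partial>M) = (\<integral>\<^sup>+x. ennreal ((?G x)\<^sup>2) \<partial>M)"
        using Gi by (intro nn_integral_eq_integral[symmetric]) auto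
      also have "\<dots> = (\<integral>\<^sup>+x. (S n x)\<^sup>2 \<partial>M)"
        using fin by (intro nn_integral_cong) (simp add: ennreal_power[symmetric] ennreal_enn2real)
      finally show ?thesis .
    qed
    have "(\<lambda>n. \<integral>\<^sup>+x. (S n x)\<^sup>2 \<partial>M) \<longlonglongrightarrow> (\<integral>\<^sup>+x. (local_lip f x)\<^sup>2 \<partial>M)"
    proof (rule nn_integral_dominated_convergence[where w="\<lambda>_. (ennreal L)\<^sup>2"])
      show "AE x in M. (S n x)\<^sup>2 \<le> (ennreal L)\<^sup>2" for n by (intro AE_I2 power_mono SL) simp
      show "(\<integral>\<^sup>+x. (ennreal L)\<^sup>2 \<partial>M) < \<infinity>" by (simp add: emeasure_space_1 power2_eq_square ennreal_mult_less_top)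
      show "AE x in M. (\<lambda>n. (S n x)\<^sup>2) \<longlonglongrightarrow> (local_lip f x)\<^sup>2"
      proof (intro AE_I2)
        fix x
        have "local_lip f x \<le> ennreal L" using lim[of x] by (rule LIMSEQ_le_const2) (use SL in auto)
        then have "local_lip f x \<noteq> \<infinity>" by (auto simp: top_unique)
        then show "(\<lambda>n. (S n x)\<^sup>2) \<longlonglongrightarrow> (local_lip f x)\<^sup>2"
          unfolding power2_eq_square by (intro tendsto_mult_ennreal lim) auto
      qed
    qed auto
    then have "(\<lambda>n. ennreal C * (\<integral>\<^sup>+x. (S n x)\<^sup>2 \<partial>M)) \<longlonglongrightarrow> ennreal C * (\<integral>\<^sup>+x. (local_lip f x)\<^sup>2 \<partial>M)"
      by (intro ennreal_tendsto_cmult) auto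
    then show ?thesis by (rule LIMSEQ_le_const) (use le in auto)
  qed
  with C that show thesis by blast
qed

lemma log_sobolev_bounded_lipschitz_scaled:
  obtains C where "0 < C" "\<And>f. bounded_lipschitz f \<Longrightarrow> 0 < (\<integral>x. (f x)\<^sup>2 \<partial>M) \<Longrightarrow>
    (\<integral>\<^sup>+x. ennreal (square_entropy (f x / sqrt (\<integral>x. (f x)\<^sup>2 \<partial>M))) \<partial>M) \<le>
      ennreal (C / (\<integral>x. (f x)\<^sup>2 \<partial>M)) * (\<integral>\<^sup>+x. (local_lip f x)\<^sup>2 \<partial>M)"
proof -
  obtain C where C: "0 < C" and LS: "\<And>f. bounded_lipschitz f \<Longrightarrow> (\<integral>x. (f x)\<^sup>2 \<partial>M) = 1 \<Longrightarrow>
    (\<integral>\<^sup>+x. ennreal (square_entropy (f x)) \<partial>M) \<le> ennreal C * (\<integral>\<^sup>+x. (local_lip f x)\<^sup>2 \<partial>M)"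
    using log_sobolev_bounded_lipschitz by metis
  have "(\<integral>\<^sup>+x. ennreal (square_entropy (f x / sqrt (\<integral>x. (f x)\<^sup>2 \<partial>M))) \<partial>M) \<le>
      ennreal (C / (\<integral>x. (f x)\<^sup>2 \<partial>M)) * (\<integral>\<^sup>+x. (local_lip f x)\<^sup>2 \<partial>M)"
    if f: "bounded_lipschitz f" and N0: "0 < (\<integral>x. (f x)\<^sup>2 \<partial>M)" for f
  proof -
    let ?N = "\<integral>x. (f x)\<^sup>2 \<partial>M"
    define a where "a = 1 / sqrt ?N"
    have a: "0 < a" "a\<^sup>2 = 1 / ?N" using N0 by (auto simp: a_def power_divide)
    have "(\<integral>x. (a * f x)\<^sup>2 \<partial>M) = 1" using N0 a(2) by (simp add: power_mult_distrib)
    then have "(\<integral>\<^sup>+x. ennreal (square_entropy (a * f x)) \<partial>M) \<le> ennreal C * (\<integral>\<^sup>+x. (local_lip (\<lambda>x. a * f x) x)\<^sup>2 \<partial>M)"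
      by (intro LS bounded_lipschitz_cmult f)
    also have "\<dots> \<le> ennreal C * (\<integral>\<^sup>+x. ennreal (a\<^sup>2) * (local_lip f x)\<^sup>2 \<partial>M)"
    proof (intro mult_left_mono nn_integral_mono)
      fix x
      show "(local_lip (\<lambda>x. a * f x) x)\<^sup>2 \<le> ennreal (a\<^sup>2) * (local_lip f x)\<^sup>2"
        using power_mono[OF local_lip_cmult_le[of a f x], of 2] a(1)
        by (simp add: power_mult_distrib ennreal_power)
    qed simp
    also have "\<dots> \<le> ennreal C * (ennreal (a\<^sup>2) * (\<integral>\<^sup>+x. (local_lip f x)\<^sup>2 \<partial>M))"
      using a(1) by (intro mult_left_mono nn_integral_cmult_pos_le) auto
    also have "\<dots> = ennreal (C / ?N) * (\<integral>\<^sup>+x. (local_lip f x)\<^sup>2 \<partial>M)"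
      using C N0 by (simp add: a(2) mult.assoc[symmetric] ennreal_mult[symmetric])
    finally show ?thesis by (simp add: a_def)
  qed
  with C that show thesis by blast
qed

end

section \<open>Passage to the Cheeger energy\<close>

lemma L2_tendsto_integral_square:
  assumes F: "\<And>n. F n \<in> L2 M" and f: "f \<in> L2 M"
    and lim: "(\<lambda>n. L2_norm M (\<lambda>x. F n x - f x)) \<longlonglongrightarrow> 0"
  shows "integrable M (\<lambda>x. (F n x - f x)\<^sup>2)"
    and "(\<lambda>n. \<integral>x. (F n x - f x)\<^sup>2 \<partial>M) \<longlonglongrightarrow> 0"
    and "(\<lambda>n. \<integral>x. (F n x)\<^sup>2 \<partial>M) \<longlonglongrightarrow> (\<integral>x. (f x)\<^sup>2 \<partial>M)"
proof -
  have i: "integrable M (\<lambda>x. (F n x - f x)\<^sup>2)" for n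
    using L2_add[OF F L2_cmult[OF f, of "-1"]] by (simp add: L2_def)
  then show "integrable M (\<lambda>x. (F n x - f x)\<^sup>2)" .
  have Fi: "integrable M (\<lambda>x. (F n x)\<^sup>2)" and fi: "integrable M (\<lambda>x. (f x)\<^sup>2)" for n
    using F f by (auto simp: L2_def)
  let ?e = "\<lambda>n. \<integral>x. (F n x - f x)\<^sup>2 \<partial>M" and ?f = "\<integral>x. (f x)\<^sup>2 \<partial>M"
  have "(\<lambda>n. (L2_norm M (\<lambda>x. F n x - f x))\<^sup>2) \<longlonglongrightarrow> 0\<^sup>2" by (intro tendsto_intros lim)
  then show e: "?e \<longlonglongrightarrow> 0" by (simp add: L2_norm_def)
  have bound: "\<bar>(\<integral>x. (F n x)\<^sup>2 \<partial>M) - ?f\<bar> \<le> s * ?f + (1 + 1 / s) * ?e n" if s: "0 < s" for n s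
  proof -
    have pw: "\<bar>(F n x)\<^sup>2 - (f x)\<^sup>2\<bar> \<le> s * (f x)\<^sup>2 + (1 + 1 / s) * (F n x - f x)\<^sup>2" for x
    proof -
      define d where "d = F n x - f x"
      have Fd: "F n x = f x + d" by (simp add: d_def)
      have "0 \<le> (s * f x - d)\<^sup>2 / s" "0 \<le> (s * f x + d)\<^sup>2 / s" using s by auto
      moreover have "(s * f x - d)\<^sup>2 / s = s * (f x)\<^sup>2 + d\<^sup>2 / s - 2 * f x * d"
        "(s * f x + d)\<^sup>2 / s = s * (f x)\<^sup>2 + d\<^sup>2 / s + 2 * f x * d"
        using s by (auto simp: power2_eq_square field_simps)
      moreover have "(F n x)\<^sup>2 - (f x)\<^sup>2 = 2 * f x * d + d\<^sup>2" by (simp add: Fd power2_eq_square algebra_simps)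
      moreover have "(1 + 1 / s) * d\<^sup>2 = d\<^sup>2 + d\<^sup>2 / s" by (simp add: distrib_right)
      ultimately show ?thesis unfolding d_def[symmetric] using zero_le_power2[of d] by linarith
    qed
    have "\<bar>(\<integral>x. (F n x)\<^sup>2 \<partial>M) - ?f\<bar> = \<bar>\<integral>x. (F n x)\<^sup>2 - (f x)\<^sup>2 \<partial>M\<bar>" using Fi fi by simp
    also have "\<dots> \<le> (\<integral>x. \<bar>(F n x)\<^sup>2 - (f x)\<^sup>2\<bar> \<partial>M)" by (rule integral_abs_bound)
    also have "\<dots> \<le> (\<integral>x. s * (f x)\<^sup>2 + (1 + 1 / s) * (F n x - f x)\<^sup>2 \<partial>M)"
      using Fi fi i pw by (intro integral_mono) auto
    also have "\<dots> = s * ?f + (1 + 1 / s) * ?e n" using fi i by simp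
    finally show ?thesis .
  qed
  show "(\<lambda>n. \<integral>x. (F n x)\<^sup>2 \<partial>M) \<longlonglongrightarrow> ?f"
  proof (rule tendstoI)
    fix r :: real assume r: "0 < r"
    have f0: "0 \<le> ?f" by simp
    define s where "s = r / (2 * (?f + 1))"
    have s: "0 < s" unfolding s_def using r add_nonneg_pos[OF f0 zero_less_one] by (intro divide_pos_pos mult_pos_pos) auto
    have "s * ?f \<le> s * (?f + 1)" using s by simp
    also have "\<dots> = r / 2"
    proof -
      have "r / (2 * c) * c = r / 2" if "c \<noteq> 0" for c using that by simp
      moreover have "?f + 1 \<noteq> 0" using f0 by linarith
      ultimately show ?thesis unfolding s_def by blast
    qed
    finally have sf: "s * ?f \<le> r / 2" .
    have "(\<lambda>n. (1 + 1 / s) * ?e n) \<longlonglongrightarrow> (1 + 1 / s) * 0" by (intro tendsto_intros e)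
    then have "\<forall>\<^sub>F n in sequentially. (1 + 1 / s) * ?e n < r / 2" using r by (intro order_tendstoD) auto
    then show "\<forall>\<^sub>F n in sequentially. dist (\<integral>x. (F n x)\<^sup>2 \<partial>M) ?f < r"
    proof eventually_elim
      case (elim n)
      have "\<bar>a - b\<bar> < r" if "\<bar>a - b\<bar> \<le> u + v" "u \<le> r / 2" "v < r / 2" for a b u v :: real
        using that by linarith
      from this[OF bound[OF s] sf elim] show ?case by (simp add: dist_real_def)
    qed
  qed
qed

text \<open>
  Both sides pass to the relaxation: along a subsequence realising the lower limit of the energies and
  converging almost everywhere, Fatou's lemma gives lower semicontinuity of the left-hand side. The
  approximating functions have to be renormalised in \<open>L\<^sup>2\<close>.
\<close>

lemma (in gaussian_CD_space) log_sobolev_Cheeger: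
  obtains C where "0 < C" "\<And>f. f \<in> L2 M \<Longrightarrow> (\<integral>x. (f x)\<^sup>2 \<partial>M) = 1 \<Longrightarrow>
    (\<integral>\<^sup>+x. ennreal (square_entropy (f x)) \<partial>M) \<le> ennreal C * Ch M f"
proof -
  obtain C where C: "0 < C" and LS: "\<And>f. bounded_lipschitz f \<Longrightarrow> 0 < (\<integral>x. (f x)\<^sup>2 \<partial>M) \<Longrightarrow>
    (\<integral>\<^sup>+x. ennreal (square_entropy (f x / sqrt (\<integral>x. (f x)\<^sup>2 \<partial>M))) \<partial>M) \<le>
      ennreal (C / (\<integral>x. (f x)\<^sup>2 \<partial>M)) * (\<integral>\<^sup>+x. (local_lip f x)\<^sup>2 \<partial>M)"
    using log_sobolev_bounded_lipschitz_scaled by metis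
  have approx: "(\<integral>\<^sup>+x. ennreal (square_entropy (f x)) \<partial>M) \<le>
      ennreal (2 * C) * liminf (\<lambda>n. (\<integral>\<^sup>+x. (local_lip (F n) x)\<^sup>2 \<partial>M) / 2)"
    if f: "f \<in> L2 M" and f1: "(\<integral>x. (f x)\<^sup>2 \<partial>M) = 1" and F: "F \<in> Cheeger_approx M f" for f F
  proof -
    let ?u = "\<lambda>n. (\<integral>\<^sup>+x. (local_lip (F n) x)\<^sup>2 \<partial>M) / 2" and ?N = "\<lambda>n. \<integral>x. (F n x)\<^sup>2 \<partial>M"
    have FL: "\<And>n. F n \<in> L2 M" and Fb: "\<And>n. bounded_lipschitz (F n)"
      and Flim: "(\<lambda>n. L2_norm M (\<lambda>x. F n x - f x)) \<longlonglongrightarrow> 0"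
      using F by (auto simp: Cheeger_approx_def)
    note L2 = L2_tendsto_integral_square[OF FL f Flim]
    have [measurable]: "F n \<in> borel_measurable M" for n using FL by (simp add: L2_def)
    obtain r :: "nat \<Rightarrow> nat" where r: "strict_mono r" "(?u \<circ> r) \<longlonglongrightarrow> liminf ?u"
      using liminf_subseq_lim[of ?u] by blast
    have "(\<lambda>n. \<integral>x. norm ((F (r n) x - f x)\<^sup>2) \<partial>M) \<longlonglongrightarrow> 0"
      using LIMSEQ_subseq_LIMSEQ[OF L2(2) r(1)] by (simp add: comp_def)
    then obtain r' :: "nat \<Rightarrow> nat" where r': "strict_mono r'"
      and ae: "AE x in M. (\<lambda>n. (F (r (r' n)) x - f x)\<^sup>2) \<longlonglongrightarrow> 0"
      using tendsto_L1_AE_subseq[of M "\<lambda>n x. (F (r n) x - f x)\<^sup>2"] L2(1) by blast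
    define q where "q n = r (r' n)" for n
    have q: "strict_mono q" using r(1) r' by (auto simp: q_def strict_mono_def)
    have Nq: "(\<lambda>n. ?N (q n)) \<longlonglongrightarrow> 1"
      using LIMSEQ_subseq_LIMSEQ[OF L2(3) q] f1 by (simp add: comp_def)
    have uq: "(\<lambda>n. ?u (q n)) \<longlonglongrightarrow> liminf ?u"
      using LIMSEQ_subseq_LIMSEQ[OF r(2) r'] by (simp add: comp_def q_def)
    let ?g = "\<lambda>n x. F (q n) x / sqrt (?N (q n))"
    have "AE x in M. ennreal (square_entropy (f x)) = liminf (\<lambda>n. ennreal (square_entropy (?g n x)))"
      using ae
    proof eventually_elim
      case (elim x)
      then have "(\<lambda>n. sqrt ((F (q n) x - f x)\<^sup>2)) \<longlonglongrightarrow> sqrt 0" unfolding q_def by (rule tendsto_real_sqrt)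
      then have "(\<lambda>n. F (q n) x - f x) \<longlonglongrightarrow> 0" by (simp add: tendsto_rabs_zero_iff)
      then have "(\<lambda>n. F (q n) x) \<longlonglongrightarrow> f x" by (simp add: LIM_zero_iff)
      then have "(\<lambda>n. ?g n x) \<longlonglongrightarrow> f x / sqrt 1"
        by (intro tendsto_divide tendsto_real_sqrt Nq) auto
      then have "(\<lambda>n. square_entropy (?g n x)) \<longlonglongrightarrow> square_entropy (f x)"
        using isCont_tendsto_compose[OF isCont_square_entropy, of "\<lambda>n. ?g n x" "f x" sequentially] by simp
      then have "(\<lambda>n. ennreal (square_entropy (?g n x))) \<longlonglongrightarrow> ennreal (square_entropy (f x))" by (rule tendsto_ennrealI)
      then show ?case by (intro lim_imp_Liminf[symmetric]) simp_all
    qed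
    then have "(\<integral>\<^sup>+x. ennreal (square_entropy (f x)) \<partial>M) = (\<integral>\<^sup>+x. liminf (\<lambda>n. ennreal (square_entropy (?g n x))) \<partial>M)"
      by (rule nn_integral_cong_AE)
    also have "\<dots> \<le> liminf (\<lambda>n. \<integral>\<^sup>+x. ennreal (square_entropy (?g n x)) \<partial>M)"
      by (rule nn_integral_liminf) (simp add: square_entropy_def)
    also have "\<dots> \<le> liminf (\<lambda>n. ennreal (2 * C / ?N (q n)) * ?u (q n))"
    proof (rule Liminf_mono)
      have "\<forall>\<^sub>F n in sequentially. 0 < ?N (q n)" using Nq by (rule order_tendstoD) simp
      then show "\<forall>\<^sub>F n in sequentially. (\<integral>\<^sup>+x. ennreal (square_entropy (?g n x)) \<partial>M) \<le> ennreal (2 * C / ?N (q n)) * ?u (q n)"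
      proof eventually_elim
        case (elim n)
        let ?I = "\<integral>\<^sup>+x. (local_lip (F (q n)) x)\<^sup>2 \<partial>M"
        have "ennreal (2 * C / ?N (q n)) = ennreal (C / ?N (q n)) * 2"
          using C elim by (simp add: ennreal_mult''[symmetric] flip: ennreal_numeral)
        then have "ennreal (2 * C / ?N (q n)) * (?I / 2) = ennreal (C / ?N (q n)) * (2 * (?I / 2))"
          by (simp add: mult.assoc)
        also have "2 * (?I / 2) = ?I"
          by (simp add: ennreal_times_divide mult.commute[of 2] ennreal_mult_divide_eq)
        finally show ?case using LS[OF Fb elim] by simp
      qed
    qed
    also have "\<dots> = ennreal (2 * C / 1) * liminf ?u"
    proof (rule lim_imp_Liminf)
      show "(\<lambda>n. ennreal (2 * C / ?N (q n)) * ?u (q n)) \<longlonglongrightarrow> ennreal (2 * C / 1) * liminf ?u"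
        using C by (intro tendsto_mult_ennreal uq tendsto_ennrealI tendsto_divide tendsto_const Nq) auto
    qed simp
    finally show ?thesis by simp
  qed
  have "(\<integral>\<^sup>+x. ennreal (square_entropy (f x)) \<partial>M) \<le> ennreal (2 * C) * Ch M f"
    if f: "f \<in> L2 M" "(\<integral>x. (f x)\<^sup>2 \<partial>M) = 1" for f
  proof -
    have inv: "ennreal (1 / (2 * C)) * (ennreal (2 * C) * y) = y" "ennreal (2 * C) * (ennreal (1 / (2 * C)) * y) = y" for y
      using C by (simp_all add: mult.assoc[symmetric] ennreal_mult[symmetric])
    have "ennreal (1 / (2 * C)) * (\<integral>\<^sup>+x. ennreal (square_entropy (f x)) \<partial>M) \<le> Ch M f"
      unfolding Ch_def
    proof (rule INF_greatest)
      fix F assume "F \<in> Cheeger_approx M f"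
      from mult_left_mono[OF approx[OF f this], of "ennreal (1 / (2 * C))"]
      show "ennreal (1 / (2 * C)) * (\<integral>\<^sup>+x. ennreal (square_entropy (f x)) \<partial>M) \<le> liminf (\<lambda>n. (\<integral>\<^sup>+x. (local_lip (F n) x)\<^sup>2 \<partial>M) / 2)"
        unfolding inv by simp
    qed
    from mult_left_mono[OF this, of "ennreal (2 * C)"] show ?thesis unfolding inv by simp
  qed
  moreover have "0 < 2 * C" using C by simp
  ultimately show thesis using that by blast
qed

lemma dirichlet_form_diagonal:
  assumes "Ch_quadratic M" "f \<in> W12 M"
  shows "dirichlet_form M f f = 2 * enn2real (Ch M f)"
proof -
  have "is_dirichlet_form M (dirichlet_form M)"
    unfolding dirichlet_form_def by (rule theI'[OF dirichlet_form_ex1[OF assms(1)]])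
  then show ?thesis using assms(2) unfolding is_dirichlet_form_def by blast
qed

theorem theorem4p4:
  fixes M :: "'a::polish_space measure" and K :: real
  assumes "K \<ge> 0"
    and "RCD_space (- K) M"
    and "prob_space M"
    and "\<exists>\<epsilon>>0. \<exists>p. (\<integral>\<^sup>+x. ennreal (exp ((K / 2 + \<epsilon>) * (dist p x)\<^sup>2)) \<partial>M) < \<infinity>"
  shows "\<exists>C>0. \<forall>f\<in>W12 M. (\<integral>x. (f x)\<^sup>2 \<partial>M) = 1 \<longrightarrow>
           ext_integral M (\<lambda>x. (f x)\<^sup>2 * ln ((f x)\<^sup>2)) \<le> ereal (C * dirichlet_form M f f)"
proof -
  have CD: "CD_space (- K) M" and quad: "Ch_quadratic M" using assms(2) by (auto simp: RCD_space_def)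
  obtain \<epsilon> p where "0 < \<epsilon>" "(\<integral>\<^sup>+x. ennreal (exp ((K / 2 + \<epsilon>) * (dist p x)\<^sup>2)) \<partial>M) < \<infinity>"
    using assms(4) by auto
  then interpret gaussian_CD_space M K \<epsilon> p
    using assms(1,3) CD
    by (intro gaussian_CD_space.intro borel_prob_space.intro borel_prob_space_axioms.intro gaussian_CD_space_axioms.intro)
       (auto simp: CD_space_def metric_measure_space_def)
  obtain C where C: "0 < C" and LS: "\<And>f. f \<in> L2 M \<Longrightarrow> (\<integral>x. (f x)\<^sup>2 \<partial>M) = 1 \<Longrightarrow>
    (\<integral>\<^sup>+x. ennreal (square_entropy (f x)) \<partial>M) \<le> ennreal C * Ch M f"
    using log_sobolev_Cheeger by metis
  have "ext_integral M (\<lambda>x. (f x)\<^sup>2 * ln ((f x)\<^sup>2)) \<le> ereal (C / 2 * dirichlet_form M f f)"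
    if f: "f \<in> W12 M" and f1: "(\<integral>x. (f x)\<^sup>2 \<partial>M) = 1" for f
  proof -
    have fL: "f \<in> L2 M" and fin: "Ch M f < \<infinity>" using f by (auto simp: W12_def)
    have [measurable]: "f \<in> borel_measurable M" and f2: "integrable M (\<lambda>x. (f x)\<^sup>2)" using fL by (auto simp: L2_def)
    have "Ch M f = ennreal (enn2real (Ch M f))" using fin by (simp add: ennreal_enn2real)
    then have le: "(\<integral>\<^sup>+x. ennreal (square_entropy (f x)) \<partial>M) \<le> ennreal (C * enn2real (Ch M f))"
      using LS[OF fL f1] C by (metis ennreal_mult enn2real_nonneg less_imp_le)
    have \<Psi>m: "(\<lambda>x. square_entropy (f x)) \<in> borel_measurable M" unfolding square_entropy_def by measurable
    have \<Psi>i: "integrable M (\<lambda>x. square_entropy (f x))"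
      using le \<Psi>m square_entropy_nonneg by (intro integrableI_bounded) (auto simp: abs_of_nonneg intro: le_less_trans)
    then have "ennreal (\<integral>x. square_entropy (f x) \<partial>M) \<le> ennreal (C * enn2real (Ch M f))"
      using le square_entropy_nonneg by (subst (asm) nn_integral_eq_integral) auto
    then have int_le: "(\<integral>x. square_entropy (f x) \<partial>M) \<le> C * enn2real (Ch M f)" using C by simp
    have eq: "(f x)\<^sup>2 * ln ((f x)\<^sup>2) = square_entropy (f x) + (f x)\<^sup>2 - 1" for x by (simp add: square_entropy_def)
    have "ext_integral M (\<lambda>x. (f x)\<^sup>2 * ln ((f x)\<^sup>2)) = ereal (\<integral>x. square_entropy (f x) + (f x)\<^sup>2 - 1 \<partial>M)"
      unfolding eq using \<Psi>i f2 by (intro ext_integral_eq_integral) auto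
    also have "(\<integral>x. square_entropy (f x) + (f x)\<^sup>2 - 1 \<partial>M) = (\<integral>x. square_entropy (f x) \<partial>M)"
      using \<Psi>i f2 f1 by (simp add: prob_space)
    also have "ereal \<dots> \<le> ereal (C / 2 * dirichlet_form M f f)"
      using int_le by (simp add: dirichlet_form_diagonal[OF quad f])
    finally show ?thesis .
  qed
  then show ?thesis using C by (intro exI[of _ "C / 2"]) auto
qed

end
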